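(* IC-nets considered up to Euclidean motions and homothety build a real four-dimensional family. An IC-net is uniquely determined by two neighboring circles $\omega_{0,0},\omega_{1,0}$ and the tangent lines $\ell_0,\ell_1,\ell_2,m_0,m_1$.
   Context: Let $\mathbb{P}=\{(i,j)\in\mathbb{Z}^2 \mid m_1<i<m_2,\ n_1<j<n_2\}$ be a rectangle in $\mathbb{Z}^2$; for $f:\mathbb{P}\to\mathbb{R}^2$ write $f_{i,j}=f(i,j)$. An IC-net (inscribed circular net) is a map $f:\mathbb{P}\to\mathbb{R}^2$ such that: (1) for any $i$ the points $\{f_{i,j}\}_j$ lie on a straight line $\ell_i$ preserving the order, i.e. $f_{i,j}$ lies between $f_{i,j-1}$ and $f_{i,j+1}$, and likewise for any $j$ the points $\{f_{i,j}\}_i$ lie on a straight line $m_j$ preserving the order; (2) all unit net-squares, i.e. quadrilaterals $\square_{i,j}=(f_{i,j},f_{i+1,j},f_{i+1,j+1},f_{i,j+1})$, are circumscribed (possess an inscribed circle). The inscribed circle of $\square_{i,j}$ is denoted $\omega_{i,j}$; it touches the lines $\ell_i,\ell_{i+1},m_j,m_{j+1}$. Thus $\omega_{0,0}$ touches $\ell_0,\ell_1,m_0,m_1$, and $\omega_{1,0}$ touches $\ell_1,\ell_2,m_0,m_1$, so that $\ell_1,m_0,m_1$ are common tangent lines of the two (non-intersecting) circles.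
   Formalization: The rectangle contains the squares of the two named circles and must have at least three lines m_j or exactly three lines l_i; in a strip with only m_0, m_1 and four or more lines l_i, the end line can be tilted about its circle, so both claims fail. *)

theory Defs
  imports "HOL-Analysis.Analysis"
begin

definition rect :: "int \<Rightarrow> int \<Rightarrow> int \<Rightarrow> int \<Rightarrow> (int \<times> int) set" where
  "rect m1 m2 n1 n2 = {(i, j). m1 < i \<and> i < m2 \<and> n1 < j \<and> j < n2}"

(* The side itself, and not merely its extension, touches the circle. *)
definition side_touches :: "real ^ 2 \<Rightarrow> real \<Rightarrow> real ^ 2 \<Rightarrow> real ^ 2 \<Rightarrow> bool" where
  "side_touches c r p q \<longleftrightarrow>
     (\<exists>t \<in> closed_segment p q. affine hull {p, q} \<inter> sphere c r = {t})"

(* Vertices are listed in cyclic order.  Since no three of them are collinear and the tangency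
   points lie on the sides, the quadrilateral is automatically convex and contains the circle. *)
definition inscribed_circle ::
    "real ^ 2 \<Rightarrow> real \<Rightarrow> real ^ 2 \<Rightarrow> real ^ 2 \<Rightarrow> real ^ 2 \<Rightarrow> real ^ 2 \<Rightarrow> bool" where
  "inscribed_circle c r p0 p1 p2 p3 \<longleftrightarrow>
     0 < r \<and>
     \<not> collinear {p0, p1, p2} \<and> \<not> collinear {p1, p2, p3} \<and>
     \<not> collinear {p2, p3, p0} \<and> \<not> collinear {p3, p0, p1} \<and>
     side_touches c r p0 p1 \<and> side_touches c r p1 p2 \<and>
     side_touches c r p2 p3 \<and> side_touches c r p3 p0"

definition net_incircle :: "(int \<times> int \<Rightarrow> real ^ 2) \<Rightarrow> int \<Rightarrow> int \<Rightarrow> real ^ 2 \<Rightarrow> real \<Rightarrow> bool" where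
  "net_incircle f i j c r \<longleftrightarrow>
     inscribed_circle c r (f (i, j)) (f (i + 1, j)) (f (i + 1, j + 1)) (f (i, j + 1))"

definition line_l :: "(int \<times> int) set \<Rightarrow> (int \<times> int \<Rightarrow> real ^ 2) \<Rightarrow> int \<Rightarrow> (real ^ 2) set" where
  "line_l P f i = affine hull {f (i, j) |j. (i, j) \<in> P}"

definition line_m :: "(int \<times> int) set \<Rightarrow> (int \<times> int \<Rightarrow> real ^ 2) \<Rightarrow> int \<Rightarrow> (real ^ 2) set" where
  "line_m P f j = affine hull {f (i, j) |i. (i, j) \<in> P}"

definition IC_net :: "(int \<times> int) set \<Rightarrow> (int \<times> int \<Rightarrow> real ^ 2) \<Rightarrow> bool" where
  "IC_net P f \<longleftrightarrow>
     (\<forall>i. collinear {f (i, j) |j. (i, j) \<in> P}) \<and>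
     (\<forall>i j. {(i, j - 1), (i, j), (i, j + 1)} \<subseteq> P \<longrightarrow>
        f (i, j) \<in> open_segment (f (i, j - 1)) (f (i, j + 1))) \<and>
     (\<forall>j. collinear {f (i, j) |i. (i, j) \<in> P}) \<and>
     (\<forall>i j. {(i - 1, j), (i, j), (i + 1, j)} \<subseteq> P \<longrightarrow>
        f (i, j) \<in> open_segment (f (i - 1, j)) (f (i + 1, j))) \<and>
     (\<forall>i j. {(i, j), (i + 1, j), (i + 1, j + 1), (i, j + 1)} \<subseteq> P \<longrightarrow>
        (\<exists>c r. net_incircle f i j c r))"

(* Maps P -> R^2 are represented by functions that are undefined outside P,
   so that equality of functions is equality on P. *)
definition IC_nets :: "(int \<times> int) set \<Rightarrow> (int \<times> int \<Rightarrow> real ^ 2) set" where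
  "IC_nets P = {f \<in> extensional P. IC_net P f}"

definition IC_net_topology :: "(int \<times> int) set \<Rightarrow> (int \<times> int \<Rightarrow> real ^ 2) topology" where
  "IC_net_topology P = subtopology (product_topology (\<lambda>_. euclidean) P) (IC_nets P)"

lemma topspace_IC_net_topology: "topspace (IC_net_topology P) = IC_nets P"
  by (auto simp: IC_net_topology_def IC_nets_def PiE_def)

(* Every product of Euclidean motions and homotheties has the form x \<mapsto> c T x + b below
   (orientation-reversing motions are allowed). *)
definition similar_nets ::
    "(int \<times> int) set \<Rightarrow> ((int \<times> int \<Rightarrow> real ^ 2) \<times> (int \<times> int \<Rightarrow> real ^ 2)) set" where
  "similar_nets P = {(f, g). f \<in> IC_nets P \<and> g \<in> IC_nets P \<and>
     (\<exists>c T b. 0 < c \<and> orthogonal_transformation T \<and> (\<forall>p \<in> P. g p = c *\<^sub>R T (f p) + b))}"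

lemma equiv_similar_nets: "equiv (IC_nets P) (similar_nets P)"
proof (rule equivI)
  show "similar_nets P \<subseteq> IC_nets P \<times> IC_nets P"
    by (auto simp: similar_nets_def)
  show "refl_on (IC_nets P) (similar_nets P)"
  proof (rule refl_onI)
    fix f assume "f \<in> IC_nets P"
    moreover have "\<exists>c T b. 0 < c \<and> orthogonal_transformation T \<and> (\<forall>p \<in> P. f p = c *\<^sub>R T (f p) + b)"
      by (rule exI[of _ 1], rule exI[of _ id], rule exI[of _ 0]) (simp add: orthogonal_transformation_def linear_id)
    ultimately show "(f, f) \<in> similar_nets P"
      by (simp add: similar_nets_def)
  qed
  show "sym (similar_nets P)"
  proof (rule symI)
    fix f g assume "(f, g) \<in> similar_nets P"
    then obtain c T b where fg: "f \<in> IC_nets P" "g \<in> IC_nets P" "0 < c"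
        and T: "orthogonal_transformation T" and eq: "\<forall>p\<in>P. g p = c *\<^sub>R T (f p) + b"
      by (auto simp: similar_nets_def)
    have T': "orthogonal_transformation (inv T)"
      using T by (rule orthogonal_transformation_inv)
    have lin: "linear (inv T)"
      using T' by (simp add: orthogonal_transformation_def)
    have "f p = (1 / c) *\<^sub>R inv T (g p) + (- (1 / c) *\<^sub>R inv T b)" if "p \<in> P" for p
    proof -
      have "inv T (g p) = c *\<^sub>R f p + inv T b"
        using eq that orthogonal_transformation_inj[OF T]
        by (simp add: linear_add[OF lin] linear_scale[OF lin])
      then show ?thesis
        using \<open>0 < c\<close> by (simp add: algebra_simps)
    qed
    then have "\<exists>c T b. 0 < c \<and> orthogonal_transformation T \<and> (\<forall>p \<in> P. f p = c *\<^sub>R T (g p) + b)"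
      using \<open>0 < c\<close> T' by (intro exI[of _ "1 / c"] exI[of _ "inv T"] exI[of _ "- (1 / c) *\<^sub>R inv T b"]) auto
    then show "(g, f) \<in> similar_nets P"
      using fg by (simp add: similar_nets_def)
  qed
  show "trans (similar_nets P)"
  proof (rule transI)
    fix f g h assume "(f, g) \<in> similar_nets P" "(g, h) \<in> similar_nets P"
    then have nets: "f \<in> IC_nets P" "h \<in> IC_nets P"
      and ex: "\<exists>c T b. 0 < c \<and> orthogonal_transformation T \<and> (\<forall>p \<in> P. g p = c *\<^sub>R T (f p) + b)"
        "\<exists>c T b. 0 < c \<and> orthogonal_transformation T \<and> (\<forall>p \<in> P. h p = c *\<^sub>R T (g p) + b)"
      by (simp_all add: similar_nets_def)
    obtain c T b where "0 < c" and T1: "orthogonal_transformation T"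
        and eq1: "\<forall>p\<in>P. g p = c *\<^sub>R T (f p) + b"
      using ex(1) by blast
    obtain c' T' b' where "0 < c'" and T2: "orthogonal_transformation T'"
        and eq2: "\<forall>p\<in>P. h p = c' *\<^sub>R T' (g p) + b'"
      using ex(2) by blast
    have lin: "linear T'"
      using T2 by (simp add: orthogonal_transformation_def)
    have "h p = (c' * c) *\<^sub>R (T' \<circ> T) (f p) + (c' *\<^sub>R T' b + b')" if "p \<in> P" for p
      using eq1 eq2 that by (simp add: linear_add[OF lin] linear_scale[OF lin] algebra_simps)
    moreover have "orthogonal_transformation (T' \<circ> T)"
      using T1 T2 by (simp add: orthogonal_transformation_compose)
    moreover have "0 < c' * c"
      using \<open>0 < c\<close> \<open>0 < c'\<close> by simp
    ultimately have "\<exists>c T b. 0 < c \<and> orthogonal_transformation T \<and> (\<forall>p \<in> P. h p = c *\<^sub>R T (f p) + b)"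
      by blast
    with nets show "(f, h) \<in> similar_nets P"
      by (simp add: similar_nets_def)
  qed
qed

(* Meaningful if R is an equivalence relation on the points of X, see openin_quotient_space. *)
definition quotient_space :: "'a topology \<Rightarrow> ('a \<times> 'a) set \<Rightarrow> 'a set topology" where
  "quotient_space X R = topology (\<lambda>U. U \<subseteq> topspace X // R \<and> openin X (\<Union>U))"

lemma openin_quotient_space:
  assumes "equiv (topspace X) R"
  shows "openin (quotient_space X R) U \<longleftrightarrow> U \<subseteq> topspace X // R \<and> openin X (\<Union>U)"
proof -
  have "istopology (\<lambda>U. U \<subseteq> topspace X // R \<and> openin X (\<Union>U))"
    unfolding istopology_def
  proof (intro conjI allI impI)
    fix S T assume S: "S \<subseteq> topspace X // R \<and> openin X (\<Union>S)"
      and T: "T \<subseteq> topspace X // R \<and> openin X (\<Union>T)"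
    then show "S \<inter> T \<subseteq> topspace X // R" by blast
    have "\<Union>(S \<inter> T) = \<Union>S \<inter> \<Union>T"
      using S T quotient_disj[OF assms] by blast
    then show "openin X (\<Union>(S \<inter> T))" using S T by auto
  next
    fix K assume K: "\<forall>U\<in>K. U \<subseteq> topspace X // R \<and> openin X (\<Union>U)"
    then show "\<Union>K \<subseteq> topspace X // R" by blast
    have "\<Union>(\<Union>K) = \<Union>(Union ` K)" by blast
    then show "openin X (\<Union>(\<Union>K))" using K by auto
  qed
  then show ?thesis by (simp add: quotient_space_def)
qed

definition IC_net_moduli :: "(int \<times> int) set \<Rightarrow> (int \<times> int \<Rightarrow> real ^ 2) set topology" where
  "IC_net_moduli P = quotient_space (IC_net_topology P) (similar_nets P)"

definition topological_manifold :: "nat \<Rightarrow> 'a topology \<Rightarrow> bool" where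
  "topological_manifold n X \<longleftrightarrow>
     Hausdorff_space X \<and> second_countable X \<and>
     (\<forall>x \<in> topspace X. \<exists>U V. openin X U \<and> x \<in> U \<and> openin (Euclidean_space n) V \<and>
        subtopology X U homeomorphic_space subtopology (Euclidean_space n) V)"

end

(*
  Encode an oriented line with unit normal n and offset d as the vector (n, d) of R^3 and a point z as
  hat z = (z, -1).  A circle with centre c and radius r is inscribed in the square cut out by the lines
  p_i, p_{i+1}, q_j, q_{j+1} iff the inner products of hat c with them are r, -r, r, -r.  So four lines
  have a common circle iff the chord from p_i to -p_{i+1} and the chord from q_j to -q_{j+1} are coplanar.

  Given three lines of one family and one line of the other, the next line is the last one reflected in
  the line of the centres of the two circles.  Hence the net is determined by l_0, l_1, l_2, m_0, m_1, and
  up to similarity by four angles between these lines.  Conversely, starting from four angles close to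
  those of a given net, the same construction yields lines for which the circles used in it exist.  The
  existence of the other circles is an incidence theorem: if eight of the nine squares of a 4 by 4 grid of
  lines are circumscribed, so is the ninth, because the six chords are rulings of one central quadric.
  The remaining requirements are strict inequalities, which persist in a neighbourhood.  So the four
  angles identify the moduli space with an open subset of R^4; it is nonempty because of the square grid.
*)

theory Submission
  imports Defs
begin

text \<open>Normals point towards growing indices, so the incircle of a square sees its four lines
  at signed distances r, -r, r, -r: the vectors p_i, -p_(i+1), q_j, -q_(j+1) all lie in the plane of
  those v with hat c . v = r. This is why the chord ends at -p_(i+1). The quadric has to be central
  because a chord from p_i to -p_(i+1) on it then puts p_(i+1) on it too, which is the start of the
  next chord. Building the quadric takes linearly independent q_0, q_1, q_2; the dependent case has
  a proof of its own.

  A strip of squares between only two lines m_0, m_1 leaves the direction of each further line l_3,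
  l_4, ... free, since every new square asks for just one new tangent. A third line m_2 removes this
  freedom. Hence the assumption that there are at least three lines m_j or exactly three lines l_i.

  An explicit continuous inverse of the four coordinates gives both the homeomorphism and the
  openness of its image, so invariance of domain does not enter.\<close>

section \<open>Linear algebra with the cross product\<close>

lemma parallel_cross3:
  fixes u v :: "real^3"
  assumes "cross3 u v = 0" "u \<noteq> 0"
  shows "\<exists>k. v = k *\<^sub>R u"
proof -
  have "cross3 u (cross3 u v) = (u \<bullet> v) *\<^sub>R u - (u \<bullet> u) *\<^sub>R v"
    by (rule Lagrange)
  then have "(u \<bullet> u) *\<^sub>R v = (u \<bullet> v) *\<^sub>R u"
    using assms by simp
  then have "v = ((u \<bullet> v) / (u \<bullet> u)) *\<^sub>R u"
    using assms(2) by (metis divide_inverse_commute inner_eq_zero_iff scaleR_one scaleR_scaleR left_inverse)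
  then show ?thesis by blast
qed

lemma orthogonal_two_cross3:
  fixes u v w :: "real^3"
  assumes "w \<bullet> u = 0" "w \<bullet> v = 0" "cross3 u v \<noteq> 0"
  shows "\<exists>k. w = k *\<^sub>R cross3 u v"
proof -
  have "cross3 (cross3 u v) w = 0"
    using assms(1,2) Lagrange[of w u v] cross_skew[of w "cross3 u v"]
    by (simp add: inner_commute)
  then show ?thesis using parallel_cross3 assms(3) by blast
qed

text \<open>With n = u x v, Lagrange's formula turns n x (w x n) into (n . n) w because w is
  orthogonal to n; expanding w x n first leaves only multiples of u and v.\<close>

lemma span_two_cross3:
  fixes u v w :: "real^3"
  assumes "w \<bullet> cross3 u v = 0" "cross3 u v \<noteq> 0"
  shows "\<exists>s t. w = s *\<^sub>R u + t *\<^sub>R v"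
proof -
  let ?n = "cross3 u v"
  have eq: "cross3 ?n (cross3 w ?n) = (?n \<bullet> ?n) *\<^sub>R w"
    using Lagrange[of ?n w ?n] assms(1) by (simp add: inner_commute)
  have "cross3 w ?n = (w \<bullet> v) *\<^sub>R u - (w \<bullet> u) *\<^sub>R v"
    by (rule Lagrange)
  moreover have "cross3 ?n u = (u \<bullet> u) *\<^sub>R v - (u \<bullet> v) *\<^sub>R u"
    using Lagrange[of u u v] cross_skew[of ?n u] by simp
  moreover have "cross3 ?n v = (v \<bullet> u) *\<^sub>R v - (v \<bullet> v) *\<^sub>R u"
    using Lagrange[of v u v] cross_skew[of ?n v] by simp
  ultimately have "(?n \<bullet> ?n) *\<^sub>R w = (w \<bullet> v) *\<^sub>R ((u \<bullet> u) *\<^sub>R v - (u \<bullet> v) *\<^sub>R u)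
      - (w \<bullet> u) *\<^sub>R ((v \<bullet> u) *\<^sub>R v - (v \<bullet> v) *\<^sub>R u)"
    using eq by (simp add: Cross3.right_diff_distrib cross_mult_right)
  also have "\<dots> = ((w \<bullet> u) * (v \<bullet> v) - (w \<bullet> v) * (u \<bullet> v)) *\<^sub>R u
      + ((w \<bullet> v) * (u \<bullet> u) - (w \<bullet> u) * (v \<bullet> u)) *\<^sub>R v"
    by (simp add: algebra_simps)
  finally have "w = (1 / (?n \<bullet> ?n)) *\<^sub>R (((w \<bullet> u) * (v \<bullet> v) - (w \<bullet> v) * (u \<bullet> v)) *\<^sub>R u
      + ((w \<bullet> v) * (u \<bullet> u) - (w \<bullet> u) * (v \<bullet> u)) *\<^sub>R v)"
    using assms(2) by (metis divide_inverse_commute inner_eq_zero_iff scaleR_one scaleR_scaleR left_inverse mult.right_neutral)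
  then show ?thesis by (metis scaleR_add_right scaleR_scaleR)
qed

definition triple3 :: "real^3 \<Rightarrow> real^3 \<Rightarrow> real^3 \<Rightarrow> real" where
  "triple3 a b c = a \<bullet> cross3 b c"

text \<open>
  If a circle with centre \<open>c\<close> touches \<open>a\<close>, \<open>b\<close> and \<open>z\<close>, with \<open>b\<close> oriented away from it, then \<open>circ a b z\<close>
  is a multiple of \<open>(c, - 1)\<close>.
\<close>

definition circ :: "real^3 \<Rightarrow> real^3 \<Rightarrow> real^3 \<Rightarrow> real^3" where
  "circ a b z = cross3 b z + cross3 a z + cross3 a b"

lemma circ_inner:
  "circ a b z \<bullet> a = triple3 a b z" "circ a b z \<bullet> b = - triple3 a b z" "circ a b z \<bullet> z = triple3 a b z"
  by (simp_all add: circ_def triple3_def cross3_simps)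

text \<open>\<open>circ a b z \<bullet> (z + z') = 0\<close> says that \<open>z'\<close> touches the
  circle of \<open>a\<close>, \<open>b\<close>, \<open>z\<close>. The identity exchanges the two
  pairs of lines, so a condition created by a step in one family can be read as one about the
  other.\<close>

lemma circ_swap: "circ a b z \<bullet> (z + z') = circ z z' a \<bullet> (a + b)"
  by (simp add: circ_def cross3_simps)

text \<open>The right-hand side is the determinant that vanishes iff the chord from \<open>a\<close>
  to \<open>- b\<close> and the chord from \<open>z\<close> to \<open>- z'\<close> are
  coplanar.\<close>

lemma circ_determinant: "circ a b z \<bullet> (z + z') = (a - z) \<bullet> cross3 (a + b) (z + z')"
  by (simp add: circ_def cross3_simps)

lemma triple3_rotate: "triple3 a b c = triple3 b c a"
  by (simp add: triple3_def cross3_simps)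

lemma triple3_cross: "triple3 a b c = cross3 a b \<bullet> c"
  by (simp add: triple3_def cross3_simps)

lemma triple3_span: "triple3 u v (s *\<^sub>R u + t *\<^sub>R v) = 0"
  by (simp add: triple3_def cross3_simps)

section \<open>The incidence theorem\<close>

text \<open>The polynomial with leading coefficient \<alpha>, linear coefficient -2 \<beta> and
  constant term 0 has the three roots 0, \<open>s\<close>, \<open>t\<close>.\<close>

lemma three_points_on_quadric:
  fixes \<alpha> \<beta> s t :: real
  assumes "s\<^sup>2 * \<alpha> = 2 * s * \<beta>" "t\<^sup>2 * \<alpha> = 2 * t * \<beta>" "s \<noteq> 0" "t \<noteq> 0" "s \<noteq> t"
  shows "\<alpha> = 0 \<and> \<beta> = 0"
proof -
  have s: "s * \<alpha> = 2 * \<beta>" and t: "t * \<alpha> = 2 * \<beta>"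
    using assms by (simp_all add: power2_eq_square)
  then have "(s - t) * \<alpha> = 0" by (simp add: algebra_simps)
  then have "\<alpha> = 0" using assms(5) by simp
  then show ?thesis using s by simp
qed

text \<open>The form is given by its operator \<open>L\<close> because half the gradient of the
  quadratic form at \<open>u\<close> is \<open>L u\<close>, and it is this vector that is compared
  with cross products.\<close>

locale symmetric_form =
  fixes L :: "real^3 \<Rightarrow> real^3"
  assumes lin: "linear L" and sym: "u \<bullet> L v = v \<bullet> L u"
begin

definition F :: "real^3 \<Rightarrow> real^3 \<Rightarrow> real" where "F u v = u \<bullet> L v"

lemma F_commute: "F u v = F v u"
  by (simp add: F_def sym)

lemma F_simps:
  "F (u + u') v = F u v + F u' v" "F u (v + v') = F u v + F u v'"
  "F (u - u') v = F u v - F u' v" "F u (v - v') = F u v - F u v'"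
  "F (k *\<^sub>R u) v = k * F u v" "F u (k *\<^sub>R v) = k * F u v"
  "F (- u) v = - F u v" "F u (- v) = - F u v"
  using lin
  by (simp_all add: F_def inner_simps linear_add linear_diff linear_scale linear_neg)

lemma line_on_quadric:
  assumes "F u u = 1" "F (u - s *\<^sub>R a) (u - s *\<^sub>R a) = 1" "F (u - t *\<^sub>R a) (u - t *\<^sub>R a) = 1"
    and "s \<noteq> 0" "t \<noteq> 0" "s \<noteq> t"
  shows "F a a = 0 \<and> F u a = 0"
  using assms F_commute[of a u]
  by (intro three_points_on_quadric[of s "F a a" "F u a" t])
    (auto simp: F_simps power2_eq_square algebra_simps)

lemma on_line_quadric:
  assumes "F u u = 1" "F a a = 0" "F u a = 0"
  shows "F (u - s *\<^sub>R a) (u - s *\<^sub>R a) = 1"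
  using assms F_commute[of a u] by (simp add: F_simps)

text \<open>Pairing with \<open>p1\<close> under \<open>F\<close> gives the constant -1 on the first
  line and the constant 1 on the second.\<close>

lemma consecutive_lines_disjoint:
  assumes "F p1 p1 = 1" "F (p0 + p1) p1 = 0" "F (p1 + p2) p1 = 0"
  shows "p0 - s *\<^sub>R (p0 + p1) \<noteq> p1 - t *\<^sub>R (p1 + p2)"
proof
  assume "p0 - s *\<^sub>R (p0 + p1) = p1 - t *\<^sub>R (p1 + p2)"
  then have "F (p0 - s *\<^sub>R (p0 + p1)) p1 = F (p1 - t *\<^sub>R (p1 + p2)) p1" by simp
  moreover have "F p0 p1 = -1" "F p2 p1 = -1" using assms by (simp_all add: F_simps)
  ultimately show False using assms(1) by (simp add: F_simps)
qed

text \<open>\<open>L a\<close> is orthogonal to both \<open>u\<close> and \<open>a\<close>, hence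
  proportional to the moment u x a of the ruling through \<open>u\<close> in direction
  \<open>a\<close>; \<open>w\<close> witnesses that it is non-zero.\<close>

lemma gradient_multiple:
  assumes "F a a = 0" "F u a = 0" "cross3 u a \<noteq> 0" "F w a \<noteq> 0"
  shows "\<exists>\<sigma>. \<sigma> \<noteq> 0 \<and> L a = \<sigma> *\<^sub>R cross3 u a"
proof -
  have "L a \<bullet> u = 0" "L a \<bullet> a = 0"
    using assms(1,2) by (simp_all add: F_def inner_commute)
  then obtain \<sigma> where "L a = \<sigma> *\<^sub>R cross3 u a"
    using orthogonal_two_cross3[OF _ _ assms(3)] by blast
  moreover have "L a \<noteq> 0" using assms(4) by (auto simp: F_def)
  ultimately show ?thesis by auto
qed

text \<open>The determinant is the mutual moment b . (u x a) + a . (v x b) of the two lines. Each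
  summand is \<open>F a b\<close> divided by the factor of one gradient, so the sum is
  \<open>F a b\<close> times 1/\<sigma> + 1/\<tau>.\<close>

lemma chords_coplanar_iff:
  assumes "F u u = 1" "F a a = 0" "F u a = 0" "F b b = 0" "cross3 a b \<noteq> 0"
    and a: "L a = \<sigma> *\<^sub>R cross3 u a" "\<sigma> \<noteq> 0" and b: "L b = \<tau> *\<^sub>R cross3 v b" "\<tau> \<noteq> 0"
    and "cross3 u a \<noteq> 0"
  shows "(u - v) \<bullet> cross3 a b = 0 \<longleftrightarrow> \<sigma> + \<tau> = 0"
proof -
  have ba: "b \<bullet> cross3 u a = F a b / \<sigma>" and ab: "a \<bullet> cross3 v b = F a b / \<tau>"
    using a b F_commute[of a b] by (simp_all add: F_def eq_divide_eq mult.commute)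
  have "(u - v) \<bullet> cross3 a b = b \<bullet> cross3 u a + a \<bullet> cross3 v b"
    by (simp add: cross3_simps)
  also have "\<dots> = F a b * ((\<sigma> + \<tau>) / (\<sigma> * \<tau>))"
    using a(2) b(2) by (simp add: ba ab field_simps)
  finally have eq: "(u - v) \<bullet> cross3 a b = F a b * ((\<sigma> + \<tau>) / (\<sigma> * \<tau>))" .
  \<comment> \<open>Otherwise \<open>b\<close> lies in the plane of \<open>u\<close> and
    \<open>a\<close>, where the form is the square of the \<open>u\<close>-coordinate; being
    isotropic, \<open>b\<close> would be parallel to \<open>a\<close>.\<close>
  have "F a b \<noteq> 0"
  proof
    assume "F a b = 0"
    then obtain x y where xy: "b = x *\<^sub>R u + y *\<^sub>R a"
      using ba span_two_cross3[of b u a] assms(10) by auto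
    then have "F b b = x\<^sup>2"
      using assms(1-3) F_commute[of a u] by (simp add: F_simps power2_eq_square)
    then have "b = y *\<^sub>R a" using xy assms(4) by simp
    then show False using assms(5) by (simp add: cross_mult_right)
  qed
  then show ?thesis using eq a(2) b(2) by simp
qed

end

text \<open>The entries -1 make q0 + q1 and q1 + q2 isotropic, which puts both chords on the
  quadric. In the basis q0, q1, q2 one Gram entry is left, \<phi> for q0 against q2. The condition
  at \<open>p\<close> is linear in \<phi> with coefficient 2 x z, and the last two hypotheses say
  that these coordinates of \<open>p\<close> are non-zero.\<close>

lemma ex_form_three_vectors:
  fixes q0 q1 q2 p :: "real^3"
  assumes "triple3 q0 q1 q2 \<noteq> 0" "triple3 p q1 q2 \<noteq> 0" "triple3 q0 q1 p \<noteq> 0"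
  shows "\<exists>L. symmetric_form L \<and> q0 \<bullet> L q0 = 1 \<and> q1 \<bullet> L q1 = 1 \<and> q2 \<bullet> L q2 = 1 \<and>
    q0 \<bullet> L q1 = -1 \<and> q1 \<bullet> L q2 = -1 \<and> p \<bullet> L p = 1"
proof -
  define \<delta> where "\<delta> = triple3 q0 q1 q2"
  define \<xi> \<eta> \<zeta> where "\<xi> = (1/\<delta>) *\<^sub>R cross3 q1 q2" and "\<eta> = (1/\<delta>) *\<^sub>R cross3 q2 q0"
    and "\<zeta> = (1/\<delta>) *\<^sub>R cross3 q0 q1"
  have \<delta>: "\<delta> \<noteq> 0" using assms(1) by (simp add: \<delta>_def)
  have tri: "q0 \<bullet> cross3 q1 q2 = \<delta>" "q1 \<bullet> cross3 q2 q0 = \<delta>" "q2 \<bullet> cross3 q0 q1 = \<delta>"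
    by (simp_all add: \<delta>_def triple3_def cross3_simps)
  have dual: "q0 \<bullet> \<xi> = 1" "q1 \<bullet> \<xi> = 0" "q2 \<bullet> \<xi> = 0" "q0 \<bullet> \<eta> = 0" "q1 \<bullet> \<eta> = 1" "q2 \<bullet> \<eta> = 0"
    "q0 \<bullet> \<zeta> = 0" "q1 \<bullet> \<zeta> = 0" "q2 \<bullet> \<zeta> = 1"
    using \<delta> tri by (simp_all add: \<xi>_def \<eta>_def \<zeta>_def dot_cross_self)
  define x y z where "x = p \<bullet> \<xi>" and "y = p \<bullet> \<eta>" and "z = p \<bullet> \<zeta>"
  have "x \<noteq> 0" "z \<noteq> 0"
    using assms(2) assms(3)[unfolded triple3_cross] \<delta>
    by (simp_all add: x_def z_def \<xi>_def \<zeta>_def triple3_def inner_commute)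
  define \<phi> where "\<phi> = (1 - x\<^sup>2 - y\<^sup>2 - z\<^sup>2 + 2 * x * y + 2 * y * z) / (2 * x * z)"
  define L where "L v = (v \<bullet> \<xi>) *\<^sub>R (\<xi> - \<eta> + \<phi> *\<^sub>R \<zeta>) + (v \<bullet> \<eta>) *\<^sub>R (\<eta> - \<xi> - \<zeta>)
    + (v \<bullet> \<zeta>) *\<^sub>R (\<zeta> - \<eta> + \<phi> *\<^sub>R \<xi>)" for v
  have "linear L"
    unfolding L_def by (rule linearI) (simp_all add: inner_simps algebra_simps)
  moreover have "u \<bullet> L v = v \<bullet> L u" for u v
    by (simp add: L_def inner_simps algebra_simps)
  moreover have "p \<bullet> L p = 1"
  proof -
    have "p \<bullet> L p = x\<^sup>2 + y\<^sup>2 + z\<^sup>2 - 2 * x * y - 2 * y * z + 2 * x * z * \<phi>"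
      by (simp add: L_def inner_simps x_def[symmetric] y_def[symmetric] z_def[symmetric]
          algebra_simps power2_eq_square)
    also have "2 * x * z * \<phi> = 1 - x\<^sup>2 - y\<^sup>2 - z\<^sup>2 + 2 * x * y + 2 * y * z"
      using \<open>x \<noteq> 0\<close> \<open>z \<noteq> 0\<close> by (simp add: \<phi>_def)
    finally show ?thesis by simp
  qed
  ultimately show ?thesis
    by (intro exI[of _ L]) (simp add: symmetric_form_def, simp add: L_def inner_simps dual)
qed

text \<open>\<open>s i j\<close> and \<open>t i j\<close> are the parameters of the common point of
  chord \<open>i\<close> of \<open>p\<close> and chord \<open>j\<close> of \<open>q\<close>.
  Coplanarity is stated as an actual intersection because the argument counts points on a
  line.\<close>

locale line_grid =
  fixes p q :: "nat \<Rightarrow> real^3" and s t :: "nat \<Rightarrow> nat \<Rightarrow> real"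
  assumes meet: "i \<le> 2 \<Longrightarrow> j \<le> 2 \<Longrightarrow> (i, j) \<noteq> (2, 2) \<Longrightarrow>
      p i - s i j *\<^sub>R (p i + p (Suc i)) = q j - t i j *\<^sub>R (q j + q (Suc j))"
    and np: "i \<le> 2 \<Longrightarrow> j \<le> 3 \<Longrightarrow> triple3 (p i) (p (Suc i)) (q j) \<noteq> 0"
    and nq: "i \<le> 3 \<Longrightarrow> j \<le> 2 \<Longrightarrow> triple3 (q j) (q (Suc j)) (p i) \<noteq> 0"
    and npar: "i \<le> 2 \<Longrightarrow> j \<le> 2 \<Longrightarrow> cross3 (p i + p (Suc i)) (q j + q (Suc j)) \<noteq> 0"
begin

abbreviation "a i \<equiv> p i + p (Suc i)"
abbreviation "b j \<equiv> q j + q (Suc j)"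

lemma cross_p: "i \<le> 2 \<Longrightarrow> cross3 (p i) (p (Suc i)) \<noteq> 0"
  using np[of i 0] by (auto simp: triple3_cross)

lemma cross_q: "j \<le> 2 \<Longrightarrow> cross3 (q j) (q (Suc j)) \<noteq> 0"
  using nq[of 0 j] by (auto simp: triple3_cross)

lemma not_on_chord_p: "i \<le> 2 \<Longrightarrow> j \<le> 3 \<Longrightarrow> q j \<noteq> p i - k *\<^sub>R a i"
proof
  assume ij: "i \<le> 2" "j \<le> 3" and "q j = p i - k *\<^sub>R a i"
  then have "q j = (1 - k) *\<^sub>R p i + (- k) *\<^sub>R p (Suc i)" by (simp add: algebra_simps)
  then show False using np[OF ij] triple3_span by metis
qed

lemma not_on_chord_q: "i \<le> 3 \<Longrightarrow> j \<le> 2 \<Longrightarrow> p i \<noteq> q j - k *\<^sub>R b j"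
proof
  assume ij: "i \<le> 3" "j \<le> 2" and "p i = q j - k *\<^sub>R b j"
  then have "p i = (1 - k) *\<^sub>R q j + (- k) *\<^sub>R q (Suc j)" by (simp add: algebra_simps)
  then show False using nq[OF ij] triple3_span by metis
qed

text \<open>
  Some central quadric \<open>F = 1\<close> contains the chords of \<open>q 0, q 1\<close> and of \<open>q 1, q 2\<close> and passes through
  \<open>p 1\<close>.  A line meeting it in three points lies on it, so it successively contains all six chords.
  Along such a chord the gradient of \<open>F\<close> is a multiple of the moment of the chord, and two chords
  are coplanar iff the two factors are opposite; hence eight coplanarities force the ninth.
\<close>

lemma incidence_generic:
  assumes q012: "triple3 (q 0) (q 1) (q 2) \<noteq> 0"
  shows "(p 2 - q 2) \<bullet> cross3 (a 2) (b 2) = 0"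
proof -
  have "triple3 (p 1) (q 1) (q 2) \<noteq> 0" "triple3 (q 0) (q 1) (p 1) \<noteq> 0"
    using nq[of 1 0] nq[of 1 1] triple3_rotate[of "p 1" "q 1" "q 2"] by (simp_all add: numeral_2_eq_2)
  from ex_form_three_vectors[OF q012 this]
  obtain L where "symmetric_form L" and L: "q 0 \<bullet> L (q 0) = 1" "q 1 \<bullet> L (q 1) = 1" "q 2 \<bullet> L (q 2) = 1"
    "q 0 \<bullet> L (q 1) = -1" "q 1 \<bullet> L (q 2) = -1" "p 1 \<bullet> L (p 1) = 1"
    by blast
  interpret symmetric_form L by fact
  have S: "Suc 0 = 1" "Suc 1 = 2" by simp_all
  have Fq: "F (q 0) (q 0) = 1" "F (q 1) (q 1) = 1" "F (q 2) (q 2) = 1"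
    "F (q 0) (q 1) = -1" "F (q 1) (q 0) = -1" "F (q 1) (q 2) = -1" "F (q 2) (q 1) = -1"
    and Fp1: "F (p 1) (p 1) = 1"
    using L F_commute unfolding F_def by metis+
  have mu0: "F (q 0 - k *\<^sub>R b 0) (q 0 - k *\<^sub>R b 0) = 1"
    and mu1: "F (q 1 - k *\<^sub>R b 1) (q 1 - k *\<^sub>R b 1) = 1" for k
    by (simp_all add: F_simps Fq S algebra_simps del: One_nat_def)
  have disj_q: "q 0 - k *\<^sub>R b 0 \<noteq> q 1 - l *\<^sub>R b 1" for k l
    using consecutive_lines_disjoint[of "q 1" "q 0" "q 2" k l] Fq by (simp add: F_simps S del: One_nat_def)
  have Y0: "F (p i - s i 0 *\<^sub>R a i) (p i - s i 0 *\<^sub>R a i) = 1"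
    and Y1: "F (p i - s i 1 *\<^sub>R a i) (p i - s i 1 *\<^sub>R a i) = 1"
    and s01: "s i 0 \<noteq> s i 1" if "i \<le> 2" for i
  proof -
    have eq: "p i - s i 0 *\<^sub>R a i = q 0 - t i 0 *\<^sub>R b 0" "p i - s i 1 *\<^sub>R a i = q 1 - t i 1 *\<^sub>R b 1"
      using that meet[of i 0] meet[of i 1] by simp_all
    show "F (p i - s i 0 *\<^sub>R a i) (p i - s i 0 *\<^sub>R a i) = 1"
      "F (p i - s i 1 *\<^sub>R a i) (p i - s i 1 *\<^sub>R a i) = 1"
      using mu0 mu1 by (simp_all only: eq)
    show "s i 0 \<noteq> s i 1" using eq disj_q by metis
  qed
  \<comment> \<open>The parameters 0 and 1 belong to \<open>p i\<close> and
    \<open>- p (Suc i)\<close>. One of these serves as the third known point of the quadric on the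
    chord, so it has to differ from the two meeting points.\<close>
  have sn: "s i 0 \<noteq> 0" "s i 0 \<noteq> 1" "s i 1 \<noteq> 0" "s i 1 \<noteq> 1" if "i \<le> 2" for i
  proof -
    show "s i 0 \<noteq> 0" "s i 1 \<noteq> 0"
      using that meet[of i 0] meet[of i 1] not_on_chord_q[of i 0] not_on_chord_q[of i 1]
      by (auto simp del: One_nat_def)
    have *: "p (Suc i) \<noteq> - (q j - k *\<^sub>R b j)" if "j \<le> 2" for j k
    proof -
      show ?thesis
      proof
        assume "p (Suc i) = - (q j - k *\<^sub>R b j)"
        then have "p (Suc i) = (k - 1) *\<^sub>R q j + k *\<^sub>R q (Suc j)" by (simp add: algebra_simps)
        then show False
          using nq[of "Suc i" j] \<open>i \<le> 2\<close> that by (simp add: triple3_span)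
      qed
    qed
    have **: "s i j \<noteq> 1" if "j \<le> 1" for j
    proof
      assume "s i j = 1"
      then have "- p (Suc i) = q j - t i j *\<^sub>R b j"
        using meet[of i j] that \<open>i \<le> 2\<close> by simp
      then have "p (Suc i) = - (q j - t i j *\<^sub>R b j)" by (metis minus_minus)
      then show False using *[of j "t i j"] that by simp
    qed
    then show "s i 0 \<noteq> 1" "s i 1 \<noteq> 1" by simp_all
  qed
  have up: "F (a i) (a i) = 0 \<and> F (p i) (a i) = 0" if "i \<le> 2" "F (p i) (p i) = 1" for i
    using line_on_quadric[OF that(2) Y0 Y1] sn s01 that by blast
  have A1: "F (a 1) (a 1) = 0" "F (p 1) (a 1) = 0" using up[of 1] Fp1 by simp_all
  have "p 2 = a 1 - p 1" by (simp add: S del: One_nat_def)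
  then have p2: "F (p 2) (p 2) = 1"
    using A1 Fp1 F_commute[of "a 1" "p 1"] by (simp add: F_simps S del: One_nat_def)
  have A2: "F (a 2) (a 2) = 0" "F (p 2) (a 2) = 0" using up[of 2] p2 by simp_all
  \<comment> \<open>Chord 0 is run through backwards from \<open>- p 1\<close>: at this stage
    \<open>p 1\<close> is known to lie on the quadric and \<open>p 0\<close> is not. Hence the
    parameters are shifted by 1.\<close>
  have A0: "F (a 0) (a 0) = 0 \<and> F (- p 1) (a 0) = 0"
  proof (rule line_on_quadric)
    show "F (- p 1) (- p 1) = 1" using Fp1 by (simp add: F_simps)
    have "p 0 - k *\<^sub>R a 0 = - p 1 - (k - 1) *\<^sub>R a 0" for k
      by (simp add: algebra_simps S del: One_nat_def)
    then show "F (- p 1 - (s 0 0 - 1) *\<^sub>R a 0) (- p 1 - (s 0 0 - 1) *\<^sub>R a 0) = 1"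
       "F (- p 1 - (s 0 1 - 1) *\<^sub>R a 0) (- p 1 - (s 0 1 - 1) *\<^sub>R a 0) = 1"
      using Y0[of 0] Y1[of 0] by simp_all
  qed (use sn[of 0] s01[of 0] in auto)
  then have A0': "F (a 0) (a 0) = 0" "F (a 0) (p 1) = 0" "F (p 1) (a 0) = 0"
    using F_commute[of "a 0" "p 1"] by (simp_all add: F_simps)
  have A0p: "F (p 0) (a 0) = 0"
  proof -
    have "p 0 = a 0 - p 1" by (simp add: S del: One_nat_def)
    then have "F (p 0) (a 0) = F (a 0) (a 0) - F (p 1) (a 0)" by (metis F_simps(3))
    then show ?thesis using A0' by simp
  qed
  have p0: "F (p 0) (p 0) = 1"
  proof -
    have "p 0 = a 0 - p 1" by (simp add: S del: One_nat_def)
    then have "F (p 0) (p 0) = F (a 0 - p 1) (a 0 - p 1)" by metis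
    then show ?thesis using A0' Fp1 by (simp add: F_simps)
  qed
  have disj_p: "p 0 - k *\<^sub>R a 0 \<noteq> p 1 - l *\<^sub>R a 1" for k l
    using consecutive_lines_disjoint[of "p 1" "p 0" "p 2" k l] Fp1 A0' A1 F_commute[of "a 1" "p 1"]
    by (simp add: S del: One_nat_def)
  \<comment> \<open>The three points on chord 2 of \<open>q\<close> are \<open>q 2\<close> and its
    meeting points with the chords 0 and 1 of \<open>p\<close>, which by now lie on the
    quadric.\<close>
  have B2: "F (b 2) (b 2) = 0 \<and> F (q 2) (b 2) = 0"
  proof (rule line_on_quadric[OF Fq(3)])
    show "F (q 2 - t 0 2 *\<^sub>R b 2) (q 2 - t 0 2 *\<^sub>R b 2) = 1"
      using on_line_quadric[OF p0 A0'(1) A0p, of "s 0 2"] meet[of 0 2] by simp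
    show "F (q 2 - t 1 2 *\<^sub>R b 2) (q 2 - t 1 2 *\<^sub>R b 2) = 1"
      using on_line_quadric[OF Fp1 A1, of "s 1 2"] meet[of 1 2] by simp
    show "t 0 2 \<noteq> 0" "t 1 2 \<noteq> 0"
      using meet[of 0 2] meet[of 1 2] not_on_chord_p[of 0 2 "s 0 2"] not_on_chord_p[of 1 2 "s 1 2"] by auto
    show "t 0 2 \<noteq> t 1 2"
      using meet[of 0 2] meet[of 1 2] disj_p[of "s 0 2" "s 1 2"] by auto
  qed
  have B0: "F (b 0) (b 0) = 0" "F (q 0) (b 0) = 0" by (simp_all add: F_simps Fq S del: One_nat_def)
  have ca: "cross3 (p i) (a i) \<noteq> 0" if "i \<le> 2" for i
    using cross_p[OF that] by (simp add: cross_add_right)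
  have cb: "cross3 (q j) (b j) \<noteq> 0" if "j \<le> 2" for j
    using cross_q[OF that] by (simp add: cross_add_right)
  \<comment> \<open>\<open>F (q 1)\<close> takes the values -1 and 1 where chord \<open>i\<close>
    meets the chords 0 and 1 of \<open>q\<close>, so it is not constant along chord
    \<open>i\<close>.\<close>
  have wa: "F (q 1) (a i) \<noteq> 0" if "i \<le> 2" for i
  proof
    assume 0: "F (q 1) (a i) = 0"
    have "F (q 1) (p i - s i 0 *\<^sub>R a i) = -1" "F (q 1) (p i - s i 1 *\<^sub>R a i) = 1"
      using meet[of i 0] meet[of i 1] that
      by (simp_all add: F_simps Fq S del: One_nat_def)
    then show False using 0 by (simp only: F_simps(4,6))
  qed
  have Fp10: "F (p 1) (p 0) = -1"
    using A0'(3) Fp1 by (simp add: F_simps S del: One_nat_def)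
  \<comment> \<open>The same with the families exchanged: \<open>F (p 1)\<close> is -1 on chord 0 of
    \<open>p\<close> and 1 on chord 1.\<close>
  have wb: "F (p 1) (b j) \<noteq> 0" if "j = 0 \<or> j = 2" for j
  proof
    assume 0: "F (p 1) (b j) = 0"
    have "F (p 1) (p 0 - s 0 j *\<^sub>R a 0) = -1" "F (p 1) (p 1 - s 1 j *\<^sub>R a 1) = 1"
      using A0'(3) A1(2) Fp1 Fp10 by (simp_all only: F_simps(4,6))
    moreover have "p 0 - s 0 j *\<^sub>R a 0 = q j - t 0 j *\<^sub>R b j" "p 1 - s 1 j *\<^sub>R a 1 = q j - t 1 j *\<^sub>R b j"
      using meet[of 0 j] meet[of 1 j] that by auto
    ultimately show False using 0 by (simp only: F_simps(4,6))
  qed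
  obtain \<sigma>0 where s0: "\<sigma>0 \<noteq> 0" "L (a 0) = \<sigma>0 *\<^sub>R cross3 (p 0) (a 0)"
    using gradient_multiple[OF A0'(1) A0p ca wa] by auto
  obtain \<sigma>2 where s2: "\<sigma>2 \<noteq> 0" "L (a 2) = \<sigma>2 *\<^sub>R cross3 (p 2) (a 2)"
    using gradient_multiple[OF A2 ca wa] by auto
  obtain \<tau>0 where t0: "\<tau>0 \<noteq> 0" "L (b 0) = \<tau>0 *\<^sub>R cross3 (q 0) (b 0)"
    using gradient_multiple[OF B0 cb wb] by auto
  obtain \<tau>2 where t2: "\<tau>2 \<noteq> 0" "L (b 2) = \<tau>2 *\<^sub>R cross3 (q 2) (b 2)"
    using gradient_multiple[OF conjunct1[OF B2] conjunct2[OF B2] cb wb] by auto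
  have K: "(p i - q j) \<bullet> cross3 (a i) (b j) = 0" if "i \<le> 2" "j \<le> 2" "(i, j) \<noteq> (2, 2)" for i j
  proof -
    have "p i - q j = s i j *\<^sub>R a i - t i j *\<^sub>R b j"
      using meet[OF that] by (simp add: algebra_simps)
    then show ?thesis by (simp only: inner_diff_left inner_scaleR_left dot_cross_self)
  qed
  \<comment> \<open>Only the corners (0,0), (2,0), (0,2), (2,2) are compared: three vanishing sums
    around a rectangle force the fourth.\<close>
  have "\<sigma>0 + \<tau>0 = 0"
    using chords_coplanar_iff[OF p0 A0'(1) A0p B0(1) npar s0(2,1) t0(2,1) ca] K[of 0 0] by simp
  moreover have "\<sigma>2 + \<tau>0 = 0"
    using chords_coplanar_iff[OF p2 A2 B0(1) npar s2(2,1) t0(2,1) ca] K[of 2 0] by simp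
  moreover have "\<sigma>0 + \<tau>2 = 0"
    using chords_coplanar_iff[OF p0 A0'(1) A0p conjunct1[OF B2] npar s0(2,1) t2(2,1) ca] K[of 0 2] by simp
  ultimately have "\<sigma>2 + \<tau>2 = 0" by linarith
  then show ?thesis
    using chords_coplanar_iff[OF p2 A2 conjunct1[OF B2] npar s2(2,1) t2(2,1) ca] by simp
qed

text \<open>Two different common points would give both chords the same direction. The meeting
  equation then makes \<open>u1\<close> itself a multiple of that direction u1 + u2, against the
  independence of \<open>u1\<close> and \<open>u2\<close>.\<close>

lemma consecutive_chords_meet_once:
  assumes "cross3 u1 u2 \<noteq> 0"
    and "u0 - x *\<^sub>R (u0 + u1) = u1 - y *\<^sub>R (u1 + u2)" "u0 - x' *\<^sub>R (u0 + u1) = u1 - y' *\<^sub>R (u1 + u2)"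
  shows "x = x'"
proof (rule ccontr)
  assume "x \<noteq> x'"
  have "(x - x') *\<^sub>R (u0 + u1) = (u0 - x' *\<^sub>R (u0 + u1)) - (u0 - x *\<^sub>R (u0 + u1))"
    by (simp add: scaleR_left_diff_distrib)
  also have "\<dots> = (y - y') *\<^sub>R (u1 + u2)"
    by (simp only: assms(2,3)) (simp add: scaleR_left_diff_distrib)
  finally have "u0 + u1 = ((y - y') / (x - x')) *\<^sub>R (u1 + u2)"
    using \<open>x \<noteq> x'\<close> by (metis divide_inverse_commute eq_iff_diff_eq_0 left_inverse scaleR_one scaleR_scaleR)
  then obtain k where k: "u0 + u1 = k *\<^sub>R (u1 + u2)" by blast
  have "2 *\<^sub>R u1 = (u0 + u1) - x *\<^sub>R (u0 + u1) + y *\<^sub>R (u1 + u2)"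
    using assms(2) by (simp add: scaleR_2 algebra_simps)
  also have "\<dots> = (k - x * k + y) *\<^sub>R (u1 + u2)"
    by (simp only: k) (simp add: algebra_simps)
  finally have eq: "2 *\<^sub>R u1 = (k - x * k + y) *\<^sub>R (u1 + u2)" .
  have "cross3 u1 (2 *\<^sub>R u1) = (k - x * k + y) *\<^sub>R cross3 u1 u2"
    by (simp only: eq) (simp add: cross_mult_right cross_add_right)
  then have "k - x * k + y = 0" using assms(1) by (simp add: cross_mult_right)
  then show False using eq assms(1) by simp
qed

text \<open>
  Here the quadric degenerates, and all six chords pass through one common point \<open>Y\<close>.
\<close>

lemma incidence_concurrent:
  assumes q012: "triple3 (q 0) (q 1) (q 2) = 0"
  shows "(p 2 - q 2) \<bullet> cross3 (a 2) (b 2) = 0"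
proof -
  have S: "Suc 0 = 1" "Suc 1 = 2" by simp_all
  define \<theta> where "\<theta> = cross3 (q 0) (q 1)"
  have \<theta>q: "\<theta> \<bullet> q 0 = 0" "\<theta> \<bullet> q 1 = 0" "\<theta> \<bullet> q 2 = 0"
    using q012 by (simp_all add: \<theta>_def triple3_cross dot_cross_self)
  have \<theta>p: "\<theta> \<bullet> p i \<noteq> 0" if "i \<le> 2" for i
    using nq[of i 0] that by (simp add: \<theta>_def triple3_cross)
  \<comment> \<open>The chord starts off the plane of \<open>q 0\<close> and \<open>q 1\<close>, so
    it meets this plane at most once, while the chords 0 and 1 of \<open>q\<close> both lie in
    it.\<close>
  have s01: "s i 0 = s i 1" if "i \<le> 2" for i
  proof -
    have "\<theta> \<bullet> (p i - s i 0 *\<^sub>R a i) = 0" "\<theta> \<bullet> (p i - s i 1 *\<^sub>R a i) = 0"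
      using meet[of i 0] meet[of i 1] that
      by (simp_all add: inner_diff_right inner_add_right \<theta>q S del: One_nat_def)
    then have "\<theta> \<bullet> p i = s i 0 * (\<theta> \<bullet> a i)" "\<theta> \<bullet> p i = s i 1 * (\<theta> \<bullet> a i)"
      by (simp_all only: inner_diff_right inner_scaleR_right)
    then show ?thesis using \<theta>p[OF that] by auto
  qed
  define Y where "Y = q 0 - t 0 0 *\<^sub>R b 0"
  have Y_p: "p i - s i 0 *\<^sub>R a i = Y" if "i \<le> 2" for i
  proof -
    have "q 0 - t i 0 *\<^sub>R b 0 = q 1 - t i 1 *\<^sub>R b 1" if "i \<le> 2" for i
      using meet[of i 0] meet[of i 1] s01[OF that] that by auto
    then have "t i 0 = t 0 0"
      using consecutive_chords_meet_once[of "q 1" "q 2" "q 0" "t i 0" "t i 1" "t 0 0" "t 0 1"] cross_q[of 1] that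
      by (simp add: S del: One_nat_def)
    then show ?thesis using meet[of i 0] that by (simp add: Y_def)
  qed
  \<comment> \<open>The plane of \<open>p 0\<close> and \<open>p 1\<close> contains
    \<open>Y\<close>, hence also chord 1 of \<open>p\<close>. It does not contain
    \<open>q 2\<close>, so chord 2 of \<open>q\<close> meets the chords 0 and 1 of \<open>p\<close>
    in one and the same point; since these two chords meet only once, it is
    \<open>Y\<close>.\<close>
  define \<psi> where "\<psi> = cross3 (p 0) (p 1)"
  have \<psi>p: "\<psi> \<bullet> p 0 = 0" "\<psi> \<bullet> p 1 = 0" and \<psi>q: "\<psi> \<bullet> q 2 \<noteq> 0"
    using np[of 0 2] by (simp_all add: \<psi>_def triple3_cross dot_cross_self)
  have "\<psi> \<bullet> Y = 0"
    using Y_p[of 0, symmetric] by (simp add: \<psi>p inner_diff_right inner_add_right S del: One_nat_def)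
  then have "\<psi> \<bullet> (p 1 - s 1 0 *\<^sub>R a 1) = 0" using Y_p[of 1] by simp
  then have "s 1 0 * (\<psi> \<bullet> a 1) = 0" by (simp only: inner_diff_right inner_scaleR_right \<psi>p)
  moreover have "s 1 0 \<noteq> 0"
    using Y_p[of 1] not_on_chord_q[of 1 0 "t 0 0"] by (auto simp: Y_def simp del: One_nat_def)
  ultimately have \<psi>a: "\<psi> \<bullet> a 1 = 0" by simp
  have "\<psi> \<bullet> (q 2 - t 0 2 *\<^sub>R b 2) = 0"
    using meet[of 0 2, symmetric] by (simp add: \<psi>p inner_diff_right inner_add_right S del: One_nat_def)
  moreover have "\<psi> \<bullet> (q 2 - t 1 2 *\<^sub>R b 2) = 0"
    using meet[of 1 2, symmetric] \<psi>a by (simp add: \<psi>p inner_diff_right del: One_nat_def)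
  ultimately have "\<psi> \<bullet> q 2 = t 0 2 * (\<psi> \<bullet> b 2)" "\<psi> \<bullet> q 2 = t 1 2 * (\<psi> \<bullet> b 2)"
    by (simp_all only: inner_diff_right inner_scaleR_right)
  then have "t 0 2 = t 1 2" using \<psi>q by auto
  then have "p 0 - s 0 2 *\<^sub>R a 0 = p 1 - s 1 2 *\<^sub>R a 1"
    using meet[of 0 2] meet[of 1 2] by simp
  moreover have "p 0 - s 0 0 *\<^sub>R a 0 = p 1 - s 1 0 *\<^sub>R a 1"
    using Y_p[of 0] Y_p[of 1] by simp
  ultimately have "s 0 2 = s 0 0"
    using consecutive_chords_meet_once[of "p 1" "p 2" "p 0" "s 0 2" "s 1 2" "s 0 0" "s 1 0"] cross_p[of 1]
    by (simp add: S del: One_nat_def)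
  then have "q 2 - t 0 2 *\<^sub>R b 2 = p 2 - s 2 0 *\<^sub>R a 2"
    using meet[of 0 2] Y_p[of 0] Y_p[of 2] by simp
  then have "p 2 - q 2 = s 2 0 *\<^sub>R a 2 - t 0 2 *\<^sub>R b 2"
    by (simp add: algebra_simps)
  then show ?thesis by (simp only: inner_diff_left inner_scaleR_left dot_cross_self)
qed

end

text \<open>Since the bisectors are not parallel, each of the eight coplanarities yields a common
  point of the two chords, which is the form required by \<open>line_grid\<close>.\<close>

theorem incidence_incircles:
  fixes p q :: "nat \<Rightarrow> real^3"
  assumes K: "\<And>i j. i \<le> 2 \<Longrightarrow> j \<le> 2 \<Longrightarrow> (i, j) \<noteq> (2, 2) \<Longrightarrow>
      circ (p i) (p (Suc i)) (q j) \<bullet> (q j + q (Suc j)) = 0"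
    and np: "\<And>i j. i \<le> 2 \<Longrightarrow> j \<le> 3 \<Longrightarrow> triple3 (p i) (p (Suc i)) (q j) \<noteq> 0"
    and nq: "\<And>i j. i \<le> 3 \<Longrightarrow> j \<le> 2 \<Longrightarrow> triple3 (q j) (q (Suc j)) (p i) \<noteq> 0"
    and npar: "\<And>i j. i \<le> 2 \<Longrightarrow> j \<le> 2 \<Longrightarrow> cross3 (p i + p (Suc i)) (q j + q (Suc j)) \<noteq> 0"
  shows "circ (p 2) (p 3) (q 2) \<bullet> (q 2 + q 3) = 0"
proof -
  have "\<exists>s t. p i - s *\<^sub>R (p i + p (Suc i)) = q j - t *\<^sub>R (q j + q (Suc j))"
    if h: "i \<le> 2" "j \<le> 2" "(i, j) \<noteq> (2, 2)" for i j
  proof -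
    have "(p i - q j) \<bullet> cross3 (p i + p (Suc i)) (q j + q (Suc j)) = 0"
      using K[OF h] by (simp add: circ_determinant)
    then obtain s t where "p i - q j = s *\<^sub>R (p i + p (Suc i)) + t *\<^sub>R (q j + q (Suc j))"
      using span_two_cross3[OF _ npar[OF h(1,2)]] by blast
    then have "p i - s *\<^sub>R (p i + p (Suc i)) = q j - (- t) *\<^sub>R (q j + q (Suc j))"
      by (simp add: algebra_simps)
    then show ?thesis by blast
  qed
  then obtain s t where st: "p i - s i j *\<^sub>R (p i + p (Suc i)) = q j - t i j *\<^sub>R (q j + q (Suc j))"
    if "i \<le> 2" "j \<le> 2" "(i, j) \<noteq> (2, 2)" for i j
    by metis
  interpret line_grid p q s t
    by unfold_locales (use st np nq npar in auto)
  have "(p 2 - q 2) \<bullet> cross3 (p 2 + p (Suc 2)) (q 2 + q (Suc 2)) = 0"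
    using incidence_generic incidence_concurrent by blast
  then show ?thesis by (simp add: circ_determinant numeral_3_eq_3)
qed

section \<open>Oriented lines and inscribed circles\<close>

text \<open>
  An oriented line with unit normal \<open>n\<close> and offset \<open>d\<close> is encoded as \<open>(n, d)\<close>, so that its inner
  product with \<open>hat z\<close> is the signed distance of \<open>z\<close> from the line.
\<close>

definition hat :: "real^2 \<Rightarrow> real^3" where
  "hat z = vector [z $ 1, z $ 2, - 1]"

text \<open>The degenerate form on lines that ignores offsets: \<open>ldot u u = 1\<close> says that
  the normal is a unit vector, and for two such lines \<open>ldot u v\<close> is the cosine of the
  angle between the normals.\<close>

definition ldot :: "real^3 \<Rightarrow> real^3 \<Rightarrow> real" where
  "ldot u v = u $ 1 * v $ 1 + u $ 2 * v $ 2"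

definition normal :: "real^3 \<Rightarrow> real^2" where
  "normal u = vector [u $ 1, u $ 2]"

lemma hat_components [simp]: "hat z $ 1 = z $ 1" "hat z $ 2 = z $ 2" "hat z $ 3 = - 1"
  by (simp_all add: hat_def)

lemma normal_components [simp]: "normal u $ 1 = u $ 1" "normal u $ 2 = u $ 2"
  by (simp_all add: normal_def)

lemma inner_hat: "u \<bullet> hat z = normal u \<bullet> z - u $ 3"
  by (simp add: inner_vec_def sum_2 sum_3)

lemma inner_hat_diff: "u \<bullet> hat y - u \<bullet> hat z = normal u \<bullet> (y - z)"
  by (simp add: inner_hat inner_diff_right)

lemma inner_hat_affine: "u \<bullet> hat ((1 - k) *\<^sub>R y + k *\<^sub>R z) = (1 - k) * (u \<bullet> hat y) + k * (u \<bullet> hat z)"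
  by (simp add: inner_hat inner_add_right algebra_simps)

lemma norm_normal: "ldot u u = 1 \<Longrightarrow> norm (normal u) = 1"
  by (simp add: norm_eq_1 ldot_def inner_vec_def sum_2)

lemma normal_minus: "normal (- u) = - normal u"
  by (simp add: vec_eq_iff forall_2)

lemma ldot_minus: "ldot (- u) (- u) = ldot u u"
  by (simp add: ldot_def)

lemma ldot_normal: "ldot u v = normal u \<bullet> normal v"
  by (simp add: ldot_def inner_vec_def sum_2)

lemma eq_if_normal_eq: "normal u = normal v \<Longrightarrow> u $ 3 = v $ 3 \<Longrightarrow> u = v"
  by (simp add: vec_eq_iff forall_2 forall_3)

lemma real2_orthogonal:
  fixes n d :: "real^2"
  assumes "norm n = 1" "n \<bullet> d = 0"
  shows "d = (n $ 1 * d $ 2 - n $ 2 * d $ 1) *\<^sub>R vector [- n $ 2, n $ 1]"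
proof -
  have 1: "n $ 1 * n $ 1 + n $ 2 * n $ 2 = 1" and 2: "n $ 1 * d $ 1 + n $ 2 * d $ 2 = 0"
    using assms by (simp_all add: norm_eq_1 inner_vec_def sum_2)
  have "d $ 1 = (n $ 1 * n $ 1 + n $ 2 * n $ 2) * d $ 1" by (simp add: 1)
  also have "\<dots> = n $ 1 * (n $ 1 * d $ 1 + n $ 2 * d $ 2) - n $ 2 * (n $ 1 * d $ 2 - n $ 2 * d $ 1)"
    by (simp add: algebra_simps)
  finally have a: "d $ 1 = - n $ 2 * (n $ 1 * d $ 2 - n $ 2 * d $ 1)" by (simp add: 2)
  have "d $ 2 = (n $ 1 * n $ 1 + n $ 2 * n $ 2) * d $ 2" by (simp add: 1)
  also have "\<dots> = n $ 2 * (n $ 1 * d $ 1 + n $ 2 * d $ 2) + n $ 1 * (n $ 1 * d $ 2 - n $ 2 * d $ 1)"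
    by (simp add: algebra_simps)
  finally have b: "d $ 2 = n $ 1 * (n $ 1 * d $ 2 - n $ 2 * d $ 1)" by (simp add: 2)
  show ?thesis using a b by (simp add: vec_eq_iff forall_2 mult.commute)
qed

lemma real2_parallel:
  fixes n d e :: "real^2"
  assumes "norm n = 1" "n \<bullet> d = 0" "n \<bullet> e = 0" "d \<noteq> 0"
  shows "\<exists>k. e = k *\<^sub>R d"
proof -
  obtain a b where d: "d = a *\<^sub>R vector [- n $ 2, n $ 1]" and e: "e = b *\<^sub>R vector [- n $ 2, n $ 1]"
    using real2_orthogonal assms(1-3) by blast
  then have "a \<noteq> 0" using assms(4) by auto
  then have "e = (b / a) *\<^sub>R d" by (simp add: d e)
  then show ?thesis by blast
qed

lemma ex_line_through:
  fixes y z :: "real^2"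
  assumes "y \<noteq> z"
  shows "\<exists>u. ldot u u = 1 \<and> u \<bullet> hat y = 0 \<and> u \<bullet> hat z = 0"
proof -
  define l where "l = norm (z - y)"
  define n :: "real^2" where "n = vector [- (z - y) $ 2 / l, (z - y) $ 1 / l]"
  define u :: "real^3" where "u = vector [n $ 1, n $ 2, n \<bullet> y]"
  have "l \<noteq> 0" using assms by (simp add: l_def)
  have l2: "l * l = (z - y) $ 1 * (z - y) $ 1 + (z - y) $ 2 * (z - y) $ 2"
    by (simp add: l_def power2_norm_eq_inner[unfolded power2_eq_square] inner_vec_def sum_2)
  have "ldot u u = ((z - y) $ 1 * (z - y) $ 1 + (z - y) $ 2 * (z - y) $ 2) / (l * l)"
    by (simp add: ldot_def u_def n_def add_divide_distrib diff_divide_distrib algebra_simps)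
  then have "ldot u u = l * l / (l * l)" by (simp only: l2)
  then have "ldot u u = 1" using \<open>l \<noteq> 0\<close> by simp
  moreover have nu: "normal u = n" by (simp add: u_def vec_eq_iff forall_2)
  then have "u \<bullet> hat y = 0" by (simp add: inner_hat u_def)
  moreover have "n \<bullet> (z - y) = 0"
    using \<open>l \<noteq> 0\<close> by (simp add: n_def inner_vec_def sum_2 field_simps)
  then have "u \<bullet> hat z - u \<bullet> hat y = 0" by (simp only: inner_hat_diff nu)
  ultimately show ?thesis by auto
qed

lemma line_eq_or_minus:
  assumes "ldot u u = 1" "ldot v v = 1" "y \<noteq> z"
    and "u \<bullet> hat y = 0" "u \<bullet> hat z = 0" "v \<bullet> hat y = 0" "v \<bullet> hat z = 0"
  shows "v = u \<or> v = - u"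
proof -
  have d: "normal u \<bullet> (z - y) = 0" "normal v \<bullet> (z - y) = 0"
    using assms inner_hat_diff[of u z y] inner_hat_diff[of v z y] by simp_all
  have "z - y \<noteq> 0" using assms(3) by simp
  obtain l where l: "z - y = l *\<^sub>R vector [- normal u $ 2, normal u $ 1]"
    using real2_orthogonal[OF norm_normal[OF assms(1)] d(1)] by blast
  obtain k where k: "z - y = k *\<^sub>R vector [- normal v $ 2, normal v $ 1]"
    using real2_orthogonal[OF norm_normal[OF assms(2)] d(2)] by blast
  have eq: "l * u $ 1 = k * v $ 1" "l * u $ 2 = k * v $ 2"
    using l k by (auto simp: vec_eq_iff forall_2)
  have "l * l = l * l * ldot u u" by (simp add: assms(1))
  also have "\<dots> = (l * u $ 1) * (l * u $ 1) + (l * u $ 2) * (l * u $ 2)"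
    by (simp add: ldot_def algebra_simps)
  also have "\<dots> = k * k * ldot v v"
    by (simp add: eq ldot_def algebra_simps)
  finally have "l * l = k * k" by (simp add: assms(2))
  moreover have "l \<noteq> 0" using l \<open>z - y \<noteq> 0\<close> by auto
  ultimately have "k = l \<or> k = - l" and "k \<noteq> 0"
    by (auto simp: square_eq_iff)
  then have "normal v = normal u \<or> normal v = normal (- u)"
  proof (elim conjE disjE)
    assume "k = l"
    then have "v $ 1 = u $ 1" "v $ 2 = u $ 2" using eq \<open>l \<noteq> 0\<close> by auto
    then show ?thesis by (simp add: vec_eq_iff forall_2)
  next
    assume "k = - l"
    then have "l * (- u $ 1) = l * v $ 1" "l * (- u $ 2) = l * v $ 2" using eq by auto
    then have "v $ 1 = - u $ 1" "v $ 2 = - u $ 2"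
      using \<open>l \<noteq> 0\<close> unfolding mult_cancel_left by auto
    then show ?thesis by (simp add: vec_eq_iff forall_2)
  qed
  moreover have "u $ 3 = normal u \<bullet> y" "v $ 3 = normal v \<bullet> y"
    using assms(4,6) by (simp_all add: inner_hat)
  ultimately show ?thesis
    using eq_if_normal_eq[of v u] eq_if_normal_eq[of v "- u"] by (auto simp: normal_minus)
qed

lemma collinear_if_on_line:
  assumes "ldot u u = 1" "\<And>z. z \<in> S \<Longrightarrow> u \<bullet> hat z = 0"
  shows "collinear S"
  unfolding collinear_def
proof (rule exI[of _ "vector [- normal u $ 2, normal u $ 1]"], intro ballI)
  fix y z assume "y \<in> S" "z \<in> S"
  then have "normal u \<bullet> (y - z) = 0" using assms(2) inner_hat_diff[of u y z] by simp
  then show "\<exists>c. y - z = c *\<^sub>R vector [- normal u $ 2, normal u $ 1]"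
    using real2_orthogonal[OF norm_normal[OF assms(1)]] by blast
qed

lemma on_line_if_collinear:
  assumes "collinear {y, z, x}" "y \<noteq> z" "u \<bullet> hat y = 0" "u \<bullet> hat z = 0"
  shows "u \<bullet> hat x = 0"
proof -
  have "collinear {y, x, z}" using assms(1) by (simp add: insert_commute)
  then obtain k where k: "x = k *\<^sub>R y + (1 - k) *\<^sub>R z"
    using assms(2) unfolding collinear_3_expand by blast
  have "u \<bullet> hat x = u \<bullet> hat ((1 - (1 - k)) *\<^sub>R y + (1 - k) *\<^sub>R z)" by (simp add: k)
  also have "\<dots> = 0" unfolding inner_hat_affine using assms(3,4) by simp
  finally show ?thesis .
qed

lemma affine_hull_eq_line:
  assumes "ldot u u = 1" "y \<noteq> z" "u \<bullet> hat y = 0" "u \<bullet> hat z = 0"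
  shows "affine hull {y, z} = {x. u \<bullet> hat x = 0}"
proof (intro equalityI subsetI)
  fix x assume "x \<in> affine hull {y, z}"
  then obtain a b where "x = a *\<^sub>R y + b *\<^sub>R z" "a + b = 1"
    by (auto simp: affine_hull_2)
  then have "x = (1 - b) *\<^sub>R y + b *\<^sub>R z" by (metis add_diff_cancel_right')
  then show "x \<in> {x. u \<bullet> hat x = 0}" using inner_hat_affine assms by simp
next
  fix x assume "x \<in> {x. u \<bullet> hat x = 0}"
  then have "normal u \<bullet> (z - y) = 0" "normal u \<bullet> (x - y) = 0"
    using assms inner_hat_diff[of u z y] inner_hat_diff[of u x y] by simp_all
  then obtain k where "x - y = k *\<^sub>R (z - y)"
    using real2_parallel[OF norm_normal[OF assms(1)]] assms(2) by (metis right_minus_eq)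
  then have "x = (1 - k) *\<^sub>R y + k *\<^sub>R z" by (simp add: algebra_simps)
  then show "x \<in> affine hull {y, z}" by (simp add: affine_hull_2) (metis diff_add_cancel)
qed

lemma tangent_point_unique:
  fixes n c t :: "real^2"
  assumes "norm n = 1" "norm (t - c) = r" "n \<bullet> (t - c) = - r"
  shows "t = c - r *\<^sub>R n"
proof -
  have "(t - c + r *\<^sub>R n) \<bullet> (t - c + r *\<^sub>R n)
      = (t - c) \<bullet> (t - c) + 2 * r * (n \<bullet> (t - c)) + r * r * (n \<bullet> n)"
    by (simp add: inner_simps inner_commute algebra_simps)
  also have "\<dots> = 0"
    using assms by (simp add: norm_eq_1 power2_norm_eq_inner[symmetric] power2_eq_square)
  finally have "t - c + r *\<^sub>R n = 0" by (simp only: inner_eq_zero_iff)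
  then show ?thesis by (simp add: algebra_simps add_eq_0_iff)
qed

lemma inner_ge_minus_radius:
  fixes n c t :: "real^2"
  assumes "norm n = 1" "norm (t - c) = r"
  shows "n \<bullet> (t - c) \<ge> - r"
  using Cauchy_Schwarz_ineq2[of n "t - c"] assms by simp

text \<open>The mirror image of the contact point in the perpendicular from the centre to the line
  is again on line and circle. As there is only one such point, the contact point is the foot of the
  perpendicular, at distance \<open>r\<close>.\<close>

lemma tangent_line_normal:
  assumes "side_touches c r y z" "y \<noteq> z" "0 < r"
  shows "\<exists>u. ldot u u = 1 \<and> u \<bullet> hat y = 0 \<and> u \<bullet> hat z = 0 \<and> u \<bullet> hat c = r \<and>
    c - r *\<^sub>R normal u \<in> closed_segment y z"
proof -
  obtain v where v: "ldot v v = 1" "v \<bullet> hat y = 0" "v \<bullet> hat z = 0"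
    using ex_line_through[OF assms(2)] by blast
  define u where "u = (if v \<bullet> hat c \<ge> 0 then v else - v)"
  have u: "ldot u u = 1" "u \<bullet> hat y = 0" "u \<bullet> hat z = 0" "u \<bullet> hat c \<ge> 0"
    using v by (auto simp: u_def ldot_minus)
  define h where "h = u \<bullet> hat c"
  obtain t where t: "t \<in> closed_segment y z" "affine hull {y, z} \<inter> sphere c r = {t}"
    using assms(1) unfolding side_touches_def by blast
  have line: "affine hull {y, z} = {x. u \<bullet> hat x = 0}"
    using affine_hull_eq_line[OF u(1) assms(2) u(2,3)] .
  have n1: "norm (normal u) = 1" "normal u \<bullet> normal u = 1"
    using norm_normal[OF u(1)] u(1) by (simp_all add: ldot_normal)
  have tt: "u \<bullet> hat t = 0" "norm (t - c) = r"
    using t(2) line by (auto simp: dist_norm norm_minus_commute)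
  have nt: "normal u \<bullet> (t - c) = - h"
    using inner_hat_diff[of u t c] tt by (simp add: h_def)
  define t' where "t' = 2 *\<^sub>R (c - h *\<^sub>R normal u) - t"
  have t'c: "t' - c = - (t - c) - (2 * h) *\<^sub>R normal u" by (simp add: t'_def algebra_simps scaleR_2)
  have "(t' - c) \<bullet> (t' - c) = (t - c) \<bullet> (t - c) + 4 * h * (normal u \<bullet> (t - c)) + 4 * h * h * (normal u \<bullet> normal u)"
    unfolding t'c by (simp add: inner_simps inner_commute algebra_simps)
  also have "\<dots> = (t - c) \<bullet> (t - c)" by (simp add: nt n1)
  finally have "norm (t' - c) = r" using tt(2) by (simp add: norm_eq_sqrt_inner)
  moreover have "normal u \<bullet> (t' - c) = - (normal u \<bullet> (t - c)) - 2 * h * (normal u \<bullet> normal u)"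
    unfolding t'c by (simp add: inner_simps algebra_simps)
  then have "normal u \<bullet> (t' - c) = - h" by (simp add: nt n1)
  then have "u \<bullet> hat t' = 0" using inner_hat_diff[of u t' c] by (simp add: h_def)
  ultimately have "t' \<in> affine hull {y, z} \<inter> sphere c r"
    by (simp add: line dist_norm norm_minus_commute)
  then have "t' = t" using t(2) by blast
  then have "2 *\<^sub>R (c - h *\<^sub>R normal u) = 2 *\<^sub>R t" by (metis diff_add_cancel scaleR_2 t'_def)
  then have teq: "t = c - h *\<^sub>R normal u" by (metis scaleR_cancel_left zero_neq_numeral)
  then have "norm (t - c) = h" using u(4) n1 by (simp add: h_def)
  then have "h = r" using tt by simp
  then show ?thesis using u t(1) teq by (auto simp: h_def)
qed

text \<open>\<open>u\<close> is the line of the side p0 p1, oriented inwards. One such line per side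
  replaces the conditions on segments and collinearity by equations and strict inequalities.\<close>

definition supports :: "real^2 \<Rightarrow> real \<Rightarrow> real^3 \<Rightarrow> real^2 \<Rightarrow> real^2 \<Rightarrow> real^2 \<Rightarrow> real^2 \<Rightarrow> bool" where
  "supports c r u p0 p1 p2 p3 \<longleftrightarrow> ldot u u = 1 \<and> u \<bullet> hat c = r \<and>
     u \<bullet> hat p0 = 0 \<and> u \<bullet> hat p1 = 0 \<and> 0 < u \<bullet> hat p2 \<and> 0 < u \<bullet> hat p3"

text \<open>The contact point of the side y z lies on the circle, hence not on the negative side of
  \<open>u\<close>; it is not on \<open>u\<close> either, as the two sides would then be one line.
  It lies between \<open>y\<close>, which is on \<open>u\<close>, and \<open>z\<close>, so
  \<open>z\<close> is on the positive side.\<close>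

lemma adjacent_vertex_positive:
  assumes u: "ldot u u = 1" "u \<bullet> hat x = 0" "u \<bullet> hat y = 0" "u \<bullet> hat c = r"
    and v: "ldot v v = 1" "v \<bullet> hat y = 0" "v \<bullet> hat z = 0" "v \<bullet> hat c = r"
      "c - r *\<^sub>R normal v \<in> closed_segment y z"
    and "0 < r" "\<not> collinear {x, y, z}"
  shows "0 < u \<bullet> hat z"
proof -
  define t where "t = c - r *\<^sub>R normal v"
  have n: "norm (normal u) = 1" "norm (normal v) = 1" using u v norm_normal by auto
  have tc: "norm (t - c) = r" using n \<open>0 < r\<close> by (simp add: t_def)
  have ut: "u \<bullet> hat t = r + normal u \<bullet> (t - c)" using inner_hat_diff[of u t c] u by simp
  then have "u \<bullet> hat t \<ge> 0" using inner_ge_minus_radius[OF n(1) tc] by simp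
  moreover have "u \<bullet> hat t \<noteq> 0"
  proof
    assume "u \<bullet> hat t = 0"
    then have "t = c - r *\<^sub>R normal u" using tangent_point_unique[OF n(1) tc] ut by simp
    then have "normal u = normal v" using \<open>0 < r\<close> by (simp add: t_def)
    moreover have "u $ 3 = normal u \<bullet> y" "v $ 3 = normal v \<bullet> y" using u v by (simp_all add: inner_hat)
    ultimately have "u = v" using eq_if_normal_eq by metis
    then have "collinear {x, y, z}"
      using collinear_if_on_line[of u "{x, y, z}"] u v by auto
    then show False using assms by blast
  qed
  ultimately have pos: "u \<bullet> hat t > 0" by simp
  obtain k where k: "t = (1 - k) *\<^sub>R y + k *\<^sub>R z" "0 \<le> k"
    using v(5) by (auto simp: t_def closed_segment_def)
  then have "0 < k * (u \<bullet> hat z)" using pos inner_hat_affine[of u k y z] u by simp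
  then show ?thesis using k(2) by (simp add: zero_less_mult_iff)
qed

text \<open>The contact point is on the circle, hence on the non-negative side of the two
  neighbouring lines \<open>v\<close> and \<open>w\<close>. These two signs bound its parameter on
  the line p0 p1 by 1 and by 0.\<close>

lemma supports_side_touches:
  assumes u: "supports c r u p0 p1 p2 p3" and v: "supports c r v p1 p2 p3 p0"
    and w: "supports c r w p3 p0 p1 p2" and "0 < r"
  shows "side_touches c r p0 p1"
proof -
  define t where "t = c - r *\<^sub>R normal u"
  have n: "norm (normal u) = 1" "norm (normal v) = 1" "norm (normal w) = 1"
    using assms norm_normal by (auto simp: supports_def)
  have tc: "norm (t - c) = r" using n \<open>0 < r\<close> by (simp add: t_def)
  have "p0 \<noteq> p1" using v by (auto simp: supports_def)
  have line: "affine hull {p0, p1} = {x. u \<bullet> hat x = 0}"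
    using affine_hull_eq_line \<open>p0 \<noteq> p1\<close> u by (simp add: supports_def)
  have "normal u \<bullet> (t - c) = - r"
    using n(1) by (simp add: t_def norm_eq_1)
  then have ut: "u \<bullet> hat t = 0" using inner_hat_diff[of u t c] u by (simp add: supports_def)
  have "affine hull {p0, p1} \<inter> sphere c r = {t}"
  proof (intro equalityI subsetI)
    fix x assume "x \<in> affine hull {p0, p1} \<inter> sphere c r"
    then have x: "u \<bullet> hat x = 0" "norm (x - c) = r" using line by (auto simp: dist_norm norm_minus_commute)
    then have "normal u \<bullet> (x - c) = - r" using inner_hat_diff[of u x c] u by (simp add: supports_def)
    then show "x \<in> {t}" using tangent_point_unique[OF n(1) x(2)] by (simp add: t_def)
  qed (use ut tc line in \<open>auto simp: dist_norm norm_minus_commute\<close>)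
  moreover have "t \<in> closed_segment p0 p1"
  proof -
    have "t \<in> affine hull {p0, p1}" using ut line by simp
    then obtain a k where "t = a *\<^sub>R p0 + k *\<^sub>R p1" "a + k = 1" by (auto simp: affine_hull_2)
    then have k: "t = (1 - k) *\<^sub>R p0 + k *\<^sub>R p1" by (metis add_diff_cancel_right')
    have "v \<bullet> hat t \<ge> 0" "w \<bullet> hat t \<ge> 0"
      using inner_ge_minus_radius[OF n(2) tc] inner_ge_minus_radius[OF n(3) tc]
        inner_hat_diff[of v t c] inner_hat_diff[of w t c] v w by (simp_all add: supports_def)
    then have "0 \<le> (1 - k) * (v \<bullet> hat p0)" "0 \<le> k * (w \<bullet> hat p1)"
      using k inner_hat_affine v w by (simp_all add: supports_def)
    then have "0 \<le> 1 - k" "0 \<le> k"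
      using v w by (auto simp: supports_def zero_le_mult_iff)
    then show ?thesis using k by (auto simp: closed_segment_def)
  qed
  ultimately show ?thesis unfolding side_touches_def by blast
qed

lemma not_collinear_if_positive:
  assumes "u \<bullet> hat x = 0" "u \<bullet> hat y = 0" "0 < u \<bullet> hat z" "x \<noteq> y"
  shows "\<not> collinear {x, y, z}"
  using on_line_if_collinear[of x y z u] assms by auto

lemma inscribed_circle_iff_supports:
  "inscribed_circle c r p0 p1 p2 p3 \<longleftrightarrow> 0 < r \<and>
     (\<exists>u0 u1 u2 u3. supports c r u0 p0 p1 p2 p3 \<and> supports c r u1 p1 p2 p3 p0 \<and>
        supports c r u2 p2 p3 p0 p1 \<and> supports c r u3 p3 p0 p1 p2)" (is "?L \<longleftrightarrow> ?R")
proof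
  assume L: ?L
  then have r: "0 < r" and nc: "\<not> collinear {p0, p1, p2}" "\<not> collinear {p1, p2, p3}"
     "\<not> collinear {p2, p3, p0}" "\<not> collinear {p3, p0, p1}"
    and st: "side_touches c r p0 p1" "side_touches c r p1 p2" "side_touches c r p2 p3" "side_touches c r p3 p0"
    by (auto simp: inscribed_circle_def)
  have ne: "p0 \<noteq> p1" "p1 \<noteq> p2" "p2 \<noteq> p3" "p3 \<noteq> p0"
    using nc by auto
  \<comment> \<open>Each side is compared with its successor and, for the other vertex, with its
    predecessor; the latter means traversing the quadrilateral backwards.\<close>
  have nc': "\<not> collinear {p2, p1, p0}" "\<not> collinear {p3, p2, p1}" "\<not> collinear {p0, p3, p2}" "\<not> collinear {p1, p0, p3}"
    using nc by (simp_all add: insert_commute)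
  obtain u0 where u0: "ldot u0 u0 = 1" "u0 \<bullet> hat p0 = 0" "u0 \<bullet> hat p1 = 0" "u0 \<bullet> hat c = r"
    "c - r *\<^sub>R normal u0 \<in> closed_segment p0 p1" using tangent_line_normal[OF st(1) ne(1) r] by blast
  obtain u1 where u1: "ldot u1 u1 = 1" "u1 \<bullet> hat p1 = 0" "u1 \<bullet> hat p2 = 0" "u1 \<bullet> hat c = r"
    "c - r *\<^sub>R normal u1 \<in> closed_segment p1 p2" using tangent_line_normal[OF st(2) ne(2) r] by blast
  obtain u2 where u2: "ldot u2 u2 = 1" "u2 \<bullet> hat p2 = 0" "u2 \<bullet> hat p3 = 0" "u2 \<bullet> hat c = r"
    "c - r *\<^sub>R normal u2 \<in> closed_segment p2 p3" using tangent_line_normal[OF st(3) ne(3) r] by blast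
  obtain u3 where u3: "ldot u3 u3 = 1" "u3 \<bullet> hat p3 = 0" "u3 \<bullet> hat p0 = 0" "u3 \<bullet> hat c = r"
    "c - r *\<^sub>R normal u3 \<in> closed_segment p3 p0" using tangent_line_normal[OF st(4) ne(4) r] by blast
  note sw = closed_segment_commute
  have "supports c r u0 p0 p1 p2 p3"
    using u0 adjacent_vertex_positive[OF u0(1-4) u1 r nc(1)]
      adjacent_vertex_positive[OF u0(1,3,2,4) u3(1,3,2,4) u3(5)[unfolded sw[of p3]] r nc'(4)]
    by (simp add: supports_def)
  moreover have "supports c r u1 p1 p2 p3 p0"
    using u1 adjacent_vertex_positive[OF u1(1-4) u2 r nc(2)]
      adjacent_vertex_positive[OF u1(1,3,2,4) u0(1,3,2,4) u0(5)[unfolded sw[of p0]] r nc'(1)]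
    by (simp add: supports_def)
  moreover have "supports c r u2 p2 p3 p0 p1"
    using u2 adjacent_vertex_positive[OF u2(1-4) u3 r nc(3)]
      adjacent_vertex_positive[OF u2(1,3,2,4) u1(1,3,2,4) u1(5)[unfolded sw[of p1]] r nc'(2)]
    by (simp add: supports_def)
  moreover have "supports c r u3 p3 p0 p1 p2"
    using u3 adjacent_vertex_positive[OF u3(1-4) u0 r nc(4)]
      adjacent_vertex_positive[OF u3(1,3,2,4) u2(1,3,2,4) u2(5)[unfolded sw[of p2]] r nc'(3)]
    by (simp add: supports_def)
  ultimately show ?R using r by blast
next
  assume ?R
  then obtain u0 u1 u2 u3 where r: "0 < r" and u: "supports c r u0 p0 p1 p2 p3" "supports c r u1 p1 p2 p3 p0"
     "supports c r u2 p2 p3 p0 p1" "supports c r u3 p3 p0 p1 p2" by blast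
  then have ne: "p0 \<noteq> p1" "p1 \<noteq> p2" "p2 \<noteq> p3" "p3 \<noteq> p0"
    by (auto simp: supports_def)
  have "side_touches c r p0 p1" "side_touches c r p1 p2" "side_touches c r p2 p3" "side_touches c r p3 p0"
    using supports_side_touches u r by blast+
  moreover have "\<not> collinear {p0, p1, p2}" "\<not> collinear {p1, p2, p3}"
     "\<not> collinear {p2, p3, p0}" "\<not> collinear {p3, p0, p1}"
    using not_collinear_if_positive u ne by (auto simp: supports_def)
  ultimately show ?L using r by (simp add: inscribed_circle_def)
qed

section \<open>Nets as families of oriented lines\<close>

text \<open>All normals point towards growing indices. The sign conditions between neighbouring
  lines express the order of the points as well as the side on which each square lies.\<close>

definition line_frame ::
    "(int \<times> int) set \<Rightarrow> (int \<times> int \<Rightarrow> real^2) \<Rightarrow> (int \<Rightarrow> real^3) \<Rightarrow> (int \<Rightarrow> real^3) \<Rightarrow> bool" where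
  "line_frame P f p q \<longleftrightarrow>
     (\<forall>i j. (i, j) \<in> P \<longrightarrow> ldot (p i) (p i) = 1 \<and> ldot (q j) (q j) = 1 \<and>
        p i \<bullet> hat (f (i, j)) = 0 \<and> q j \<bullet> hat (f (i, j)) = 0) \<and>
     (\<forall>i j. (i, j) \<in> P \<longrightarrow> (i + 1, j) \<in> P \<longrightarrow>
        0 < p i \<bullet> hat (f (i + 1, j)) \<and> p (i + 1) \<bullet> hat (f (i, j)) < 0) \<and>
     (\<forall>i j. (i, j) \<in> P \<longrightarrow> (i, j + 1) \<in> P \<longrightarrow>
        0 < q j \<bullet> hat (f (i, j + 1)) \<and> q (j + 1) \<bullet> hat (f (i, j)) < 0)"

text \<open>With normals towards growing indices, the second line of each pair is oriented out of
  the square, hence its value \<open>- r\<close>.\<close>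

definition tangent_lines :: "real^2 \<Rightarrow> real \<Rightarrow> real^3 \<Rightarrow> real^3 \<Rightarrow> real^3 \<Rightarrow> real^3 \<Rightarrow> bool" where
  "tangent_lines c r a b z z' \<longleftrightarrow> 0 < r \<and> a \<bullet> hat c = r \<and> b \<bullet> hat c = - r \<and> z \<bullet> hat c = r \<and> z' \<bullet> hat c = - r"

definition circle_frame :: "(int \<times> int) set \<Rightarrow> (int \<Rightarrow> real^3) \<Rightarrow> (int \<Rightarrow> real^3) \<Rightarrow> bool" where
  "circle_frame P p q \<longleftrightarrow> (\<forall>i j. (i, j) \<in> P \<longrightarrow> (i + 1, j + 1) \<in> P \<longrightarrow>
     (\<exists>c r. tangent_lines c r (p i) (p (i + 1)) (q j) (q (j + 1))))"

lemma mem_rect [simp]: "(i, j) \<in> rect m1 m2 n1 n2 \<longleftrightarrow> m1 < i \<and> i < m2 \<and> n1 < j \<and> j < n2"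
  by (simp add: rect_def)

lemma line_frameD:
  assumes "line_frame P f p q"
  shows "(i, j) \<in> P \<Longrightarrow> ldot (p i) (p i) = 1" "(i, j) \<in> P \<Longrightarrow> ldot (q j) (q j) = 1"
    "(i, j) \<in> P \<Longrightarrow> p i \<bullet> hat (f (i, j)) = 0" "(i, j) \<in> P \<Longrightarrow> q j \<bullet> hat (f (i, j)) = 0"
    "(i, j) \<in> P \<Longrightarrow> (i + 1, j) \<in> P \<Longrightarrow> 0 < p i \<bullet> hat (f (i + 1, j))"
    "(i, j) \<in> P \<Longrightarrow> (i + 1, j) \<in> P \<Longrightarrow> p (i + 1) \<bullet> hat (f (i, j)) < 0"
    "(i, j) \<in> P \<Longrightarrow> (i, j + 1) \<in> P \<Longrightarrow> 0 < q j \<bullet> hat (f (i, j + 1))"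
    "(i, j) \<in> P \<Longrightarrow> (i, j + 1) \<in> P \<Longrightarrow> q (j + 1) \<bullet> hat (f (i, j)) < 0"
  using assms unfolding line_frame_def by blast+

lemma open_segment_if_signs:
  assumes "ldot u u = 1" "u \<bullet> hat x = 0" "u \<bullet> hat y = 0" "u \<bullet> hat z = 0"
    and "v \<bullet> hat x < 0" "v \<bullet> hat y = 0" "0 < v \<bullet> hat z"
  shows "y \<in> open_segment x z"
proof -
  have ne: "x \<noteq> z" using assms by auto
  have "y \<in> affine hull {x, z}" using affine_hull_eq_line[OF assms(1) ne] assms by simp
  then obtain a k where "y = a *\<^sub>R x + k *\<^sub>R z" "a + k = 1" by (auto simp: affine_hull_2)
  then have k: "y = (1 - k) *\<^sub>R x + k *\<^sub>R z" by (metis add_diff_cancel_right')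
  then have 0: "(1 - k) * (v \<bullet> hat x) + k * (v \<bullet> hat z) = 0"
    using inner_hat_affine[of v k x z] assms(6) by simp
  have "0 < k"
  proof (rule ccontr)
    assume "\<not> 0 < k"
    then have "(1 - k) * (v \<bullet> hat x) < 0" "k * (v \<bullet> hat z) \<le> 0"
      using assms by (auto simp: mult_less_0_iff mult_le_0_iff)
    then show False using 0 by simp
  qed
  moreover have "k < 1"
  proof (rule ccontr)
    assume "\<not> k < 1"
    then have "(1 - k) * (v \<bullet> hat x) \<ge> 0" "k * (v \<bullet> hat z) > 0"
      using assms by (auto simp: zero_less_mult_iff zero_le_mult_iff)
    then show False using 0 by simp
  qed
  ultimately show ?thesis using k ne by (auto simp: in_segment)
qed

lemma IC_net_if_frames:
  assumes P: "P = rect m1 m2 n1 n2" and L: "line_frame P f p q" and C: "circle_frame P p q"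
    and "m1 + 1 < m2" "n1 + 1 < n2"
  shows "IC_net P f"
  unfolding IC_net_def
proof (intro conjI allI impI)
  note D = line_frameD[OF L]
  show "collinear {f (i, j) |j. (i, j) \<in> P}" for i
  proof (cases "\<exists>j. (i, j) \<in> P")
    case True
    then show ?thesis using D(1,3) by (intro collinear_if_on_line[of "p i"]) auto
  qed simp
  show "collinear {f (i, j) |i. (i, j) \<in> P}" for j
  proof (cases "\<exists>i. (i, j) \<in> P")
    case True
    then show ?thesis using D(2,4) by (intro collinear_if_on_line[of "q j"]) auto
  qed simp
  show "f (i, j) \<in> open_segment (f (i, j - 1)) (f (i, j + 1))"
    if "{(i, j - 1), (i, j), (i, j + 1)} \<subseteq> P" for i j
    using that D(1,3)[of i j] D(3)[of i "j - 1"] D(3)[of i "j + 1"] D(4)[of i j] D(7)[of i j] D(8)[of i "j - 1"]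
    by (intro open_segment_if_signs[of "p i" _ _ _ "q j"]) auto
  show "f (i, j) \<in> open_segment (f (i - 1, j)) (f (i + 1, j))"
    if "{(i - 1, j), (i, j), (i + 1, j)} \<subseteq> P" for i j
    using that D(2,4)[of i j] D(4)[of "i - 1" j] D(4)[of "i + 1" j] D(3)[of i j] D(5)[of i j] D(6)[of "i - 1" j]
    by (intro open_segment_if_signs[of "q j" _ _ _ "p i"]) auto
  show "\<exists>c r. net_incircle f i j c r"
    if sq: "{(i, j), (i + 1, j), (i + 1, j + 1), (i, j + 1)} \<subseteq> P" for i j
  proof -
    obtain c r where c: "tangent_lines c r (p i) (p (i + 1)) (q j) (q (j + 1))"
      using C sq unfolding circle_frame_def by blast
    have in_P: "(i, j) \<in> P" "(i + 1, j) \<in> P" "(i + 1, j + 1) \<in> P" "(i, j + 1) \<in> P"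
      using sq by auto
    note D1 = D[OF in_P(1)] D[OF in_P(2)] D[OF in_P(3)] D[OF in_P(4)]
    have "supports c r (q j) (f (i, j)) (f (i + 1, j)) (f (i + 1, j + 1)) (f (i, j + 1))"
      "supports c r (- p (i + 1)) (f (i + 1, j)) (f (i + 1, j + 1)) (f (i, j + 1)) (f (i, j))"
      "supports c r (- q (j + 1)) (f (i + 1, j + 1)) (f (i, j + 1)) (f (i, j)) (f (i + 1, j))"
      "supports c r (p i) (f (i, j + 1)) (f (i, j)) (f (i + 1, j)) (f (i + 1, j + 1))"
      using c D1 in_P by (auto simp: supports_def tangent_lines_def ldot_minus)
    then show ?thesis
      using c unfolding net_incircle_def inscribed_circle_iff_supports tangent_lines_def by blast
  qed
qed

lemma supports_same_side:
  assumes "supports c r v p0 p1 p2 p3" "p0 \<noteq> p1" "ldot u u = 1" "u \<bullet> hat p0 = 0" "u \<bullet> hat p1 = 0"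
  shows "0 < (u \<bullet> hat p2) * (u \<bullet> hat p3)"
    and "0 < u \<bullet> hat p2 \<Longrightarrow> u = v"
proof -
  have "u = v \<or> u = - v"
    using line_eq_or_minus[of v u p0 p1] assms by (auto simp: supports_def)
  then show "0 < (u \<bullet> hat p2) * (u \<bullet> hat p3)" "0 < u \<bullet> hat p2 \<Longrightarrow> u = v"
    using assms(1) by (auto simp: supports_def zero_less_mult_iff)
qed

lemma same_sign_on_int_interval:
  fixes s :: "int \<Rightarrow> real"
  assumes "\<And>j. a < j \<Longrightarrow> j + 1 < b \<Longrightarrow> 0 < s j * s (j + 1)" and "0 < s (a + 1)" "a < j" "j < b"
  shows "0 < s j"
proof -
  have "a + 1 \<le> j" using assms by simp
  then have "j < b \<longrightarrow> 0 < s j"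
  proof (induction rule: int_ge_induct)
    case (step i)
    then show ?case using assms(1)[of i] by (auto simp: zero_less_mult_iff)
  qed (use assms in simp)
  then show ?thesis using assms by simp
qed

text \<open>The circles keep the sign of a neighbouring row constant along the line, so one point
  decides it, and betweenness puts the two neighbouring rows on opposite sides. The array
  \<open>g\<close> is arbitrary so that the lemma serves both families of lines.\<close>

lemma ex_oriented_line:
  fixes g :: "int \<Rightarrow> int \<Rightarrow> real^2"
  assumes col: "collinear {g i j |j. n1 < j \<and> j < n2}"
    and up: "\<And>j. n1 < j \<Longrightarrow> j + 1 < n2 \<Longrightarrow> i + 1 < m2 \<Longrightarrow> g i j \<noteq> g i (j + 1) \<and>
      (\<forall>u. ldot u u = 1 \<longrightarrow> u \<bullet> hat (g i j) = 0 \<longrightarrow> u \<bullet> hat (g i (j + 1)) = 0 \<longrightarrow>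
        0 < (u \<bullet> hat (g (i + 1) j)) * (u \<bullet> hat (g (i + 1) (j + 1))))"
    and down: "\<And>j. n1 < j \<Longrightarrow> j + 1 < n2 \<Longrightarrow> m1 < i - 1 \<Longrightarrow> g i j \<noteq> g i (j + 1) \<and>
      (\<forall>u. ldot u u = 1 \<longrightarrow> u \<bullet> hat (g i j) = 0 \<longrightarrow> u \<bullet> hat (g i (j + 1)) = 0 \<longrightarrow>
        0 < (u \<bullet> hat (g (i - 1) j)) * (u \<bullet> hat (g (i - 1) (j + 1))))"
    and ord: "\<And>j. n1 < j \<Longrightarrow> j < n2 \<Longrightarrow> m1 < i - 1 \<Longrightarrow> i + 1 < m2 \<Longrightarrow>
      g i j \<in> open_segment (g (i - 1) j) (g (i + 1) j)"
    and i: "m1 < i" "i < m2" and size: "m1 + 2 < m2" "n1 + 2 < n2"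
  shows "\<exists>u. ldot u u = 1 \<and> (\<forall>j. n1 < j \<longrightarrow> j < n2 \<longrightarrow> u \<bullet> hat (g i j) = 0 \<and>
    (i + 1 < m2 \<longrightarrow> 0 < u \<bullet> hat (g (i + 1) j)) \<and> (m1 < i - 1 \<longrightarrow> u \<bullet> hat (g (i - 1) j) < 0))"
proof -
  let ?j = "n1 + 1"
  have ne: "g i ?j \<noteq> g i (?j + 1)"
    using up[of ?j] down[of ?j] i size by linarith
  obtain v where v: "ldot v v = 1" "v \<bullet> hat (g i ?j) = 0" "v \<bullet> hat (g i (?j + 1)) = 0"
    using ex_line_through[OF ne] by blast
  have zero: "v \<bullet> hat (g i j) = 0" if "n1 < j" "j < n2" for j
  proof -
    have "collinear {g i ?j, g i (?j + 1), g i j}"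
      by (rule collinear_subset[OF col]) (use that size in auto)
    then show ?thesis using on_line_if_collinear ne v by blast
  qed
  have upv: "0 < (v \<bullet> hat (g (i + 1) j)) * (v \<bullet> hat (g (i + 1) (j + 1)))"
    if "n1 < j" "j + 1 < n2" "i + 1 < m2" for j
    using up[OF that] v(1) zero[of j] zero[of "j + 1"] that by simp
  have downv: "0 < (v \<bullet> hat (g (i - 1) j)) * (v \<bullet> hat (g (i - 1) (j + 1)))"
    if "n1 < j" "j + 1 < n2" "m1 < i - 1" for j
    using down[OF that] v(1) zero[of j] zero[of "j + 1"] that by simp
  \<comment> \<open>The orientation is read off from the next row; on the last line only the
    previous row exists, and the sign is reversed.\<close>
  define e :: real where "e = (if i + 1 < m2 then sgn (v \<bullet> hat (g (i + 1) ?j)) else - sgn (v \<bullet> hat (g (i - 1) ?j)))"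
  have up0: "v \<bullet> hat (g (i + 1) ?j) \<noteq> 0" if "i + 1 < m2"
    using upv[of ?j] that size by auto
  have down0: "v \<bullet> hat (g (i - 1) ?j) \<noteq> 0" if "m1 < i - 1"
    using downv[of ?j] that size by auto
  have e: "e = 1 \<or> e = -1"
    using up0 down0 i size by (auto simp: e_def sgn_if)
  have up1: "0 < e * (v \<bullet> hat (g (i + 1) ?j))" if "i + 1 < m2"
    using up0[OF that] that by (auto simp: e_def sgn_if)
  have down1: "0 < - (e * (v \<bullet> hat (g (i - 1) ?j)))" if d: "m1 < i - 1"
  proof (cases "i + 1 < m2")
    case True
    obtain k where k: "0 < k" "k < 1" "g i ?j = (1 - k) *\<^sub>R g (i - 1) ?j + k *\<^sub>R g (i + 1) ?j"
      using ord[of ?j] d True size by (auto simp: in_segment)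
    then have "(1 - k) * (v \<bullet> hat (g (i - 1) ?j)) + k * (v \<bullet> hat (g (i + 1) ?j)) = 0"
      using inner_hat_affine[of v k "g (i - 1) ?j" "g (i + 1) ?j"] v(2) by simp
    then have "(1 - k) * (e * (v \<bullet> hat (g (i - 1) ?j))) = - (k * (e * (v \<bullet> hat (g (i + 1) ?j))))"
      by algebra
    also have "\<dots> < 0" using k up1[OF True] by simp
    finally show ?thesis using k by (simp add: mult_less_0_iff)
  next
    case False
    then show ?thesis using down0[OF d] by (auto simp: e_def sgn_if)
  qed
  define u where "u = e *\<^sub>R v"
  have "ldot u u = 1" using e v by (auto simp: u_def ldot_minus)
  moreover have "u \<bullet> hat (g i j) = 0" if "n1 < j" "j < n2" for j
    using zero[OF that] by (simp add: u_def)
  moreover have "0 < u \<bullet> hat (g (i + 1) j)" if "n1 < j" "j < n2" "i + 1 < m2" for j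
    by (rule same_sign_on_int_interval[of n1 n2 "\<lambda>j. u \<bullet> hat (g (i + 1) j)"])
      (use upv up1 that e in \<open>auto simp: u_def\<close>)
  moreover have "0 < - (u \<bullet> hat (g (i - 1) j))" if "n1 < j" "j < n2" "m1 < i - 1" for j
    by (rule same_sign_on_int_interval[of n1 n2 "\<lambda>j. - (u \<bullet> hat (g (i - 1) j))"])
      (use downv down1 that e in \<open>auto simp: u_def\<close>)
  ultimately show ?thesis by (intro exI[of _ u]) auto
qed

lemma frames_if_IC_net:
  assumes P: "P = rect m1 m2 n1 n2" and IC: "IC_net P f" and size: "m1 + 2 < m2" "n1 + 2 < n2"
  shows "\<exists>p q. line_frame P f p q \<and> circle_frame P p q"
proof -
  have col: "collinear {f (i, j) |j. (i, j) \<in> P}" "collinear {f (i, j) |i. (i, j) \<in> P}"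
    and ordj: "{(i, j - 1), (i, j), (i, j + 1)} \<subseteq> P \<Longrightarrow> f (i, j) \<in> open_segment (f (i, j - 1)) (f (i, j + 1))"
    and ordi: "{(i - 1, j), (i, j), (i + 1, j)} \<subseteq> P \<Longrightarrow> f (i, j) \<in> open_segment (f (i - 1, j)) (f (i + 1, j))"
    and circ: "{(i, j), (i + 1, j), (i + 1, j + 1), (i, j + 1)} \<subseteq> P \<Longrightarrow> \<exists>c r. net_incircle f i j c r" for i j
    using IC by (simp_all add: IC_net_def)
  have sq: "\<exists>c r u0 u1 u2 u3. 0 < r \<and> supports c r u0 (f (i, j)) (f (i + 1, j)) (f (i + 1, j + 1)) (f (i, j + 1)) \<and>
      supports c r u1 (f (i + 1, j)) (f (i + 1, j + 1)) (f (i, j + 1)) (f (i, j)) \<and>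
      supports c r u2 (f (i + 1, j + 1)) (f (i, j + 1)) (f (i, j)) (f (i + 1, j)) \<and>
      supports c r u3 (f (i, j + 1)) (f (i, j)) (f (i + 1, j)) (f (i + 1, j + 1))"
    if "m1 < i" "i + 1 < m2" "n1 < j" "j + 1 < n2" for i j
    using circ[of i j] that P unfolding net_incircle_def inscribed_circle_iff_supports by auto
  have ne: "f (i, j) \<noteq> f (i + 1, j)" "f (i + 1, j) \<noteq> f (i + 1, j + 1)"
      "f (i + 1, j + 1) \<noteq> f (i, j + 1)" "f (i, j + 1) \<noteq> f (i, j)"
    and side: "ldot u u = 1 \<Longrightarrow> u \<bullet> hat (f (i, j)) = 0 \<Longrightarrow> u \<bullet> hat (f (i, j + 1)) = 0 \<Longrightarrow>
        0 < (u \<bullet> hat (f (i + 1, j))) * (u \<bullet> hat (f (i + 1, j + 1)))"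
      "ldot u u = 1 \<Longrightarrow> u \<bullet> hat (f (i + 1, j)) = 0 \<Longrightarrow> u \<bullet> hat (f (i + 1, j + 1)) = 0 \<Longrightarrow>
        0 < (u \<bullet> hat (f (i, j))) * (u \<bullet> hat (f (i, j + 1)))"
      "ldot u u = 1 \<Longrightarrow> u \<bullet> hat (f (i, j)) = 0 \<Longrightarrow> u \<bullet> hat (f (i + 1, j)) = 0 \<Longrightarrow>
        0 < (u \<bullet> hat (f (i, j + 1))) * (u \<bullet> hat (f (i + 1, j + 1)))"
      "ldot u u = 1 \<Longrightarrow> u \<bullet> hat (f (i, j + 1)) = 0 \<Longrightarrow> u \<bullet> hat (f (i + 1, j + 1)) = 0 \<Longrightarrow>
        0 < (u \<bullet> hat (f (i, j))) * (u \<bullet> hat (f (i + 1, j)))"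
    if h: "m1 < i" "i + 1 < m2" "n1 < j" "j + 1 < n2" for i j u
  proof -
    obtain c r u0 u1 u2 u3 where s: "0 < r" "supports c r u0 (f (i, j)) (f (i + 1, j)) (f (i + 1, j + 1)) (f (i, j + 1))"
      "supports c r u1 (f (i + 1, j)) (f (i + 1, j + 1)) (f (i, j + 1)) (f (i, j))"
      "supports c r u2 (f (i + 1, j + 1)) (f (i, j + 1)) (f (i, j)) (f (i + 1, j))"
      "supports c r u3 (f (i, j + 1)) (f (i, j)) (f (i + 1, j)) (f (i + 1, j + 1))"
      using sq[OF h] by blast
    show n: "f (i, j) \<noteq> f (i + 1, j)" "f (i + 1, j) \<noteq> f (i + 1, j + 1)"
      "f (i + 1, j + 1) \<noteq> f (i, j + 1)" "f (i, j + 1) \<noteq> f (i, j)"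
      using s by (auto simp: supports_def)
    show "0 < (u \<bullet> hat (f (i + 1, j))) * (u \<bullet> hat (f (i + 1, j + 1)))"
      if "ldot u u = 1" "u \<bullet> hat (f (i, j)) = 0" "u \<bullet> hat (f (i, j + 1)) = 0"
      using supports_same_side(1)[OF s(5) n(4)] that by simp
    show "0 < (u \<bullet> hat (f (i, j))) * (u \<bullet> hat (f (i, j + 1)))"
      if "ldot u u = 1" "u \<bullet> hat (f (i + 1, j)) = 0" "u \<bullet> hat (f (i + 1, j + 1)) = 0"
      using supports_same_side(1)[OF s(3) n(2)] that by (simp add: mult.commute)
    show "0 < (u \<bullet> hat (f (i, j + 1))) * (u \<bullet> hat (f (i + 1, j + 1)))"
      if "ldot u u = 1" "u \<bullet> hat (f (i, j)) = 0" "u \<bullet> hat (f (i + 1, j)) = 0"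
      using supports_same_side(1)[OF s(2) n(1)] that by (simp add: mult.commute)
    show "0 < (u \<bullet> hat (f (i, j))) * (u \<bullet> hat (f (i + 1, j)))"
      if "ldot u u = 1" "u \<bullet> hat (f (i, j + 1)) = 0" "u \<bullet> hat (f (i + 1, j + 1)) = 0"
      using supports_same_side(1)[OF s(4) n(3)] that by simp
  qed
  have "\<exists>u. m1 < i \<longrightarrow> i < m2 \<longrightarrow> ldot u u = 1 \<and> (\<forall>j. n1 < j \<longrightarrow> j < n2 \<longrightarrow> u \<bullet> hat (f (i, j)) = 0 \<and>
      (i + 1 < m2 \<longrightarrow> 0 < u \<bullet> hat (f (i + 1, j))) \<and> (m1 < i - 1 \<longrightarrow> u \<bullet> hat (f (i - 1, j)) < 0))" for i
  proof (cases "m1 < i \<and> i < m2")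
    case True
    have "\<exists>u. ldot u u = 1 \<and> (\<forall>j. n1 < j \<longrightarrow> j < n2 \<longrightarrow> u \<bullet> hat (f (i, j)) = 0 \<and>
      (i + 1 < m2 \<longrightarrow> 0 < u \<bullet> hat (f (i + 1, j))) \<and> (m1 < i - 1 \<longrightarrow> u \<bullet> hat (f (i - 1, j)) < 0))"
    proof (rule ex_oriented_line[where g = "\<lambda>i j. f (i, j)" and ?m1.0 = m1 and ?m2.0 = m2])
      show "collinear {f (i, j) |j. n1 < j \<and> j < n2}"
        by (rule collinear_subset[OF col(1)[of i]]) (use True P in auto)
      show "f (i, j) \<noteq> f (i, j + 1) \<and> (\<forall>u. ldot u u = 1 \<longrightarrow> u \<bullet> hat (f (i, j)) = 0 \<longrightarrow> u \<bullet> hat (f (i, j + 1)) = 0 \<longrightarrow>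
        0 < (u \<bullet> hat (f (i + 1, j))) * (u \<bullet> hat (f (i + 1, j + 1))))"
        if "n1 < j" "j + 1 < n2" "i + 1 < m2" for j
        using ne(4)[of i j] side(1)[of i j] True that by auto
      show "f (i, j) \<noteq> f (i, j + 1) \<and> (\<forall>u. ldot u u = 1 \<longrightarrow> u \<bullet> hat (f (i, j)) = 0 \<longrightarrow> u \<bullet> hat (f (i, j + 1)) = 0 \<longrightarrow>
        0 < (u \<bullet> hat (f (i - 1, j))) * (u \<bullet> hat (f (i - 1, j + 1))))"
        if "n1 < j" "j + 1 < n2" "m1 < i - 1" for j
        using ne(2)[of "i - 1" j] side(2)[of "i - 1" j] True that by auto
      show "f (i, j) \<in> open_segment (f (i - 1, j)) (f (i + 1, j))"
        if "n1 < j" "j < n2" "m1 < i - 1" "i + 1 < m2" for j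
        using ordi[of i j] that P by auto
    qed (use True size in auto)
    then show ?thesis by blast
  qed auto
  then obtain p where p: "\<And>i. m1 < i \<Longrightarrow> i < m2 \<Longrightarrow> ldot (p i) (p i) = 1 \<and>
      (\<forall>j. n1 < j \<longrightarrow> j < n2 \<longrightarrow> p i \<bullet> hat (f (i, j)) = 0 \<and>
      (i + 1 < m2 \<longrightarrow> 0 < p i \<bullet> hat (f (i + 1, j))) \<and> (m1 < i - 1 \<longrightarrow> p i \<bullet> hat (f (i - 1, j)) < 0))"
    by metis
  have "\<exists>u. n1 < j \<longrightarrow> j < n2 \<longrightarrow> ldot u u = 1 \<and> (\<forall>i. m1 < i \<longrightarrow> i < m2 \<longrightarrow> u \<bullet> hat (f (i, j)) = 0 \<and>
      (j + 1 < n2 \<longrightarrow> 0 < u \<bullet> hat (f (i, j + 1))) \<and> (n1 < j - 1 \<longrightarrow> u \<bullet> hat (f (i, j - 1)) < 0))" for j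
  proof (cases "n1 < j \<and> j < n2")
    case True
    have "\<exists>u. ldot u u = 1 \<and> (\<forall>i. m1 < i \<longrightarrow> i < m2 \<longrightarrow> u \<bullet> hat (f (i, j)) = 0 \<and>
      (j + 1 < n2 \<longrightarrow> 0 < u \<bullet> hat (f (i, j + 1))) \<and> (n1 < j - 1 \<longrightarrow> u \<bullet> hat (f (i, j - 1)) < 0))"
    proof (rule ex_oriented_line[where g = "\<lambda>j i. f (i, j)" and ?m1.0 = n1 and ?m2.0 = n2])
      show "collinear {f (i, j) |i. m1 < i \<and> i < m2}"
        by (rule collinear_subset[OF col(2)[of j]]) (use True P in auto)
      show "f (i, j) \<noteq> f (i + 1, j) \<and> (\<forall>u. ldot u u = 1 \<longrightarrow> u \<bullet> hat (f (i, j)) = 0 \<longrightarrow> u \<bullet> hat (f (i + 1, j)) = 0 \<longrightarrow>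
        0 < (u \<bullet> hat (f (i, j + 1))) * (u \<bullet> hat (f (i + 1, j + 1))))"
        if "m1 < i" "i + 1 < m2" "j + 1 < n2" for i
        using ne(1)[of i j] side(3)[of i j] True that by auto
      show "f (i, j) \<noteq> f (i + 1, j) \<and> (\<forall>u. ldot u u = 1 \<longrightarrow> u \<bullet> hat (f (i, j)) = 0 \<longrightarrow> u \<bullet> hat (f (i + 1, j)) = 0 \<longrightarrow>
        0 < (u \<bullet> hat (f (i, j - 1))) * (u \<bullet> hat (f (i + 1, j - 1))))"
        if "m1 < i" "i + 1 < m2" "n1 < j - 1" for i
        using ne(3)[of i "j - 1"] side(4)[of i "j - 1"] True that by auto
      show "f (i, j) \<in> open_segment (f (i, j - 1)) (f (i, j + 1))"
        if "m1 < i" "i < m2" "n1 < j - 1" "j + 1 < n2" for i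
        using ordj[of i j] that P by auto
    qed (use True size in auto)
    then show ?thesis by blast
  qed auto
  then obtain q where q: "\<And>j. n1 < j \<Longrightarrow> j < n2 \<Longrightarrow> ldot (q j) (q j) = 1 \<and>
      (\<forall>i. m1 < i \<longrightarrow> i < m2 \<longrightarrow> q j \<bullet> hat (f (i, j)) = 0 \<and>
      (j + 1 < n2 \<longrightarrow> 0 < q j \<bullet> hat (f (i, j + 1))) \<and> (n1 < j - 1 \<longrightarrow> q j \<bullet> hat (f (i, j - 1)) < 0))"
    by metis
  have L: "line_frame P f p q"
    unfolding line_frame_def P mem_rect
  proof (intro conjI allI impI)
    fix i j assume "m1 < i \<and> i < m2 \<and> n1 < j \<and> j < n2"
    then show "ldot (p i) (p i) = 1" "ldot (q j) (q j) = 1" "p i \<bullet> hat (f (i, j)) = 0" "q j \<bullet> hat (f (i, j)) = 0"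
      using p q by auto
  next
    fix i j assume "m1 < i \<and> i < m2 \<and> n1 < j \<and> j < n2" "m1 < i + 1 \<and> i + 1 < m2 \<and> n1 < j \<and> j < n2"
    then show "0 < p i \<bullet> hat (f (i + 1, j))" "p (i + 1) \<bullet> hat (f (i, j)) < 0"
      using p[of i] p[of "i + 1"] by auto
  next
    fix i j assume "m1 < i \<and> i < m2 \<and> n1 < j \<and> j < n2" "m1 < i \<and> i < m2 \<and> n1 < j + 1 \<and> j + 1 < n2"
    then show "0 < q j \<bullet> hat (f (i, j + 1))" "q (j + 1) \<bullet> hat (f (i, j)) < 0"
      using q[of j] q[of "j + 1"] by auto
  qed
  note D = line_frameD[OF L]
  have "circle_frame P p q"
    unfolding circle_frame_def
  proof (intro allI impI)
    fix i j assume "(i, j) \<in> P" "(i + 1, j + 1) \<in> P"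
    then have h: "m1 < i" "i + 1 < m2" "n1 < j" "j + 1 < n2"
      and in_P: "(i, j) \<in> P" "(i + 1, j) \<in> P" "(i + 1, j + 1) \<in> P" "(i, j + 1) \<in> P"
      by (auto simp: P)
    obtain c r u0 u1 u2 u3 where s: "0 < r" "supports c r u0 (f (i, j)) (f (i + 1, j)) (f (i + 1, j + 1)) (f (i, j + 1))"
      "supports c r u1 (f (i + 1, j)) (f (i + 1, j + 1)) (f (i, j + 1)) (f (i, j))"
      "supports c r u2 (f (i + 1, j + 1)) (f (i, j + 1)) (f (i, j)) (f (i + 1, j))"
      "supports c r u3 (f (i, j + 1)) (f (i, j)) (f (i + 1, j)) (f (i + 1, j + 1))"
      using sq[OF h] by blast
    note D1 = D[OF in_P(1)] D[OF in_P(2)] D[OF in_P(3)] D[OF in_P(4)]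
    \<comment> \<open>The \<open>u\<close>s are oriented inwards, \<open>p\<close> and
      \<open>q\<close> towards growing indices: they agree on the first line of each pair and are
      opposite on the second.\<close>
    have "q j = u0"
      by (rule supports_same_side(2)[OF s(2) ne(1)[OF h]]) (use D1 in_P in auto)
    moreover have "- p (i + 1) = u1"
      by (rule supports_same_side(2)[OF s(3) ne(2)[OF h]]) (use D1 in_P in \<open>auto simp: ldot_minus\<close>)
    moreover have "- q (j + 1) = u2"
      by (rule supports_same_side(2)[OF s(4) ne(3)[OF h]]) (use D1 in_P in \<open>auto simp: ldot_minus\<close>)
    moreover have "p i = u3"
      by (rule supports_same_side(2)[OF s(5) ne(4)[OF h]]) (use D1 in_P in auto)
    ultimately have "tangent_lines c r (p i) (p (i + 1)) (q j) (q (j + 1))"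
      using s by (auto simp: tangent_lines_def supports_def)
    then show "\<exists>c r. tangent_lines c r (p i) (p (i + 1)) (q j) (q (j + 1))" by blast
  qed
  with L show ?thesis by blast
qed

lemma cross3_third: "cross3 u v $ 3 = normal u $ 1 * normal v $ 2 - normal u $ 2 * normal v $ 1"
  by (simp add: cross_components)

lemma hat_intersection:
  assumes "cross3 u v $ 3 \<noteq> 0" "u \<bullet> hat z = 0" "v \<bullet> hat z = 0"
  shows "hat z = (- 1 / cross3 u v $ 3) *\<^sub>R cross3 u v"
proof -
  have "cross3 u v \<noteq> 0" using assms(1) by auto
  then obtain k where k: "hat z = k *\<^sub>R cross3 u v"
    using orthogonal_two_cross3[of "hat z" u v] assms by (auto simp: inner_commute)
  then have "hat z $ 3 = k * cross3 u v $ 3" by simp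
  then have "k = - 1 / cross3 u v $ 3" using assms(1) by (simp add: field_simps)
  then show ?thesis using k by simp
qed

lemma hat_inject [simp]: "hat y = hat z \<longleftrightarrow> y = z"
  by (auto simp: vec_eq_iff forall_2 forall_3)

lemma intersection_unique:
  assumes "cross3 u v $ 3 \<noteq> 0" "u \<bullet> hat y = 0" "v \<bullet> hat y = 0" "u \<bullet> hat z = 0" "v \<bullet> hat z = 0"
  shows "y = z"
  using hat_intersection[OF assms(1-3)] hat_intersection[OF assms(1,4,5)] by (metis hat_inject)

section \<open>Two neighbouring circles determine the net\<close>

definition transpose_net :: "(int \<times> int \<Rightarrow> real^2) \<Rightarrow> int \<times> int \<Rightarrow> real^2" where
  "transpose_net f = f \<circ> prod.swap"

lemma transpose_net_apply [simp]: "transpose_net f (i, j) = f (j, i)"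
  by (simp add: transpose_net_def)

lemma line_frame_transpose:
  assumes "line_frame (rect m1 m2 n1 n2) f p q"
  shows "line_frame (rect n1 n2 m1 m2) (transpose_net f) q p"
  using assms unfolding line_frame_def by auto

lemma circle_frame_transpose:
  assumes "circle_frame (rect m1 m2 n1 n2) p q"
  shows "circle_frame (rect n1 n2 m1 m2) q p"
  unfolding circle_frame_def
proof (intro allI impI)
  fix i j assume "(i, j) \<in> rect n1 n2 m1 m2" "(i + 1, j + 1) \<in> rect n1 n2 m1 m2"
  then have "\<exists>c r. tangent_lines c r (p j) (p (j + 1)) (q i) (q (i + 1))"
    using assms unfolding circle_frame_def by simp
  then show "\<exists>c r. tangent_lines c r (q i) (q (i + 1)) (p j) (p (j + 1))"
    unfolding tangent_lines_def by blast
qed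

text \<open>From f(i,j) to f(i+1,j) the signed distances from both lines increase. The direction of
  this edge is a multiple of the rotated normal of \<open>q j\<close>, so its product with the
  normal of any \<open>u\<close> is a fixed multiple of \<open>cross3 u (q j) $ 3\<close>.\<close>

lemma line_frame_cross_step:
  assumes L: "line_frame P f p q" and P: "(i, j) \<in> P" "(i + 1, j) \<in> P"
  shows "0 < cross3 (p i) (q j) $ 3 * cross3 (p (i + 1)) (q j) $ 3"
proof -
  note D = line_frameD[OF L]
  let ?d = "f (i + 1, j) - f (i, j)"
  have "normal (q j) \<bullet> ?d = 0"
    using D(4)[OF P(1)] D(4)[OF P(2)] by (simp add: inner_hat_diff[symmetric])
  then obtain l where l: "?d = l *\<^sub>R vector [- normal (q j) $ 2, normal (q j) $ 1]"
    using real2_orthogonal norm_normal D(2)[OF P(1)] by blast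
  have eq: "normal u \<bullet> ?d = - l * cross3 u (q j) $ 3" for u
    by (simp only: l) (simp add: cross3_third inner_vec_def sum_2 algebra_simps)
  have "0 < normal (p i) \<bullet> ?d" "0 < normal (p (i + 1)) \<bullet> ?d"
    using D(3)[OF P(1)] D(5)[OF P] D(3)[OF P(2)] D(6)[OF P] by (simp_all add: inner_hat_diff[symmetric])
  then show ?thesis by (auto simp: eq zero_less_mult_iff mult_less_0_iff)
qed

lemma triple3_nonzero_if_not_concurrent:
  assumes "cross3 u v $ 3 \<noteq> 0" "u \<bullet> hat z = 0" "v \<bullet> hat z = 0" "w \<bullet> hat z \<noteq> 0"
  shows "triple3 u w v \<noteq> 0"
proof
  assume "triple3 u w v = 0"
  then have "w \<bullet> cross3 u v = 0"
    by (simp add: triple3_def cross3_simps)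
  then show False using hat_intersection[OF assms(1-3)] assms(4) by simp
qed

locale framed_net =
  fixes m1 m2 n1 n2 :: int and f :: "int \<times> int \<Rightarrow> real^2" and p q :: "int \<Rightarrow> real^3"
  assumes size: "m1 + 2 < m2" "n1 + 2 < n2"
    and line_frame: "line_frame (rect m1 m2 n1 n2) f p q"
begin

lemma transposed: "framed_net n1 n2 m1 m2 (transpose_net f) q p"
  using size line_frame_transpose[OF line_frame] by unfold_locales auto

lemmas frameD = line_frameD[OF line_frame, unfolded mem_rect]

lemma unit_p: "m1 < i \<Longrightarrow> i < m2 \<Longrightarrow> ldot (p i) (p i) = 1"
  using frameD(1)[of i "n1 + 1"] size by simp

lemma unit_q: "n1 < j \<Longrightarrow> j < n2 \<Longrightarrow> ldot (q j) (q j) = 1"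
  using frameD(2)[of "m1 + 1" j] size by simp

lemma cross_step:
  assumes "m1 < i" "i + 1 < m2" "n1 < j" "j < n2"
  shows "0 < cross3 (p i) (q j) $ 3 * cross3 (p (i + 1)) (q j) $ 3"
  using line_frame_cross_step[OF line_frame, of i j] assms by simp

lemma cross_nonzero:
  assumes "m1 < i" "i < m2" "n1 < j" "j < n2"
  shows "cross3 (p i) (q j) $ 3 \<noteq> 0"
proof (cases "i + 1 < m2")
  case True
  then show ?thesis using cross_step[of i j] assms by auto
next
  case False
  then show ?thesis using cross_step[of "i - 1" j] assms size by auto
qed

lemma triple_nonzero:
  assumes "m1 < i" "i + 1 < m2" "n1 < j" "j < n2"
  shows "triple3 (p i) (p (i + 1)) (q j) \<noteq> 0"
  using triple3_nonzero_if_not_concurrent[of "p i" "q j" "f (i, j)" "p (i + 1)"]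
    cross_nonzero[of i j] frameD(3,4,6)[of i j] assms by simp

text \<open>The bisector of the \<open>p\<close> lines separates f(i,j) from f(i+1,j), whereas the
  sum of the \<open>q\<close> lines is negative at both points.\<close>

lemma bisectors_not_parallel:
  assumes "m1 < i" "i + 1 < m2" "n1 < j" "j + 1 < n2"
  shows "cross3 (p i + p (i + 1)) (q j + q (j + 1)) \<noteq> 0"
proof
  assume "cross3 (p i + p (i + 1)) (q j + q (j + 1)) = 0"
  moreover have a: "(p i + p (i + 1)) \<bullet> hat (f (i, j)) < 0" "(p i + p (i + 1)) \<bullet> hat (f (i + 1, j)) > 0"
    using frameD(3,5,6)[of i j] frameD(3)[of "i + 1" j] assms by (simp_all add: inner_add_left)
  then have "p i + p (i + 1) \<noteq> 0" by auto
  ultimately obtain k where k: "q j + q (j + 1) = k *\<^sub>R (p i + p (i + 1))"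
    using parallel_cross3 by blast
  have "(q j + q (j + 1)) \<bullet> hat (f (i, j)) < 0" "(q j + q (j + 1)) \<bullet> hat (f (i + 1, j)) < 0"
    using frameD(4,8)[of i j] frameD(4,8)[of "i + 1" j] assms by (simp_all add: inner_add_left)
  then show False using a unfolding k by (auto simp: mult_less_0_iff)
qed

end

lemma eq_if_inner_eq:
  fixes X Y :: "real^3"
  assumes "triple3 a b z \<noteq> 0" "X \<bullet> a = Y \<bullet> a" "X \<bullet> b = Y \<bullet> b" "X \<bullet> z = Y \<bullet> z"
  shows "X = Y"
proof (rule ccontr)
  assume "X \<noteq> Y"
  have 0: "(X - Y) \<bullet> a = 0" "(X - Y) \<bullet> b = 0" "(X - Y) \<bullet> z = 0"
    using assms by (simp_all add: inner_diff_left)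
  have "cross3 a b \<noteq> 0" using assms(1) by (auto simp: triple3_cross)
  then obtain k where k: "X - Y = k *\<^sub>R cross3 a b"
    using orthogonal_two_cross3 0 by blast
  then have "k * triple3 a b z = 0" using 0(3) by (simp add: triple3_cross)
  then show False using assms(1) k \<open>X \<noteq> Y\<close> by simp
qed

lemma circ_eq_center:
  assumes "tangent_lines c r a b z z'" "triple3 a b z \<noteq> 0"
  shows "circ a b z = (triple3 a b z / r) *\<^sub>R hat c"
  using assms by (intro eq_if_inner_eq[OF assms(2)])
    (auto simp: circ_inner tangent_lines_def inner_commute[of "hat c"])

definition step_axis :: "real^3 \<Rightarrow> real^3 \<Rightarrow> real^3 \<Rightarrow> real^3 \<Rightarrow> real^3" where
  "step_axis a b c z = cross3 (circ a b z) (circ b c z)"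

text \<open>
  The vector \<open>step_axis a b c z\<close> represents the line through the centres of the circles touching
  \<open>a, b, z\<close> and \<open>b, c, z\<close>; \<open>next_line\<close> is \<open>z\<close> reflected in it, with the orientation reversed.
\<close>

definition next_line :: "real^3 \<Rightarrow> real^3 \<Rightarrow> real^3 \<Rightarrow> real^3 \<Rightarrow> real^3" where
  "next_line a b c z = (let d = step_axis a b c z in - z + (2 * ldot z d / ldot d d) *\<^sub>R d)"

lemma ldot_simps:
  "ldot (u + u') v = ldot u v + ldot u' v" "ldot u (v + v') = ldot u v + ldot u v'"
  "ldot (u - u') v = ldot u v - ldot u' v" "ldot u (v - v') = ldot u v - ldot u v'"
  "ldot (k *\<^sub>R u) v = k * ldot u v" "ldot u (k *\<^sub>R v) = k * ldot u v"
  "ldot (- u) v = - ldot u v" "ldot u (- v) = - ldot u v"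
  by (simp_all add: ldot_def algebra_simps)

lemma ldot_commute: "ldot u v = ldot v u"
  by (simp add: ldot_def mult.commute)

text \<open>z + z' vanishes at both centres, so it is a multiple of
  \<open>step_axis a b c z\<close>. That \<open>z\<close> and \<open>z'\<close> have unit normals
  fixes the multiple through \<open>ldot s s = 2 * ldot z s\<close>, whose other solution s = 0 is
  the excluded z' = -z.\<close>

lemma next_line_eq:
  assumes t0: "tangent_lines c0 r0 a b z z'" and t1: "tangent_lines c1 r1 b c z z'"
    and unit: "ldot z z = 1" "ldot z' z' = 1" and tri: "triple3 a b z \<noteq> 0" "triple3 b c z \<noteq> 0"
    and "z' \<noteq> - z"
  shows "z' = next_line a b c z"
    and "ldot (step_axis a b c z) (step_axis a b c z) \<noteq> 0"
proof -
  define C where "C = cross3 (hat c0) (hat c1)"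
  define d where "d = step_axis a b c z"
  define k where "k = (triple3 a b z / r0) * (triple3 b c z / r1)"
  have r: "0 < r0" "0 < r1" using t0 t1 by (simp_all add: tangent_lines_def)
  have k: "k \<noteq> 0" using tri r by (simp add: k_def)
  have d: "d = k *\<^sub>R C"
    unfolding d_def step_axis_def C_def k_def circ_eq_center[OF t0 tri(1)] circ_eq_center[OF t1 tri(2)]
    by (simp only: cross_mult_left cross_mult_right scaleR_scaleR mult.commute)
  \<comment> \<open>The centres differ because \<open>b\<close> separates them: its value is
    \<open>- r0\<close> at one and \<open>r1\<close> at the other.\<close>
  have "C \<noteq> 0"
  proof
    assume "C = 0"
    moreover have "hat c0 \<noteq> 0" using hat_components(3)[of c0] by (metis zero_index zero_neq_neg_one)
    ultimately obtain l where l: "hat c1 = l *\<^sub>R hat c0"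
      unfolding C_def using parallel_cross3 by blast
    have "hat c1 $ 3 = l * hat c0 $ 3" by (subst l) simp
    then have "l = 1" by simp
    then have "hat c1 = hat c0" using l by (simp only: scaleR_one)
    then show False using t0 t1 r by (simp add: tangent_lines_def)
  qed
  define s where "s = z + z'"
  have s0: "s \<bullet> hat c0 = 0" "s \<bullet> hat c1 = 0"
    using t0 t1 by (simp_all add: s_def tangent_lines_def inner_add_left)
  then obtain \<mu> where \<mu>: "s = \<mu> *\<^sub>R C"
    using orthogonal_two_cross3 \<open>C \<noteq> 0\<close> unfolding C_def by blast
  have "s \<noteq> 0" using \<open>z' \<noteq> - z\<close> by (simp add: s_def add_eq_0_iff)
  then have "\<mu> \<noteq> 0" using \<mu> by auto
  define \<kappa> where "\<kappa> = k / \<mu>"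
  have ds: "d = \<kappa> *\<^sub>R s" using d \<mu> \<open>\<mu> \<noteq> 0\<close> by (simp add: \<kappa>_def)
  have \<kappa>: "\<kappa> \<noteq> 0" using k \<open>\<mu> \<noteq> 0\<close> by (simp add: \<kappa>_def)
  \<comment> \<open>A vector with zero normal has the same value at every point; vanishing at
    \<open>c0\<close>, it would be 0.\<close>
  have "ldot s s \<noteq> 0"
  proof
    assume "ldot s s = 0"
    then have "normal s = 0" by (simp add: ldot_normal)
    moreover have "s $ 3 = 0" using s0(1) calculation by (simp add: inner_hat)
    ultimately have "s = 0" using eq_if_normal_eq[of s 0] by (simp add: vec_eq_iff forall_2)
    then show False using \<open>s \<noteq> 0\<close> by simp
  qed
  moreover have "ldot s s = 2 * ldot z s"
    using unit ldot_commute[of z z'] by (simp add: s_def ldot_simps)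
  ultimately have "(2 * ldot z d / ldot d d) *\<^sub>R d = s"
    using \<kappa> by (simp add: ds ldot_simps)
  then show "z' = next_line a b c z"
    by (simp add: next_line_def d_def[symmetric] s_def)
  show "ldot (step_axis a b c z) (step_axis a b c z) \<noteq> 0"
    using \<kappa> \<open>ldot s s \<noteq> 0\<close> by (simp add: d_def[symmetric] ds ldot_simps)
qed

text \<open>Exchanging the second pair and reversing both orientations restores the signs. Hence the
  passage from a line to the next one can also be run backwards.\<close>

lemma tangent_lines_reverse: "tangent_lines c r a b z z' \<Longrightarrow> tangent_lines c r a b (- z') (- z)"
  by (simp add: tangent_lines_def)

locale circular_net = framed_net +
  assumes circle_frame: "circle_frame (rect m1 m2 n1 n2) p q"
begin

lemma transposed_circular: "circular_net n1 n2 m1 m2 (transpose_net f) q p"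
  using transposed circle_frame_transpose[OF circle_frame]
  by (simp add: circular_net_def circular_net_axioms_def)

lemma tangent:
  assumes "m1 < i" "i + 1 < m2" "n1 < j" "j + 1 < n2"
  shows "\<exists>c r. tangent_lines c r (p i) (p (i + 1)) (q j) (q (j + 1))"
  using circle_frame assms unfolding circle_frame_def by simp

lemma row_step:
  assumes "m1 < i" "i + 2 < m2" "n1 < j" "j + 1 < n2"
  shows "q (j + 1) = next_line (p i) (p (i + 1)) (p (i + 2)) (q j)"
    and "ldot (step_axis (p i) (p (i + 1)) (p (i + 2)) (q j))
      (step_axis (p i) (p (i + 1)) (p (i + 2)) (q j)) \<noteq> 0"
proof -
  obtain c0 r0 where t0: "tangent_lines c0 r0 (p i) (p (i + 1)) (q j) (q (j + 1))"
    using tangent[of i j] assms by auto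
  obtain c1 r1 where t1: "tangent_lines c1 r1 (p (i + 1)) (p (i + 2)) (q j) (q (j + 1))"
    using tangent[of "i + 1" j] assms by (auto simp: add.assoc)
  have "q (j + 1) \<noteq> - q j" using frameD(4,8)[of i j] assms by auto
  then show "q (j + 1) = next_line (p i) (p (i + 1)) (p (i + 2)) (q j)"
    "ldot (step_axis (p i) (p (i + 1)) (p (i + 2)) (q j))
      (step_axis (p i) (p (i + 1)) (p (i + 2)) (q j)) \<noteq> 0"
    using next_line_eq[OF t0 t1] unit_q[of j] unit_q[of "j + 1"] triple_nonzero[of i j] triple_nonzero[of "i + 1" j] assms
    by (simp_all add: add.assoc)
qed

lemma row_step_back:
  assumes "m1 < i" "i + 2 < m2" "n1 < j" "j + 1 < n2"
  shows "- q j = next_line (p i) (p (i + 1)) (p (i + 2)) (- q (j + 1))"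
proof -
  obtain c0 r0 where t0: "tangent_lines c0 r0 (p i) (p (i + 1)) (- q (j + 1)) (- q j)"
    using tangent[of i j] tangent_lines_reverse assms by fastforce
  obtain c1 r1 where t1: "tangent_lines c1 r1 (p (i + 1)) (p (i + 2)) (- q (j + 1)) (- q j)"
    using tangent[of "i + 1" j] tangent_lines_reverse assms by (fastforce simp: add.assoc)
  have m: "triple3 u v (- w) = - triple3 u v w" for u v w by (simp add: triple3_def)
  have "- q j \<noteq> - (- q (j + 1))"
  proof
    assume "- q j = - (- q (j + 1))"
    then have "q (j + 1) \<bullet> hat (f (i, j)) = - (q j \<bullet> hat (f (i, j)))"
      by (metis inner_minus_left minus_minus)
    then show False using frameD(4,8)[of i j] assms by simp
  qed
  then show ?thesis
    using next_line_eq(1)[OF t0 t1] unit_q[of j] unit_q[of "j + 1"] triple_nonzero[of i "j + 1"]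
      triple_nonzero[of "i + 1" "j + 1"] assms
    by (simp add: add.assoc ldot_minus m)
qed

end

text \<open>Both sequences obey the same recursion upwards (\<open>row_step\<close>) and downwards
  (\<open>row_step_back\<close>), so one common line spreads in both directions.\<close>

lemma rows_agree:
  assumes "circular_net m1 m2 n1 n2 f p q" "circular_net m1 m2 n1 n2 g p' q'"
    and i: "m1 < i" "i + 2 < m2" and p: "p' i = p i" "p' (i + 1) = p (i + 1)" "p' (i + 2) = p (i + 2)"
    and k: "n1 < k" "k < n2" "q' k = q k" and j: "n1 < j" "j < n2"
  shows "q' j = q j"
proof -
  interpret A: circular_net m1 m2 n1 n2 f p q by fact
  interpret B: circular_net m1 m2 n1 n2 g p' q' by fact
  show ?thesis
  proof (cases "k \<le> j")
    case True
    then have "j < n2 \<longrightarrow> q' j = q j"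
    proof (induction rule: int_ge_induct)
      case (step l)
      then show ?case using A.row_step(1)[of i l] B.row_step(1)[of i l] i p k by auto
    qed (simp add: k)
    then show ?thesis using j by simp
  next
    case False
    then have "j \<le> k" by simp
    then have "n1 < j \<longrightarrow> q' j = q j"
    proof (induction rule: int_le_induct)
      case (step l)
      show ?case
      proof
        assume "n1 < l - 1"
        then have "- q (l - 1) = - q' (l - 1)"
          using A.row_step_back[of i "l - 1"] B.row_step_back[of i "l - 1"] step i p k by auto
        then show "q' (l - 1) = q (l - 1)" by simp
      qed
    qed (simp add: k)
    then show ?thesis using j by simp
  qed
qed

theorem frames_agree:
  assumes A: "circular_net m1 m2 n1 n2 f p q" and B: "circular_net m1 m2 n1 n2 g p' q'"
    and i: "m1 < i" "i + 2 < m2" and p: "p' i = p i" "p' (i + 1) = p (i + 1)" "p' (i + 2) = p (i + 2)"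
    and k: "n1 < k" "k < n2" "q' k = q k" and size: "4 \<le> n2 - n1 \<or> m2 - m1 = 4"
  shows "\<And>j. n1 < j \<Longrightarrow> j < n2 \<Longrightarrow> q' j = q j" and "\<And>l. m1 < l \<Longrightarrow> l < m2 \<Longrightarrow> p' l = p l"
    and "\<And>l j. m1 < l \<Longrightarrow> l < m2 \<Longrightarrow> n1 < j \<Longrightarrow> j < n2 \<Longrightarrow> g (l, j) = f (l, j)"
proof -
  interpret A: circular_net m1 m2 n1 n2 f p q by fact
  interpret B: circular_net m1 m2 n1 n2 g p' q' by fact
  show q: "q' j = q j" if "n1 < j" "j < n2" for j
    using rows_agree[OF A B i p k that] .
  show p': "p' l = p l" if l: "m1 < l" "l < m2" for l
  \<comment> \<open>With three lines in the other family, now known to agree, the transposed nets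
    give all of \<open>p\<close>. Otherwise m2 - m1 = 4, and the three given lines are already all
    of \<open>p\<close>.\<close>
  proof (cases "4 \<le> n2 - n1")
    case True
    show ?thesis
      by (rule rows_agree[OF A.transposed_circular B.transposed_circular, of "n1 + 1" i])
        (use True q i p l in auto)
  next
    case False
    then have "l = i \<or> l = i + 1 \<or> l = i + 2" using size i l by linarith
    then show ?thesis using p by auto
  qed
  show "g (l, j) = f (l, j)" if l: "m1 < l" "l < m2" and j: "n1 < j" "j < n2" for l j
    using intersection_unique[of "p l" "q j" "g (l, j)" "f (l, j)"] A.cross_nonzero[OF l j]
      A.frameD(3,4)[of l j] B.frameD(3,4)[of l j] p'[OF l] q[OF j] l j by simp
qed

section \<open>Similarities acting on oriented lines and normal position\<close>

text \<open>The image of an oriented line under the similarity z -> k T z + b: the offset is chosen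
  so that all signed distances are multiplied by \<open>k\<close>.\<close>

definition move_line :: "real \<Rightarrow> (real^2 \<Rightarrow> real^2) \<Rightarrow> real^2 \<Rightarrow> real^3 \<Rightarrow> real^3" where
  "move_line k T b u = vector [T (normal u) $ 1, T (normal u) $ 2, k * u $ 3 + T (normal u) \<bullet> b]"

lemma normal_move_line: "normal (move_line k T b u) = T (normal u)"
  by (simp add: move_line_def vec_eq_iff forall_2)

lemma move_line_hat:
  assumes "orthogonal_transformation T"
  shows "move_line k T b u \<bullet> hat (k *\<^sub>R T z + b) = k * (u \<bullet> hat z)"
proof -
  have "T (normal u) \<bullet> T z = normal u \<bullet> z"
    using assms by (simp add: orthogonal_transformation_def)
  then show ?thesis
    unfolding inner_hat normal_move_line
    by (simp add: move_line_def inner_add_right algebra_simps)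
qed

lemma ldot_move_line:
  assumes "orthogonal_transformation T"
  shows "ldot (move_line k T b u) (move_line k T b v) = ldot u v"
  using assms by (simp add: ldot_normal normal_move_line orthogonal_transformation_def)

lemma circular_net_move:
  assumes "circular_net m1 m2 n1 n2 f p q" and T: "orthogonal_transformation T" and "0 < k"
    and g: "\<And>i j. (i, j) \<in> rect m1 m2 n1 n2 \<Longrightarrow> g (i, j) = k *\<^sub>R T (f (i, j)) + b"
  shows "circular_net m1 m2 n1 n2 g (move_line k T b \<circ> p) (move_line k T b \<circ> q)"
proof -
  interpret A: circular_net m1 m2 n1 n2 f p q by fact
  show ?thesis
  proof
    show "line_frame (rect m1 m2 n1 n2) g (move_line k T b \<circ> p) (move_line k T b \<circ> q)"
      using A.line_frame \<open>0 < k\<close> unfolding line_frame_def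
      by (auto simp: g move_line_hat[OF T] ldot_move_line[OF T] mult_less_0_iff)
    show "circle_frame (rect m1 m2 n1 n2) (move_line k T b \<circ> p) (move_line k T b \<circ> q)"
      unfolding circle_frame_def
    proof (intro allI impI)
      fix i j assume "(i, j) \<in> rect m1 m2 n1 n2" "(i + 1, j + 1) \<in> rect m1 m2 n1 n2"
      then obtain c r where "tangent_lines c r (p i) (p (i + 1)) (q j) (q (j + 1))"
        using A.circle_frame unfolding circle_frame_def by blast
      then have "tangent_lines (k *\<^sub>R T c + b) (k * r) (move_line k T b (p i)) (move_line k T b (p (i + 1)))
         (move_line k T b (q j)) (move_line k T b (q (j + 1)))"
        using \<open>0 < k\<close> by (simp add: tangent_lines_def move_line_hat[OF T])
      then show "\<exists>c r. tangent_lines c r ((move_line k T b \<circ> p) i) ((move_line k T b \<circ> p) (i + 1))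
         ((move_line k T b \<circ> q) j) ((move_line k T b \<circ> q) (j + 1))" by auto
    qed
  qed (use A.size in auto)
qed

lemma circular_net_IC_net:
  assumes "circular_net m1 m2 n1 n2 f p q"
  shows "IC_net (rect m1 m2 n1 n2) f"
proof -
  interpret circular_net m1 m2 n1 n2 f p q by fact
  show ?thesis using IC_net_if_frames[OF refl line_frame circle_frame] size by simp
qed

lemma IC_net_circular_net:
  assumes "IC_net (rect m1 m2 n1 n2) f" "m1 + 2 < m2" "n1 + 2 < n2"
  shows "\<exists>p q. circular_net m1 m2 n1 n2 f p q"
proof -
  obtain p q where "line_frame (rect m1 m2 n1 n2) f p q" "circle_frame (rect m1 m2 n1 n2) p q"
    using frames_if_IC_net[OF refl assms] by blast
  then have "circular_net m1 m2 n1 n2 f p q"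
    using assms(2,3) by unfold_locales
  then show ?thesis by blast
qed

text \<open>The rows of \<open>T\<close> are the unit vector of the first edge and the normal of
  \<open>q j\<close>. Nothing is assumed about the orientation of this pair, so \<open>T\<close> may
  be a reflection. As reflections count as similarities, cosines, which do not see orientation, can
  separate the classes.\<close>

lemma circular_net_normalize:
  assumes "circular_net m1 m2 n1 n2 f p q" and j: "n1 < j" "j < n2"
  shows "\<exists>k T b. 0 < k \<and> orthogonal_transformation T \<and>
    k *\<^sub>R T (f (m1 + 1, j)) + b = 0 \<and> k *\<^sub>R T (f (m1 + 2, j)) + b = vector [1, 0] \<and>
    move_line k T b (q j) = vector [0, 1, 0]"
proof -
  interpret circular_net m1 m2 n1 n2 f p q by fact
  define d where "d = f (m1 + 2, j) - f (m1 + 1, j)"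
  define w where "w = normal (q j)"
  define t where "t = (1 / norm d) *\<^sub>R d"
  define T where "T x = (vector [t \<bullet> x, w \<bullet> x] :: real^2)" for x
  define k where "k = 1 / norm d"
  define b where "b = - (k *\<^sub>R T (f (m1 + 1, j)))"
  have m: "m1 + 2 = m1 + 1 + 1" by simp
  have "d \<noteq> 0" using frameD(3,5)[of "m1 + 1" j] size j by (auto simp: d_def m)
  have w1: "norm w = 1" unfolding w_def using unit_q j by (intro norm_normal) auto
  have wd: "w \<bullet> d = 0"
    using frameD(4)[of "m1 + 1" j] frameD(4)[of "m1 + 2" j] size j by (simp add: d_def w_def inner_hat_diff[symmetric])
  have t1: "norm t = 1" using \<open>d \<noteq> 0\<close> by (simp add: t_def)
  have wt: "w \<bullet> t = 0" by (simp add: t_def wd)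
  have "linear T"
    unfolding T_def by (rule linearI) (simp_all add: vec_eq_iff forall_2 inner_simps)
  moreover have "norm (T x) = norm x" for x
  proof -
    define e where "e = (w $ 1 * t $ 2 - w $ 2 * t $ 1)"
    have te: "t = e *\<^sub>R vector [- w $ 2, w $ 1]"
      using real2_orthogonal[OF w1 wt] by (simp only: e_def)
    have t: "t $ 1 = - e * w $ 2" "t $ 2 = e * w $ 1"
      by (subst te, simp)+
    have ww: "w $ 1 * w $ 1 + w $ 2 * w $ 2 = 1" "t $ 1 * t $ 1 + t $ 2 * t $ 2 = 1"
      using w1 t1 by (simp_all add: norm_eq_1 inner_vec_def sum_2)
    have "e * e * (w $ 1 * w $ 1 + w $ 2 * w $ 2) = 1"
      using ww(2) by (simp add: t algebra_simps)
    then have ee: "e * e = 1" by (simp add: ww)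
    have "T x \<bullet> T x = (e * e) * (w $ 1 * x $ 2 - w $ 2 * x $ 1)\<^sup>2 + (w $ 1 * x $ 1 + w $ 2 * x $ 2)\<^sup>2"
      by (simp add: T_def inner_vec_def sum_2 t algebra_simps power2_eq_square)
    also have "\<dots> = (w $ 1 * w $ 1 + w $ 2 * w $ 2) * (x $ 1 * x $ 1 + x $ 2 * x $ 2)"
      by (simp add: ee algebra_simps power2_eq_square)
    also have "\<dots> = x \<bullet> x" by (simp add: ww inner_vec_def sum_2)
    finally show ?thesis by (simp add: norm_eq_sqrt_inner)
  qed
  ultimately have T: "orthogonal_transformation T"
    by (simp add: orthogonal_transformation)
  have Td: "T d = vector [norm d, 0]"
    using \<open>d \<noteq> 0\<close> by (simp add: T_def wd t_def power2_norm_eq_inner[symmetric] power2_eq_square)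
  have "k *\<^sub>R T (f (m1 + 2, j)) + b = k *\<^sub>R T d"
    using \<open>linear T\<close> by (simp add: b_def d_def linear_diff scaleR_diff_right)
  also have "\<dots> = vector [1, 0]" using \<open>d \<noteq> 0\<close> by (simp add: Td k_def vec_eq_iff forall_2)
  finally have 1: "k *\<^sub>R T (f (m1 + 2, j)) + b = vector [1, 0]" .
  have 0: "k *\<^sub>R T (f (m1 + 1, j)) + b = 0" by (simp add: b_def)
  have Tw: "T w = vector [0, 1]"
    using w1 wt by (simp add: T_def inner_commute[of t] norm_eq_1)
  have "move_line k T b (q j) \<bullet> hat 0 = 0"
    using move_line_hat[OF T, of k b "q j" "f (m1 + 1, j)"] frameD(4)[of "m1 + 1" j] size j 0 by simp
  then have "move_line k T b (q j) $ 3 = 0" by (simp add: inner_hat)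
  then have "move_line k T b (q j) = vector [0, 1, 0]"
    using normal_move_line[of k T b "q j"] by (intro eq_if_normal_eq) (simp_all add: Tw w_def[symmetric] vec_eq_iff forall_2)
  then show ?thesis using T 0 1 \<open>d \<noteq> 0\<close> by (intro exI[of _ k] exI[of _ T] exI[of _ b]) (simp add: k_def)
qed

definition cosine :: "real^2 \<Rightarrow> real^2 \<Rightarrow> real" where
  "cosine x y = (x \<bullet> y) / (norm x * norm y)"

text \<open>\<open>x\<close> and \<open>y\<close> are multiples of the normals turned by a right
  angle in the same sense. The two positivity conditions force factors of opposite sign, whence the
  minus.\<close>

lemma cosine_crossing_lines:
  assumes u: "ldot u u = 1" "normal u \<bullet> x = 0" and v: "ldot v v = 1" "normal v \<bullet> y = 0"
    and "0 < normal v \<bullet> x" "0 < normal u \<bullet> y"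
  shows "cosine x y = - ldot u v"
proof -
  obtain a where a: "x = a *\<^sub>R vector [- normal u $ 2, normal u $ 1]"
    using real2_orthogonal[OF norm_normal[OF u(1)] u(2)] by blast
  obtain b where b: "y = b *\<^sub>R vector [- normal v $ 2, normal v $ 1]"
    using real2_orthogonal[OF norm_normal[OF v(1)] v(2)] by blast
  have n: "norm (vector [- w $ 2, w $ 1] :: real^2) = 1" if "ldot w w = 1" for w
    using that by (simp add: norm_eq_1 ldot_def inner_vec_def sum_2 add.commute)
  have "normal v \<bullet> x = a * (u $ 1 * v $ 2 - u $ 2 * v $ 1)" "normal u \<bullet> y = - b * (u $ 1 * v $ 2 - u $ 2 * v $ 1)"
    by (simp_all add: a b inner_vec_def sum_2 algebra_simps)
  then have ab: "a * b < 0"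
    using assms(5,6) by (auto simp: zero_less_mult_iff mult_less_0_iff)
  have "x \<bullet> y = a * b * ldot u v"
    by (simp add: a b ldot_def inner_vec_def sum_2 algebra_simps)
  moreover have "norm x = \<bar>a\<bar>" "norm y = \<bar>b\<bar>"
    by (simp_all add: a b n[OF u(1)] n[OF v(1)])
  moreover have "\<bar>a\<bar> * \<bar>b\<bar> = - (a * b)" using ab by (simp add: abs_mult[symmetric])
  ultimately have "cosine x y = (a * b * ldot u v) / (- (a * b))" by (simp add: cosine_def)
  moreover have "a \<noteq> 0" "b \<noteq> 0" using ab by auto
  ultimately show ?thesis by simp
qed

section \<open>A chart of the moduli space\<close>

text \<open>
  The coordinates are the cosines of the angles between \<open>l 0\<close> and \<open>m 0\<close>, \<open>l 1\<close> and \<open>m 0\<close>, \<open>l 1\<close> and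
  \<open>m 1\<close>, \<open>l 2\<close> and \<open>m 0\<close> at the corner \<open>(i, j)\<close> of the net.
\<close>

definition chart :: "int \<Rightarrow> int \<Rightarrow> (int \<times> int \<Rightarrow> real^2) \<Rightarrow> nat \<Rightarrow> real" where
  "chart i j f = (\<lambda>k.
     if k = 0 then cosine (f (i, j + 1) - f (i, j)) (f (i + 1, j) - f (i, j))
     else if k = 1 then cosine (f (i + 1, j + 1) - f (i + 1, j)) (f (i + 1, j) - f (i, j))
     else if k = 2 then cosine (f (i + 1, j + 1) - f (i + 1, j)) (f (i + 1, j + 1) - f (i, j + 1))
     else if k = 3 then cosine (f (i + 2, j + 1) - f (i + 2, j)) (f (i + 2, j) - f (i + 1, j))
     else 0)"

text \<open>The offset makes the line tangent to the circle touching \<open>a, b, z\<close>, on the side of \<open>b\<close>.\<close>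

definition tangent_line :: "real^3 \<Rightarrow> real^3 \<Rightarrow> real^3 \<Rightarrow> real^2 \<Rightarrow> real^3" where
  "tangent_line a b z w = vector [w $ 1, w $ 2,
     - (triple3 a b z + circ a b z $ 1 * w $ 1 + circ a b z $ 2 * w $ 2) / circ a b z $ 3]"

text \<open>The unit vector that has cosine \<open>- c\<close> with the normal of a unit line
  \<open>v\<close> and lies on its counterclockwise side; the sign of \<open>c\<close> is that of
  \<open>cosine_crossing_lines\<close>.\<close>

definition turn :: "real^3 \<Rightarrow> real \<Rightarrow> real^2" where
  "turn v c = vector [- c * v $ 1 - sqrt (1 - c\<^sup>2) * v $ 2, - c * v $ 2 + sqrt (1 - c\<^sup>2) * v $ 1]"

definition axis_line :: "real^3" where "axis_line = vector [0, 1, 0]"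

text \<open>
  The net with given coordinates is normalised by \<open>f (i, j) = 0\<close> and \<open>f (i + 1, j) = (1, 0)\<close>, so that
  \<open>m 0\<close> is the first coordinate axis.
\<close>

definition line_l0 :: "(nat \<Rightarrow> real) \<Rightarrow> real^3" where
  "line_l0 x = vector [sqrt (1 - (x 0)\<^sup>2), - x 0, 0]"

definition line_l1 :: "(nat \<Rightarrow> real) \<Rightarrow> real^3" where
  "line_l1 x = vector [sqrt (1 - (x 1)\<^sup>2), - x 1, sqrt (1 - (x 1)\<^sup>2)]"

definition line_m1 :: "(nat \<Rightarrow> real) \<Rightarrow> real^3" where
  "line_m1 x = tangent_line (line_l0 x) (line_l1 x) axis_line (turn (line_l1 x) (x 2))"

text \<open>This closes the second square with the families exchanged: the circle touching m_0, m_1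
  and l_1 is known, and l_2 is its tangent of prescribed direction.\<close>

definition line_l2 :: "(nat \<Rightarrow> real) \<Rightarrow> real^3" where
  "line_l2 x = tangent_line axis_line (line_m1 x) (line_l1 x) (vector [sqrt (1 - (x 3)\<^sup>2), - x 3])"

fun m_seq :: "(nat \<Rightarrow> real) \<Rightarrow> nat \<Rightarrow> real^3" where
  "m_seq x 0 = axis_line"
| "m_seq x (Suc 0) = line_m1 x"
| "m_seq x (Suc (Suc n)) = next_line (line_l0 x) (line_l1 x) (line_l2 x) (m_seq x (Suc n))"

fun l_seq :: "(nat \<Rightarrow> real) \<Rightarrow> nat \<Rightarrow> real^3" where
  "l_seq x 0 = line_l0 x"
| "l_seq x (Suc 0) = line_l1 x"
| "l_seq x (Suc (Suc 0)) = line_l2 x"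
| "l_seq x (Suc (Suc (Suc n))) = next_line (m_seq x 0) (m_seq x 1) (m_seq x 2) (l_seq x (Suc (Suc n)))"

definition meet_point :: "real^3 \<Rightarrow> real^3 \<Rightarrow> real^2" where
  "meet_point u v = vector [- cross3 u v $ 1 / cross3 u v $ 3, - cross3 u v $ 2 / cross3 u v $ 3]"

lemma hat_meet_point:
  assumes "cross3 u v $ 3 \<noteq> 0"
  shows "hat (meet_point u v) = (- 1 / cross3 u v $ 3) *\<^sub>R cross3 u v"
  using assms by (simp add: meet_point_def vec_eq_iff forall_3)

lemma meet_point_on_lines:
  assumes "cross3 u v $ 3 \<noteq> 0"
  shows "u \<bullet> hat (meet_point u v) = 0" "v \<bullet> hat (meet_point u v) = 0"
  unfolding hat_meet_point[OF assms] by (simp_all add: dot_cross_self)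

lemma meet_point_unique:
  assumes "cross3 u v $ 3 \<noteq> 0" "u \<bullet> hat z = 0" "v \<bullet> hat z = 0"
  shows "z = meet_point u v"
  using intersection_unique[OF assms(1) assms(2,3) meet_point_on_lines[OF assms(1)]] .

lemma inner_3: "(u :: real^3) \<bullet> v = u $ 1 * v $ 1 + u $ 2 * v $ 2 + u $ 3 * v $ 3"
  by (simp add: inner_vec_def sum_3)

lemma normal_tangent_line [simp]: "normal (tangent_line a b z w) = w"
  by (simp add: tangent_line_def vec_eq_iff forall_2)

lemma circ_tangent_line:
  assumes "circ a b z $ 3 \<noteq> 0"
  shows "circ a b z \<bullet> tangent_line a b z w = - triple3 a b z"
  using assms by (simp add: tangent_line_def inner_3)

lemma tangent_line_eq:
  assumes "circ a b z $ 3 \<noteq> 0" "circ a b z \<bullet> u = - triple3 a b z"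
  shows "u = tangent_line a b z (normal u)"
proof (rule eq_if_normal_eq)
  show "u $ 3 = tangent_line a b z (normal u) $ 3"
    using assms by (simp add: tangent_line_def inner_3 field_simps)
qed simp

lemma ldot_turn:
  assumes "ldot v v = 1" "\<bar>c\<bar> < 1"
  shows "turn v c \<bullet> turn v c = 1" "normal v \<bullet> turn v c = - c"
proof -
  have v: "v $ 1 * v $ 1 + v $ 2 * v $ 2 = 1" using assms(1) by (simp add: ldot_def)
  define s where "s = sqrt (1 - c\<^sup>2)"
  have "c\<^sup>2 < 1" using assms(2) by (simp add: abs_square_less_1)
  then have s: "s * s = 1 - c\<^sup>2" by (simp add: s_def)
  have turn: "turn v c = vector [- c * v $ 1 - s * v $ 2, - c * v $ 2 + s * v $ 1]"
    by (simp only: turn_def s_def)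
  have "turn v c \<bullet> turn v c = (c\<^sup>2 + s * s) * (v $ 1 * v $ 1 + v $ 2 * v $ 2)"
    by (simp add: turn inner_vec_def sum_2 algebra_simps power2_eq_square)
  then show "turn v c \<bullet> turn v c = 1" by (simp add: v s)
  have "normal v \<bullet> turn v c = - c * (v $ 1 * v $ 1 + v $ 2 * v $ 2)"
    by (simp add: turn inner_vec_def sum_2 algebra_simps)
  then show "normal v \<bullet> turn v c = - c" by (simp add: v)
qed

lemma turn_unique:
  assumes "ldot v v = 1" "ldot w w = 1" "ldot v w = - c" "0 < cross3 v w $ 3"
  shows "normal w = turn v c" "\<bar>c\<bar> < 1"
proof -
  have v: "v $ 1 * v $ 1 + v $ 2 * v $ 2 = 1" and w: "w $ 1 * w $ 1 + w $ 2 * w $ 2 = 1"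
    using assms by (simp_all add: ldot_def)
  define s where "s = cross3 v w $ 3"
  have s: "s = v $ 1 * w $ 2 - v $ 2 * w $ 1" by (simp add: s_def cross3_third)
  have c: "- c = v $ 1 * w $ 1 + v $ 2 * w $ 2" using assms(3) by (simp add: ldot_def)
  have "s * s + (- c) * (- c) = (v $ 1 * v $ 1 + v $ 2 * v $ 2) * (w $ 1 * w $ 1 + w $ 2 * w $ 2)"
    unfolding s c by (simp add: algebra_simps)
  then have sc: "s\<^sup>2 = 1 - c\<^sup>2" by (simp add: v w power2_eq_square)
  have "0 < s" using assms(4) by (simp add: s_def)
  then have "c\<^sup>2 < 1" using sc by (metis diff_gt_0_iff_gt zero_less_power)
  then show "\<bar>c\<bar> < 1" by (simp add: abs_square_less_1)
  have "s = sqrt (1 - c\<^sup>2)" using sc \<open>0 < s\<close> by (metis less_imp_le real_sqrt_unique)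
  moreover have "w $ 1 = (- c) * v $ 1 - s * v $ 2"
  proof -
    have "(- c) * v $ 1 - s * v $ 2 = (v $ 1 * v $ 1 + v $ 2 * v $ 2) * w $ 1"
      unfolding s c by (simp add: algebra_simps)
    then show ?thesis by (simp add: v)
  qed
  moreover have "w $ 2 = (- c) * v $ 2 + s * v $ 1"
  proof -
    have "(- c) * v $ 2 + s * v $ 1 = (v $ 1 * v $ 1 + v $ 2 * v $ 2) * w $ 2"
      unfolding s c by (simp add: algebra_simps)
    then show ?thesis by (simp add: v)
  qed
  ultimately show "normal w = turn v c"
    by (simp add: turn_def vec_eq_iff forall_2)
qed

lemma ldot_next_line:
  assumes "ldot z z = 1"
    and "ldot (step_axis a b c z) (step_axis a b c z) \<noteq> 0"
  shows "ldot (next_line a b c z) (next_line a b c z) = 1"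
proof -
  define d where "d = step_axis a b c z"
  define k where "k = 2 * ldot z d / ldot d d"
  have "ldot d d \<noteq> 0" using assms(2) by (simp add: d_def)
  then have k: "k * ldot d d = 2 * ldot z d" by (simp add: k_def)
  have "next_line a b c z = - z + k *\<^sub>R d" by (simp add: next_line_def d_def k_def Let_def)
  then have "ldot (next_line a b c z) (next_line a b c z) = ldot z z - 2 * k * ldot z d + k * (k * ldot d d)"
    by (simp only: ldot_simps) (simp add: ldot_commute[of d z] algebra_simps)
  also have "\<dots> = 1" by (simp only: k) (simp add: assms(1) algebra_simps)
  finally show ?thesis .
qed

text \<open>z plus its next line is a multiple of the cross product of the two \<open>circ\<close>
  vectors, so one step closes two squares at once.\<close>

lemma circ_next_line:
  "circ a b z \<bullet> (z + next_line a b c z) = 0" "circ b c z \<bullet> (z + next_line a b c z) = 0"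
  by (simp_all add: next_line_def step_axis_def Let_def dot_cross_self)

section \<open>Continuity of the constructions\<close>

lemma tendsto_vector_3:
  assumes "(f \<longlongrightarrow> a) F" "(g \<longlongrightarrow> b) F" "(h \<longlongrightarrow> c) F"
  shows "((\<lambda>x. vector [f x, g x, h x] :: real^3) \<longlongrightarrow> vector [a, b, c]) F"
proof (rule vec_tendstoI)
  fix i :: 3
  consider "i = 1" | "i = 2" | "i = 3" using exhaust_3 by blast
  then show "((\<lambda>x. (vector [f x, g x, h x] :: real^3) $ i) \<longlongrightarrow> vector [a, b, c] $ i) F"
    using assms by cases simp_all
qed

lemma tendsto_vector_2:
  assumes "(f \<longlongrightarrow> a) F" "(g \<longlongrightarrow> b) F"
  shows "((\<lambda>x. vector [f x, g x] :: real^2) \<longlongrightarrow> vector [a, b]) F"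
proof (rule vec_tendstoI)
  fix i :: 2
  consider "i = 1" | "i = 2" using exhaust_2 by blast
  then show "((\<lambda>x. (vector [f x, g x] :: real^2) $ i) \<longlongrightarrow> vector [a, b] $ i) F"
    using assms by cases simp_all
qed

lemma tendsto_cross3 [tendsto_intros]:
  "(f \<longlongrightarrow> a) F \<Longrightarrow> (g \<longlongrightarrow> b) F \<Longrightarrow> ((\<lambda>x. cross3 (f x) (g x)) \<longlongrightarrow> cross3 a b) F"
  unfolding cross3_def by (intro tendsto_vector_3 tendsto_intros)

lemma tendsto_triple3 [tendsto_intros]:
  "(f \<longlongrightarrow> a) F \<Longrightarrow> (g \<longlongrightarrow> b) F \<Longrightarrow> (h \<longlongrightarrow> c) F \<Longrightarrow>
    ((\<lambda>x. triple3 (f x) (g x) (h x)) \<longlongrightarrow> triple3 a b c) F"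
  unfolding triple3_def by (intro tendsto_intros)

lemma tendsto_circ [tendsto_intros]:
  "(f \<longlongrightarrow> a) F \<Longrightarrow> (g \<longlongrightarrow> b) F \<Longrightarrow> (h \<longlongrightarrow> c) F \<Longrightarrow>
    ((\<lambda>x. circ (f x) (g x) (h x)) \<longlongrightarrow> circ a b c) F"
  unfolding circ_def by (intro tendsto_intros)

lemma tendsto_step_axis [tendsto_intros]:
  "(f \<longlongrightarrow> a) F \<Longrightarrow> (g \<longlongrightarrow> b) F \<Longrightarrow> (h \<longlongrightarrow> c) F \<Longrightarrow> (k \<longlongrightarrow> z) F \<Longrightarrow>
    ((\<lambda>x. step_axis (f x) (g x) (h x) (k x)) \<longlongrightarrow> step_axis a b c z) F"
  unfolding step_axis_def by (intro tendsto_intros)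

lemma tendsto_ldot [tendsto_intros]:
  "(f \<longlongrightarrow> a) F \<Longrightarrow> (g \<longlongrightarrow> b) F \<Longrightarrow> ((\<lambda>x. ldot (f x) (g x)) \<longlongrightarrow> ldot a b) F"
  unfolding ldot_def by (intro tendsto_intros)

lemma tendsto_hat [tendsto_intros]:
  "(f \<longlongrightarrow> a) F \<Longrightarrow> ((\<lambda>x. hat (f x)) \<longlongrightarrow> hat a) F"
  unfolding hat_def by (intro tendsto_vector_3 tendsto_intros)

lemma tendsto_meet_point:
  assumes "(f \<longlongrightarrow> u) F" "(g \<longlongrightarrow> v) F" "cross3 u v $ 3 \<noteq> 0"
  shows "((\<lambda>x. meet_point (f x) (g x)) \<longlongrightarrow> meet_point u v) F"
  unfolding meet_point_def using assms by (intro tendsto_vector_2 tendsto_intros)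

lemma tendsto_tangent_line:
  assumes "(f \<longlongrightarrow> a) F" "(g \<longlongrightarrow> b) F" "(h \<longlongrightarrow> c) F" "(k \<longlongrightarrow> w) F"
    and "circ a b c $ 3 \<noteq> 0"
  shows "((\<lambda>x. tangent_line (f x) (g x) (h x) (k x)) \<longlongrightarrow> tangent_line a b c w) F"
  unfolding tangent_line_def using assms by (intro tendsto_vector_3 tendsto_intros)

lemma tendsto_next_line:
  assumes "(f \<longlongrightarrow> a) F" "(g \<longlongrightarrow> b) F" "(h \<longlongrightarrow> c) F" "(k \<longlongrightarrow> z) F"
    and "ldot (step_axis a b c z) (step_axis a b c z) \<noteq> 0"
  shows "((\<lambda>x. next_line (f x) (g x) (h x) (k x)) \<longlongrightarrow> next_line a b c z) F"
  unfolding next_line_def Let_def using assms by (intro tendsto_intros)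

lemma tendsto_turn:
  "(f \<longlongrightarrow> a) F \<Longrightarrow> (g \<longlongrightarrow> b) F \<Longrightarrow> ((\<lambda>x. turn (f x) (g x)) \<longlongrightarrow> turn a b) F"
  unfolding turn_def by (intro tendsto_vector_2 tendsto_intros)

lemma tendsto_coordinate: "((\<lambda>x :: nat \<Rightarrow> real. x k) \<longlongrightarrow> x0 k) (nhds x0)"
proof -
  have "continuous_on UNIV (\<lambda>x :: nat \<Rightarrow> real. x k)" by (rule continuous_on_product_coordinates)
  then have "isCont (\<lambda>x :: nat \<Rightarrow> real. x k) x0"
    using continuous_on_eq_continuous_at[OF open_UNIV] by blast
  then show ?thesis by (simp add: isCont_def tendsto_nhds_iff)
qed

context framed_net
begin

lemma chart_eq_ldot:
  assumes "m1 + 3 < m2"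
  shows "chart (m1 + 1) (n1 + 1) f 0 = - ldot (p (m1 + 1)) (q (n1 + 1))"
    "chart (m1 + 1) (n1 + 1) f 1 = - ldot (p (m1 + 2)) (q (n1 + 1))"
    "chart (m1 + 1) (n1 + 1) f 2 = - ldot (p (m1 + 2)) (q (n1 + 2))"
    "chart (m1 + 1) (n1 + 1) f 3 = - ldot (p (m1 + 3)) (q (n1 + 1))"
proof -
  \<comment> \<open>The two edges meet at the crossing of the two lines, but either of them may
    start or end there; the alternatives for \<open>i\<close> and \<open>j'\<close> cover all four
    coordinates.\<close>
  have cos: "cosine (f (i, j + 1) - f (i, j)) (f (i' + 1, j') - f (i', j')) = - ldot (p i) (q j')"
    if "m1 < i" "i < m2" "n1 < j" "j + 1 < n2" "m1 < i'" "i' + 1 < m2" "n1 < j'" "j' < n2"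
      "i = i' \<or> i = i' + 1" "j' = j \<or> j' = j + 1" for i i' j j'
  proof (rule cosine_crossing_lines)
    show "ldot (p i) (p i) = 1" "ldot (q j') (q j') = 1" using that unit_p unit_q by auto
    show "normal (p i) \<bullet> (f (i, j + 1) - f (i, j)) = 0"
      using frameD(3)[of i j] frameD(3)[of i "j + 1"] that by (simp add: inner_hat_diff[symmetric])
    show "normal (q j') \<bullet> (f (i' + 1, j') - f (i', j')) = 0"
      using frameD(4)[of i' j'] frameD(4)[of "i' + 1" j'] that by (simp add: inner_hat_diff[symmetric])
    show "0 < normal (q j') \<bullet> (f (i, j + 1) - f (i, j))"
      using frameD(4)[of i j] frameD(4)[of i "j + 1"] frameD(7)[of i j] frameD(8)[of i j] that
      by (auto simp: inner_hat_diff[symmetric])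
    show "0 < normal (p i) \<bullet> (f (i' + 1, j') - f (i', j'))"
      using frameD(3)[of i' j'] frameD(3)[of "i' + 1" j'] frameD(5)[of i' j'] frameD(6)[of i' j'] that
      by (auto simp: inner_hat_diff[symmetric])
  qed
  show "chart (m1 + 1) (n1 + 1) f 0 = - ldot (p (m1 + 1)) (q (n1 + 1))"
    using cos[of "m1 + 1" "n1 + 1" "m1 + 1" "n1 + 1"] assms size by (simp add: chart_def)
  show "chart (m1 + 1) (n1 + 1) f 1 = - ldot (p (m1 + 2)) (q (n1 + 1))"
    using cos[of "m1 + 2" "n1 + 1" "m1 + 1" "n1 + 1"] assms size by (simp add: chart_def add.assoc)
  show "chart (m1 + 1) (n1 + 1) f 2 = - ldot (p (m1 + 2)) (q (n1 + 2))"
    using cos[of "m1 + 2" "n1 + 1" "m1 + 1" "n1 + 2"] assms size by (simp add: chart_def add.assoc)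
  show "chart (m1 + 1) (n1 + 1) f 3 = - ldot (p (m1 + 3)) (q (n1 + 1))"
    using cos[of "m1 + 3" "n1 + 1" "m1 + 2" "n1 + 1"] assms size by (simp add: chart_def add.assoc)
qed

end

lemma chart_eq_0: "4 \<le> k \<Longrightarrow> chart i j f k = 0"
  by (auto simp: chart_def)

lemma circ_tangent_lines:
  assumes "tangent_lines c r a b z z'" "triple3 a b z \<noteq> 0"
  shows "circ a b z $ 3 \<noteq> 0" "circ a b z \<bullet> z' = - triple3 a b z" "triple3 a b z * circ a b z $ 3 < 0"
proof -
  have r: "0 < r" and z': "z' \<bullet> hat c = - r" using assms(1) by (simp_all add: tangent_lines_def)
  have C: "circ a b z = (triple3 a b z / r) *\<^sub>R hat c" by (rule circ_eq_center[OF assms])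
  then have 3: "circ a b z $ 3 = - triple3 a b z / r" by simp
  then show "circ a b z $ 3 \<noteq> 0" using assms(2) r by simp
  show "circ a b z \<bullet> z' = - triple3 a b z"
    using r z' by (simp add: C inner_commute[of "hat c"])
  have "0 < triple3 a b z * triple3 a b z" using assms(2) by (metis not_real_square_gt_zero)
  then show "triple3 a b z * circ a b z $ 3 < 0" using r by (simp add: 3)
qed

text \<open>\<open>circ a b z\<close> is a multiple of (c, -1), so its components give the centre,
  and the radius is minus the quotient of \<open>triple3 a b z\<close> by the third component. The
  negative product expresses that the radius is positive, without a division.\<close>

lemma tangent_lines_if_circ:
  assumes "circ a b z \<bullet> (z + z') = 0" "triple3 a b z * circ a b z $ 3 < 0"
  shows "\<exists>c r. tangent_lines c r a b z z'"
proof -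
  define C where "C = circ a b z"
  define t where "t = triple3 a b z"
  have tC: "t * C $ 3 < 0" using assms(2) by (simp add: C_def t_def)
  then have 3: "C $ 3 \<noteq> 0" by auto
  define c :: "real^2" where "c = vector [- C $ 1 / C $ 3, - C $ 2 / C $ 3]"
  have hat: "hat c = (- 1 / C $ 3) *\<^sub>R C" using 3 by (simp add: c_def vec_eq_iff forall_3)
  have in_C: "a \<bullet> C = t" "b \<bullet> C = - t" "z \<bullet> C = t"
    using circ_inner[of a b z] by (simp_all add: C_def t_def inner_commute)
  moreover have "z' \<bullet> C = - t"
    using assms(1) in_C(3) by (simp add: C_def[symmetric] inner_add_right inner_commute)
  moreover have "0 < - t / C $ 3" using tC by (auto simp: zero_less_divide_iff mult_less_0_iff divide_less_0_iff)
  ultimately have "tangent_lines c (- t / C $ 3) a b z z'"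
    by (simp add: tangent_lines_def hat)
  then show ?thesis by blast
qed

lemma axis_components [simp]: "axis_line $ 1 = 0" "axis_line $ 2 = 1" "axis_line $ 3 = 0"
  by (simp_all add: axis_line_def)

section \<open>Nets in normal position: lines and points as functions of the coordinates\<close>

locale normalized_net = circular_net +
  fixes x0 :: "nat \<Rightarrow> real"
  assumes columns: "m1 + 3 < m2" and rows: "4 \<le> n2 - n1 \<or> m2 - m1 = 4"
    and corner: "f (m1 + 1, n1 + 1) = 0" "f (m1 + 2, n1 + 1) = vector [1, 0]" "q (n1 + 1) = axis_line"
    and x0: "x0 = chart (m1 + 1) (n1 + 1) f"
begin

interpretation T: circular_net n1 n2 m1 m2 "transpose_net f" q p
  by (rule transposed_circular)

lemma x0_ldot:
  "ldot (p (m1 + 1)) (q (n1 + 1)) = - x0 0" "ldot (p (m1 + 2)) (q (n1 + 1)) = - x0 1"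
  "ldot (p (m1 + 2)) (q (n1 + 2)) = - x0 2" "ldot (p (m1 + 3)) (q (n1 + 1)) = - x0 3"
  using chart_eq_ldot[OF columns] by (simp_all add: x0)

lemma adds: "m1 + 1 + 1 = m1 + 2" "m1 + 1 + 2 = m1 + 3" "m1 + 2 + 1 = m1 + 3" "n1 + 1 + 1 = n1 + 2"
  by simp_all


lemma unit_with_second:
  fixes u :: "real^3"
  assumes "ldot u u = 1" "ldot u axis_line = - c" "0 < u $ 1"
  shows "u $ 1 = sqrt (1 - c\<^sup>2)" "u $ 2 = - c" "\<bar>c\<bar> < 1"
proof -
  show 2: "u $ 2 = - c" using assms(2) by (simp add: ldot_def)
  have 1: "(u $ 1)\<^sup>2 = 1 - c\<^sup>2" using assms(1) 2 by (simp add: ldot_def power2_eq_square)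
  then show "u $ 1 = sqrt (1 - c\<^sup>2)" using assms(3) by (metis less_imp_le real_sqrt_unique)
  have "c\<^sup>2 < 1" using 1 assms(3) by (metis diff_gt_0_iff_gt zero_less_power)
  then show "\<bar>c\<bar> < 1" by (simp add: abs_square_less_1)
qed

lemma l0_eq: "p (m1 + 1) = line_l0 x0" "\<bar>x0 0\<bar> < 1"
proof -
  have "p (m1 + 1) $ 3 = 0"
    using frameD(3)[of "m1 + 1" "n1 + 1"] size by (simp add: corner inner_hat)
  moreover have "0 < p (m1 + 1) $ 1"
    using frameD(5)[of "m1 + 1" "n1 + 1"] size columns calculation by (simp add: adds corner inner_3)
  moreover have "ldot (p (m1 + 1)) (p (m1 + 1)) = 1" using unit_p size by simp
  ultimately show "p (m1 + 1) = line_l0 x0" "\<bar>x0 0\<bar> < 1"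
    using unit_with_second[of "p (m1 + 1)" "x0 0"] x0_ldot(1)
    by (simp_all add: corner line_l0_def vec_eq_iff forall_3)
qed

lemma l1_eq: "p (m1 + 2) = line_l1 x0" "\<bar>x0 1\<bar> < 1" "0 < p (m1 + 2) $ 1"
proof -
  have 3: "p (m1 + 2) $ 3 = p (m1 + 2) $ 1"
    using frameD(3)[of "m1 + 2" "n1 + 1"] size columns by (simp add: corner inner_3)
  moreover show 1: "0 < p (m1 + 2) $ 1"
    using frameD(6)[of "m1 + 1" "n1 + 1"] size columns 3 by (simp add: adds corner inner_hat)
  moreover have "ldot (p (m1 + 2)) (p (m1 + 2)) = 1" using unit_p size columns by simp
  ultimately show "p (m1 + 2) = line_l1 x0" "\<bar>x0 1\<bar> < 1"
    using unit_with_second[of "p (m1 + 2)" "x0 1"] x0_ldot(2)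
    by (simp_all add: corner line_l1_def vec_eq_iff forall_3)
qed

lemma m1_eq: "q (n1 + 2) = line_m1 x0" "\<bar>x0 2\<bar> < 1"
    "circ (line_l0 x0) (line_l1 x0) axis_line $ 3 \<noteq> 0"
proof -
  obtain c r where t: "tangent_lines c r (p (m1 + 1)) (p (m1 + 2)) (q (n1 + 1)) (q (n1 + 2))"
    using tangent[of "m1 + 1" "n1 + 1"] size columns by (auto simp: adds)
  have tri: "triple3 (p (m1 + 1)) (p (m1 + 2)) (q (n1 + 1)) \<noteq> 0"
    using triple_nonzero[of "m1 + 1" "n1 + 1"] size columns by (simp add: adds)
  note c = circ_tangent_lines[OF t tri, unfolded corner l0_eq l1_eq]
  show "circ (line_l0 x0) (line_l1 x0) axis_line $ 3 \<noteq> 0" by (rule c(1))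
  \<comment> \<open>The cosine leaves two directions for m_1. The crossing sign of l_1 with m_0 is
    carried over to m_1 and selects the one given by \<open>turn\<close>.\<close>
  have "0 < cross3 (q (n1 + 1)) (p (m1 + 2)) $ 3 * cross3 (q (n1 + 2)) (p (m1 + 2)) $ 3"
    using T.cross_step[of "n1 + 1" "m1 + 2"] size columns by (simp add: adds)
  moreover have "cross3 (q (n1 + 1)) (p (m1 + 2)) $ 3 = - p (m1 + 2) $ 1"
    "cross3 (q (n1 + 2)) (p (m1 + 2)) $ 3 = - cross3 (p (m1 + 2)) (q (n1 + 2)) $ 3"
    by (simp_all add: corner cross3_third)
  ultimately have "0 < cross3 (p (m1 + 2)) (q (n1 + 2)) $ 3"
    using l1_eq(3) by (simp add: zero_less_mult_iff)
  then have n: "normal (q (n1 + 2)) = turn (p (m1 + 2)) (x0 2)" "\<bar>x0 2\<bar> < 1"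
    using turn_unique[of "p (m1 + 2)" "q (n1 + 2)" "x0 2"] x0_ldot(3) unit_p unit_q size columns by auto
  show "\<bar>x0 2\<bar> < 1" by (rule n)
  show "q (n1 + 2) = line_m1 x0"
    using tangent_line_eq[OF c(1,2)] by (simp add: n l1_eq line_m1_def)
qed

lemma l2_eq: "p (m1 + 3) = line_l2 x0" "\<bar>x0 3\<bar> < 1"
    "circ axis_line (line_m1 x0) (line_l1 x0) $ 3 \<noteq> 0"
proof -
  obtain c r where t: "tangent_lines c r (q (n1 + 1)) (q (n1 + 2)) (p (m1 + 2)) (p (m1 + 3))"
    using T.tangent[of "n1 + 1" "m1 + 2"] size columns by (auto simp: adds)
  have tri: "triple3 (q (n1 + 1)) (q (n1 + 2)) (p (m1 + 2)) \<noteq> 0"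
    using T.triple_nonzero[of "n1 + 1" "m1 + 2"] size columns by (simp add: adds)
  note c = circ_tangent_lines[OF t tri, unfolded corner l1_eq m1_eq]
  show "circ axis_line (line_m1 x0) (line_l1 x0) $ 3 \<noteq> 0" by (rule c(1))
  have "0 < cross3 (p (m1 + 2)) (q (n1 + 1)) $ 3 * cross3 (p (m1 + 3)) (q (n1 + 1)) $ 3"
    using cross_step[of "m1 + 2" "n1 + 1"] size columns by (simp add: adds)
  then have "0 < p (m1 + 3) $ 1"
    using l1_eq(3) by (simp add: corner cross3_third zero_less_mult_iff)
  moreover have "ldot (p (m1 + 3)) (p (m1 + 3)) = 1" using unit_p size columns by simp
  ultimately have n: "p (m1 + 3) $ 1 = sqrt (1 - (x0 3)\<^sup>2)" "p (m1 + 3) $ 2 = - x0 3" "\<bar>x0 3\<bar> < 1"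
    using unit_with_second[of "p (m1 + 3)" "x0 3"] x0_ldot(4) by (simp_all add: corner)
  show "\<bar>x0 3\<bar> < 1" by (rule n)
  have "normal (p (m1 + 3)) = vector [sqrt (1 - (x0 3)\<^sup>2), - x0 3]"
    by (simp add: n vec_eq_iff forall_2)
  then show "p (m1 + 3) = line_l2 x0"
    using tangent_line_eq[OF c(1,2)] by (simp add: line_l2_def)
qed

lemma q_eq_m_seq: "n1 + 1 + int n < n2 \<Longrightarrow> q (n1 + 1 + int n) = m_seq x0 n"
proof (induction n rule: less_induct)
  case (less n)
  consider "n = 0" | "n = 1" | k where "n = Suc (Suc k)"
    by (metis One_nat_def not0_implies_Suc)
  then show ?case
  proof cases
    case 3
    have "q (n1 + 1 + int (Suc k) + 1) = next_line (p (m1 + 1)) (p (m1 + 1 + 1)) (p (m1 + 1 + 2)) (q (n1 + 1 + int (Suc k)))"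
      using row_step(1)[of "m1 + 1" "n1 + 1 + int (Suc k)"] less.prems 3 columns by simp
    moreover have "q (n1 + 1 + int (Suc k)) = m_seq x0 (Suc k)"
      using less.IH[of "Suc k"] less.prems 3 by simp
    moreover have "n1 + 1 + int (Suc k) + 1 = n1 + 1 + int n" using 3 by simp
    ultimately show ?thesis using 3 by (simp only: adds l0_eq l1_eq l2_eq m_seq.simps)
  qed (use corner m1_eq in \<open>simp_all add: add.assoc\<close>)
qed

lemma p_eq_l_seq: "m1 + 1 + int n < m2 \<Longrightarrow> p (m1 + 1 + int n) = l_seq x0 n"
proof (induction n rule: less_induct)
  case (less n)
  consider "n = 0" | "n = 1" | "n = 2" | k where "n = Suc (Suc (Suc k))"
    by (metis One_nat_def not0_implies_Suc numeral_2_eq_2)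
  then show ?case
  proof cases
    case 4
    \<comment> \<open>A line beyond l_2 rules out m2 - m1 = 4, so three lines of the other family
      are available for \<open>next_line\<close>.\<close>
    have n: "n1 + 3 < n2" using rows less.prems 4 by auto
    have "p (m1 + 1 + int (Suc (Suc k)) + 1) = next_line (q (n1 + 1)) (q (n1 + 1 + 1)) (q (n1 + 1 + 2)) (p (m1 + 1 + int (Suc (Suc k))))"
      using T.row_step(1)[of "n1 + 1" "m1 + 1 + int (Suc (Suc k))"] less.prems 4 n by simp
    moreover have "p (m1 + 1 + int (Suc (Suc k))) = l_seq x0 (Suc (Suc k))"
      using less.IH[of "Suc (Suc k)"] less.prems 4 by simp
    moreover have "m1 + 1 + int (Suc (Suc k)) + 1 = m1 + 1 + int n" using 4 by simp
    moreover have "q (n1 + 1) = m_seq x0 0" "q (n1 + 1 + 1) = m_seq x0 1" "q (n1 + 1 + 2) = m_seq x0 2"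
      using q_eq_m_seq[of 0] q_eq_m_seq[of 1] q_eq_m_seq[of 2] n by simp_all
    ultimately show ?thesis using 4 by (simp only: l_seq.simps)
  qed (use l0_eq l1_eq l2_eq in \<open>simp_all add: add.assoc numeral_2_eq_2\<close>)
qed

lemma f_eq_meet_point:
  assumes "m1 + 1 + int n < m2" "n1 + 1 + int k < n2"
  shows "cross3 (l_seq x0 n) (m_seq x0 k) $ 3 \<noteq> 0"
    "f (m1 + 1 + int n, n1 + 1 + int k) = meet_point (l_seq x0 n) (m_seq x0 k)"
proof -
  show "cross3 (l_seq x0 n) (m_seq x0 k) $ 3 \<noteq> 0"
    using cross_nonzero[of "m1 + 1 + int n" "n1 + 1 + int k"] assms
    by (simp add: p_eq_l_seq[symmetric] q_eq_m_seq[symmetric])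
  then show "f (m1 + 1 + int n, n1 + 1 + int k) = meet_point (l_seq x0 n) (m_seq x0 k)"
    using frameD(3,4)[of "m1 + 1 + int n" "n1 + 1 + int k"] assms
    by (intro meet_point_unique) (simp_all add: p_eq_l_seq[symmetric] q_eq_m_seq[symmetric])
qed

lemma m_seq_denominator:
  assumes "n1 + 1 + int (Suc (Suc n)) < n2"
  shows "ldot (step_axis (line_l0 x0) (line_l1 x0) (line_l2 x0) (m_seq x0 (Suc n)))
     (step_axis (line_l0 x0) (line_l1 x0) (line_l2 x0) (m_seq x0 (Suc n))) \<noteq> 0"
proof -
  have "q (n1 + 1 + int (Suc n)) = m_seq x0 (Suc n)" using q_eq_m_seq[of "Suc n"] assms by simp
  then show ?thesis
    using row_step(2)[of "m1 + 1" "n1 + 1 + int (Suc n)"] assms columns by (simp add: adds l0_eq l1_eq l2_eq)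
qed

lemma l_seq_denominator:
  assumes "m1 + 1 + int (Suc (Suc (Suc n))) < m2"
  shows "ldot (step_axis (m_seq x0 0) (m_seq x0 1) (m_seq x0 2) (l_seq x0 (Suc (Suc n))))
     (step_axis (m_seq x0 0) (m_seq x0 1) (m_seq x0 2) (l_seq x0 (Suc (Suc n)))) \<noteq> 0"
proof -
  have n: "n1 + 3 < n2" using rows assms by auto
  have "p (m1 + 1 + int (Suc (Suc n))) = l_seq x0 (Suc (Suc n))" using p_eq_l_seq[of "Suc (Suc n)"] assms by simp
  moreover have "q (n1 + 1) = m_seq x0 0" "q (n1 + 1 + 1) = m_seq x0 1" "q (n1 + 1 + 2) = m_seq x0 2"
    using q_eq_m_seq[of 0] q_eq_m_seq[of 1] q_eq_m_seq[of 2] n by simp_all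
  moreover have "m1 < m1 + 1 + int (Suc (Suc n))" "m1 + 1 + int (Suc (Suc n)) + 1 < m2" "n1 + 1 + 2 < n2"
    using assms n by simp_all
  ultimately show ?thesis
    using T.row_step(2)[of "n1 + 1" "m1 + 1 + int (Suc (Suc n))"] by simp
qed

text \<open>Limits are taken at the single point \<open>x0\<close>: it comes from a net, so the
  denominators in the later lines are known to be non-zero there.\<close>

lemma tendsto_l0: "(line_l0 \<longlongrightarrow> line_l0 x0) (nhds x0)"
  unfolding line_l0_def by (intro tendsto_vector_3 tendsto_intros tendsto_coordinate)

lemma tendsto_l1: "(line_l1 \<longlongrightarrow> line_l1 x0) (nhds x0)"
  unfolding line_l1_def by (intro tendsto_vector_3 tendsto_intros tendsto_coordinate)

lemma tendsto_m1: "(line_m1 \<longlongrightarrow> line_m1 x0) (nhds x0)"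
  unfolding line_m1_def
  by (intro tendsto_tangent_line tendsto_turn tendsto_l0 tendsto_l1 tendsto_coordinate tendsto_const m1_eq)

lemma tendsto_l2: "(line_l2 \<longlongrightarrow> line_l2 x0) (nhds x0)"
  unfolding line_l2_def
  by (intro tendsto_tangent_line tendsto_vector_2 tendsto_m1 tendsto_l1 tendsto_const l2_eq tendsto_intros tendsto_coordinate)

lemma tendsto_m_seq: "n1 + 1 + int n < n2 \<Longrightarrow> ((\<lambda>x. m_seq x n) \<longlongrightarrow> m_seq x0 n) (nhds x0)"
proof (induction n rule: less_induct)
  case (less n)
  consider "n = 0" | "n = 1" | k where "n = Suc (Suc k)"
    by (metis One_nat_def not0_implies_Suc)
  then show ?case
  proof cases
    case 3
    have "((\<lambda>x. m_seq x (Suc k)) \<longlongrightarrow> m_seq x0 (Suc k)) (nhds x0)"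
      using less.IH[of "Suc k"] less.prems 3 by simp
    then show ?thesis
      unfolding 3 m_seq.simps using less.prems[unfolded 3]
      by (intro tendsto_next_line tendsto_l0 tendsto_l1 tendsto_l2 m_seq_denominator)
  qed (use tendsto_m1 in simp_all)
qed

lemma tendsto_l_seq: "m1 + 1 + int n < m2 \<Longrightarrow> ((\<lambda>x. l_seq x n) \<longlongrightarrow> l_seq x0 n) (nhds x0)"
proof (induction n rule: less_induct)
  case (less n)
  consider "n = 0" | "n = 1" | "n = 2" | k where "n = Suc (Suc (Suc k))"
    by (metis One_nat_def not0_implies_Suc numeral_2_eq_2)
  then show ?case
  proof cases
    case 4
    have n: "n1 + 3 < n2" using rows less.prems 4 by auto
    have "((\<lambda>x. l_seq x (Suc (Suc k))) \<longlongrightarrow> l_seq x0 (Suc (Suc k))) (nhds x0)"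
      using less.IH[of "Suc (Suc k)"] less.prems 4 by simp
    moreover have "((\<lambda>x. m_seq x l) \<longlongrightarrow> m_seq x0 l) (nhds x0)" if "l \<le> 2" for l
      using tendsto_m_seq[of l] that n by simp
    ultimately show ?thesis
      unfolding 4 l_seq.simps using less.prems[unfolded 4] tendsto_m1
      by (intro tendsto_next_line l_seq_denominator) simp_all
  qed (use tendsto_l0 tendsto_l1 tendsto_l2 in \<open>simp_all add: numeral_2_eq_2\<close>)
qed

lemma tendsto_net_point:
  assumes "m1 + 1 + int n < m2" "n1 + 1 + int k < n2"
  shows "((\<lambda>x. meet_point (l_seq x n) (m_seq x k)) \<longlongrightarrow> meet_point (l_seq x0 n) (m_seq x0 k)) (nhds x0)"
  using assms by (intro tendsto_meet_point tendsto_l_seq tendsto_m_seq f_eq_meet_point)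

end

text \<open>All conditions are open and hold at the coordinates of a net; together they suffice for a net.\<close>

definition good_parameter :: "nat \<Rightarrow> nat \<Rightarrow> (nat \<Rightarrow> real) \<Rightarrow> bool" where
  "good_parameter M N x \<longleftrightarrow>
     (\<forall>k<4. \<bar>x k\<bar> < 1) \<and>
     circ (line_l0 x) (line_l1 x) axis_line $ 3 \<noteq> 0 \<and>
     circ axis_line (line_m1 x) (line_l1 x) $ 3 \<noteq> 0 \<and>
     (\<forall>n<N - 2. ldot (step_axis (line_l0 x) (line_l1 x) (line_l2 x) (m_seq x (Suc n)))
        (step_axis (line_l0 x) (line_l1 x) (line_l2 x) (m_seq x (Suc n))) \<noteq> 0) \<and>
     (\<forall>n<M - 3. ldot (step_axis (m_seq x 0) (m_seq x 1) (m_seq x 2) (l_seq x (Suc (Suc n))))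
        (step_axis (m_seq x 0) (m_seq x 1) (m_seq x 2) (l_seq x (Suc (Suc n)))) \<noteq> 0) \<and>
     (\<forall>n<M. \<forall>k<N. cross3 (l_seq x n) (m_seq x k) $ 3 \<noteq> 0) \<and>
     (\<forall>n<M - 1. \<forall>k<N. 0 < l_seq x n \<bullet> hat (meet_point (l_seq x (Suc n)) (m_seq x k)) \<and>
        l_seq x (Suc n) \<bullet> hat (meet_point (l_seq x n) (m_seq x k)) < 0) \<and>
     (\<forall>n<M. \<forall>k<N - 1. 0 < m_seq x k \<bullet> hat (meet_point (l_seq x n) (m_seq x (Suc k))) \<and>
        m_seq x (Suc k) \<bullet> hat (meet_point (l_seq x n) (m_seq x k)) < 0) \<and>
     (\<forall>n<M - 1. \<forall>k<N - 1. triple3 (l_seq x n) (l_seq x (Suc n)) (m_seq x k) *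
        circ (l_seq x n) (l_seq x (Suc n)) (m_seq x k) $ 3 < 0)"

lemma eventually_all_less_nat:
  fixes n :: nat
  assumes "\<And>k. k < n \<Longrightarrow> eventually (P k) F"
  shows "eventually (\<lambda>x. \<forall>k<n. P k x) F"
  using eventually_ball_finite[of "{..<n}" "\<lambda>x k. P k x" F] assms by (simp add: Ball_def)

lemma (in normalized_net) eventually_good_parameter:
  "eventually (good_parameter (nat (m2 - m1 - 1)) (nat (n2 - n1 - 1))) (nhds x0)"
proof -
  let ?M = "nat (m2 - m1 - 1)" and ?N = "nat (n2 - n1 - 1)"
  interpret T: circular_net n1 n2 m1 m2 "transpose_net f" q p
    by (rule transposed_circular)
  have M: "m1 + 1 + int n < m2" if "n < ?M" for n using that by linarith
  have N: "n1 + 1 + int n < n2" if "n < ?N" for n using that by linarith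
  have S: "m1 + 1 + int (Suc n) = m1 + 1 + int n + 1" "n1 + 1 + int (Suc n) = n1 + 1 + int n + 1" for n
    by simp_all
  note tl = tendsto_l_seq[OF M] and tm = tendsto_m_seq[OF N] and tp = tendsto_net_point[OF M N]
  have "\<forall>\<^sub>F x in nhds x0. \<forall>k<4. \<bar>x k\<bar> < 1"
  proof (rule eventually_all_less_nat)
    fix k :: nat assume "k < 4"
    then have "k = 0 \<or> k = 1 \<or> k = 2 \<or> k = 3" by linarith
    then have "\<bar>x0 k\<bar> < 1" using l0_eq l1_eq l2_eq m1_eq by auto
    moreover have "((\<lambda>x. \<bar>x k\<bar>) \<longlongrightarrow> \<bar>x0 k\<bar>) (nhds x0)"
      by (intro tendsto_intros tendsto_coordinate)
    ultimately show "\<forall>\<^sub>F x in nhds x0. \<bar>x k\<bar> < 1" by (rule order_tendstoD(2)[rotated])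
  qed
  moreover have "\<forall>\<^sub>F x in nhds x0. circ (line_l0 x) (line_l1 x) axis_line $ 3 \<noteq> 0"
    by (intro tendsto_imp_eventually_ne[OF _ m1_eq(3)] tendsto_vec_nth tendsto_circ tendsto_l0 tendsto_l1 tendsto_const)
  moreover have "\<forall>\<^sub>F x in nhds x0. circ axis_line (line_m1 x) (line_l1 x) $ 3 \<noteq> 0"
    by (intro tendsto_imp_eventually_ne[OF _ l2_eq(3)] tendsto_vec_nth tendsto_circ tendsto_m1 tendsto_l1 tendsto_const)
  moreover have "\<forall>\<^sub>F x in nhds x0. \<forall>n<?N - 2. ldot (step_axis (line_l0 x) (line_l1 x) (line_l2 x) (m_seq x (Suc n)))
        (step_axis (line_l0 x) (line_l1 x) (line_l2 x) (m_seq x (Suc n))) \<noteq> 0"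
  proof (rule eventually_all_less_nat, goal_cases)
    case (1 n)
    then have n: "n1 + 1 + int (Suc (Suc n)) < n2" "n1 + 1 + int (Suc n) < n2" by linarith+
    show ?case
      using n(2) by (intro tendsto_imp_eventually_ne[OF _ m_seq_denominator[OF n(1)]]
        tendsto_ldot tendsto_step_axis tendsto_l0 tendsto_l1 tendsto_l2 tendsto_m_seq)
  qed
  moreover have "\<forall>\<^sub>F x in nhds x0. \<forall>n<?M - 3. ldot (step_axis (m_seq x 0) (m_seq x 1) (m_seq x 2) (l_seq x (Suc (Suc n))))
        (step_axis (m_seq x 0) (m_seq x 1) (m_seq x 2) (l_seq x (Suc (Suc n)))) \<noteq> 0"
  proof (rule eventually_all_less_nat, goal_cases)
    case (1 n)
    then have n: "m1 + 1 + int (Suc (Suc (Suc n))) < m2" "m1 + 1 + int (Suc (Suc n)) < m2" by linarith+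
    then have r: "n1 + 1 + int 0 < n2" "n1 + 1 + int 1 < n2" "n1 + 1 + int 2 < n2" using rows by auto
    show ?case
      using n(2) r by (intro tendsto_imp_eventually_ne[OF _ l_seq_denominator[OF n(1)]]
        tendsto_ldot tendsto_step_axis tendsto_l_seq tendsto_m_seq)
  qed
  moreover have "\<forall>\<^sub>F x in nhds x0. \<forall>n<?M. \<forall>k<?N. cross3 (l_seq x n) (m_seq x k) $ 3 \<noteq> 0"
  proof (intro eventually_all_less_nat, goal_cases)
    case (1 n k)
    then show ?case
      by (intro tendsto_imp_eventually_ne[OF _ f_eq_meet_point(1)[OF M[of n] N[of k]]]
        tendsto_vec_nth tendsto_cross3 tl tm)
  qed
  moreover have "\<forall>\<^sub>F x in nhds x0. \<forall>n<?M - 1. \<forall>k<?N. 0 < l_seq x n \<bullet> hat (meet_point (l_seq x (Suc n)) (m_seq x k)) \<and>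
        l_seq x (Suc n) \<bullet> hat (meet_point (l_seq x n) (m_seq x k)) < 0"
  proof (intro eventually_all_less_nat eventually_conj)
    fix n k assume h: "n < ?M - 1" "k < ?N"
    then have M': "m1 + 1 + int n < m2" "m1 + 1 + int (Suc n) < m2" and N': "n1 + 1 + int k < n2"
      using M[of n] M[of "Suc n"] N[of k] by simp_all
    have "0 < l_seq x0 n \<bullet> hat (meet_point (l_seq x0 (Suc n)) (m_seq x0 k))"
         "l_seq x0 (Suc n) \<bullet> hat (meet_point (l_seq x0 n) (m_seq x0 k)) < 0"
      using frameD(5,6)[of "m1 + 1 + int n" "n1 + 1 + int k"] M' N'
        f_eq_meet_point(2)[OF M'(1) N'] f_eq_meet_point(2)[OF M'(2) N'] p_eq_l_seq[OF M'(1)] p_eq_l_seq[OF M'(2)]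
      by (simp_all only: S) simp_all
    then show "\<forall>\<^sub>F x in nhds x0. 0 < l_seq x n \<bullet> hat (meet_point (l_seq x (Suc n)) (m_seq x k))"
      "\<forall>\<^sub>F x in nhds x0. l_seq x (Suc n) \<bullet> hat (meet_point (l_seq x n) (m_seq x k)) < 0"
      using M' N' by - (erule order_tendstoD[rotated],
        intro tendsto_inner tendsto_hat tendsto_net_point tendsto_l_seq; assumption)+
  qed
  moreover have "\<forall>\<^sub>F x in nhds x0. \<forall>n<?M. \<forall>k<?N - 1. 0 < m_seq x k \<bullet> hat (meet_point (l_seq x n) (m_seq x (Suc k))) \<and>
        m_seq x (Suc k) \<bullet> hat (meet_point (l_seq x n) (m_seq x k)) < 0"
  proof (intro eventually_all_less_nat eventually_conj)
    fix n k assume h: "n < ?M" "k < ?N - 1"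
    then have M': "m1 + 1 + int n < m2" and N': "n1 + 1 + int k < n2" "n1 + 1 + int (Suc k) < n2"
      using M[of n] N[of k] N[of "Suc k"] by simp_all
    have "0 < m_seq x0 k \<bullet> hat (meet_point (l_seq x0 n) (m_seq x0 (Suc k)))"
         "m_seq x0 (Suc k) \<bullet> hat (meet_point (l_seq x0 n) (m_seq x0 k)) < 0"
      using frameD(7,8)[of "m1 + 1 + int n" "n1 + 1 + int k"] M' N'
        f_eq_meet_point(2)[OF M' N'(1)] f_eq_meet_point(2)[OF M' N'(2)] q_eq_m_seq[OF N'(1)] q_eq_m_seq[OF N'(2)]
      by (simp_all only: S) simp_all
    then show "\<forall>\<^sub>F x in nhds x0. 0 < m_seq x k \<bullet> hat (meet_point (l_seq x n) (m_seq x (Suc k)))"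
      "\<forall>\<^sub>F x in nhds x0. m_seq x (Suc k) \<bullet> hat (meet_point (l_seq x n) (m_seq x k)) < 0"
      using M' N' by - (erule order_tendstoD[rotated],
        intro tendsto_inner tendsto_hat tendsto_net_point tendsto_m_seq; assumption)+
  qed
  moreover have "\<forall>\<^sub>F x in nhds x0. \<forall>n<?M - 1. \<forall>k<?N - 1. triple3 (l_seq x n) (l_seq x (Suc n)) (m_seq x k) *
        circ (l_seq x n) (l_seq x (Suc n)) (m_seq x k) $ 3 < 0"
  proof (intro eventually_all_less_nat)
    fix n k assume h: "n < ?M - 1" "k < ?N - 1"
    then have M': "m1 + 1 + int n < m2" "m1 + 1 + int (Suc n) < m2" and N': "n1 + 1 + int k < n2" "n1 + 1 + int (Suc k) < n2"
      using M[of n] M[of "Suc n"] N[of k] N[of "Suc k"] by simp_all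
    obtain c r where "tangent_lines c r (p (m1 + 1 + int n)) (p (m1 + 1 + int (Suc n))) (q (n1 + 1 + int k)) (q (n1 + 1 + int (Suc k)))"
      using tangent[of "m1 + 1 + int n" "n1 + 1 + int k"] M' N' unfolding S by auto
    moreover have "triple3 (p (m1 + 1 + int n)) (p (m1 + 1 + int (Suc n))) (q (n1 + 1 + int k)) \<noteq> 0"
      using triple_nonzero[of "m1 + 1 + int n" "n1 + 1 + int k"] M' N' unfolding S by simp
    ultimately have "triple3 (l_seq x0 n) (l_seq x0 (Suc n)) (m_seq x0 k) *
        circ (l_seq x0 n) (l_seq x0 (Suc n)) (m_seq x0 k) $ 3 < 0"
      using circ_tangent_lines(3) unfolding p_eq_l_seq[OF M'(1)] p_eq_l_seq[OF M'(2)] q_eq_m_seq[OF N'(1)]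
      by blast
    then show "\<forall>\<^sub>F x in nhds x0. triple3 (l_seq x n) (l_seq x (Suc n)) (m_seq x k) *
        circ (l_seq x n) (l_seq x (Suc n)) (m_seq x k) $ 3 < 0"
      using M' N' by - (erule order_tendstoD[rotated],
        intro tendsto_mult tendsto_vec_nth tendsto_triple3 tendsto_circ tendsto_l_seq tendsto_m_seq; assumption)
  qed
  ultimately show ?thesis
    unfolding good_parameter_def by (intro eventually_conj)
qed

section \<open>The inverse of the chart\<close>

definition section_net :: "int \<Rightarrow> int \<Rightarrow> int \<Rightarrow> int \<Rightarrow> (nat \<Rightarrow> real) \<Rightarrow> int \<times> int \<Rightarrow> real^2" where
  "section_net m1 m2 n1 n2 x = restrict
     (\<lambda>(i, j). meet_point (l_seq x (nat (i - m1 - 1))) (m_seq x (nat (j - n1 - 1)))) (rect m1 m2 n1 n2)"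

lemma int_index:
  assumes "(a::int) < i"
  shows "nat (i + 1 - a - 1) = Suc (nat (i - a - 1))"
  using assms by simp

lemma good_parameter_units:
  assumes "good_parameter M N x" "3 \<le> M" "2 \<le> N"
  shows "\<And>k. k < N \<Longrightarrow> ldot (m_seq x k) (m_seq x k) = 1"
    and "\<And>n. n < M \<Longrightarrow> ldot (l_seq x n) (l_seq x n) = 1"
proof -
  have x: "\<bar>x 0\<bar> < 1" "\<bar>x 1\<bar> < 1" "\<bar>x 2\<bar> < 1" "\<bar>x 3\<bar> < 1"
    using assms(1) by (simp_all add: good_parameter_def)
  have sq: "sqrt (1 - c\<^sup>2) * sqrt (1 - c\<^sup>2) + c * c = 1" if "\<bar>c\<bar> < 1" for c :: real
  proof -
    have "c\<^sup>2 < 1" using that by (simp add: abs_square_less_1)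
    then have "sqrt (1 - c\<^sup>2) * sqrt (1 - c\<^sup>2) = 1 - c\<^sup>2" by simp
    then show ?thesis by (simp add: power2_eq_square)
  qed
  have l: "ldot (line_l0 x) (line_l0 x) = 1" "ldot (line_l1 x) (line_l1 x) = 1"
    using sq[OF x(1)] sq[OF x(2)] by (simp_all add: ldot_def line_l0_def line_l1_def)
  have a: "ldot axis_line axis_line = 1" by (simp add: ldot_def)
  have m: "ldot (line_m1 x) (line_m1 x) = 1"
    using ldot_turn(1)[OF l(2) x(3)] by (simp add: ldot_normal line_m1_def)
  have l2: "ldot (line_l2 x) (line_l2 x) = 1"
    using sq[OF x(4)] by (simp add: ldot_normal line_l2_def inner_vec_def sum_2)
  show "ldot (m_seq x k) (m_seq x k) = 1" if "k < N" for k
    using that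
  proof (induction k rule: less_induct)
    case (less k)
    consider "k = 0" | "k = 1" | i where "k = Suc (Suc i)"
      by (metis One_nat_def not0_implies_Suc)
    then show ?case
    proof cases
      case 3
      then have "i < N - 2" using less.prems by simp
      then show ?thesis
        unfolding 3 m_seq.simps using assms(1) less.IH[of "Suc i"] less.prems 3
        by (intro ldot_next_line) (simp_all add: good_parameter_def)
    qed (use a m in simp_all)
  qed
  show "ldot (l_seq x n) (l_seq x n) = 1" if "n < M" for n
    using that
  proof (induction n rule: less_induct)
    case (less n)
    consider "n = 0" | "n = 1" | "n = 2" | i where "n = Suc (Suc (Suc i))"
      by (metis One_nat_def not0_implies_Suc numeral_2_eq_2)
    then show ?case
    proof cases
      case 4
      then have i: "i < M - 3" using less.prems by simp
      have "ldot (l_seq x (Suc (Suc i))) (l_seq x (Suc (Suc i))) = 1"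
        using less.IH[of "Suc (Suc i)"] less.prems 4 by simp
      moreover have "\<forall>n<M - 3. ldot (step_axis (m_seq x 0) (m_seq x 1) (m_seq x 2) (l_seq x (Suc (Suc n))))
        (step_axis (m_seq x 0) (m_seq x 1) (m_seq x 2) (l_seq x (Suc (Suc n)))) \<noteq> 0"
        using assms(1) unfolding good_parameter_def by blast
      ultimately show ?thesis
        unfolding 4 l_seq.simps using i by (intro ldot_next_line) blast+
    qed (use l l2 in \<open>simp_all add: numeral_2_eq_2\<close>)
  qed
qed

section \<open>All squares of the constructed net are circumscribed\<close>

abbreviation (input) coplanar_at :: "(nat \<Rightarrow> real) \<Rightarrow> nat \<Rightarrow> nat \<Rightarrow> bool" where
  "coplanar_at x n k \<equiv> circ (l_seq x n) (l_seq x (Suc n)) (m_seq x k) \<bullet> (m_seq x k + m_seq x (Suc k)) = 0"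

text \<open>The squares (0,0) and (1,0) close by the choice of m_1 and l_2 as tangents; every later
  line m_k is reflected in the axis of the two circles below it, which closes both columns.\<close>

lemma coplanar_first_columns:
  assumes "circ (line_l0 x) (line_l1 x) axis_line $ 3 \<noteq> 0" "circ axis_line (line_m1 x) (line_l1 x) $ 3 \<noteq> 0"
    and "n \<le> 1"
  shows "coplanar_at x n k"
proof (cases k)
  case 0
  have "circ (line_l0 x) (line_l1 x) axis_line \<bullet> (axis_line + line_m1 x) = 0"
    using circ_tangent_line[OF assms(1)] by (simp add: line_m1_def inner_add_right circ_inner)
  moreover have "circ axis_line (line_m1 x) (line_l1 x) \<bullet> (line_l1 x + line_l2 x) = 0"
    using circ_tangent_line[OF assms(2)] by (simp add: line_l2_def inner_add_right circ_inner)
  then have "circ (line_l1 x) (line_l2 x) axis_line \<bullet> (axis_line + line_m1 x) = 0"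
    by (simp add: circ_swap)
  ultimately show ?thesis using \<open>n \<le> 1\<close> 0 by (cases n) auto
next
  case (Suc k')
  then show ?thesis using \<open>n \<le> 1\<close> circ_next_line by (cases n) auto
qed

lemma coplanar_first_rows:
  assumes "k \<le> 1"
  shows "coplanar_at x (Suc (Suc n)) k"
proof -
  have "circ (m_seq x 0) (m_seq x 1) (l_seq x (Suc (Suc n))) \<bullet> (l_seq x (Suc (Suc n)) + l_seq x (Suc (Suc (Suc n)))) = 0"
    "circ (m_seq x 1) (m_seq x 2) (l_seq x (Suc (Suc n))) \<bullet> (l_seq x (Suc (Suc n)) + l_seq x (Suc (Suc (Suc n)))) = 0"
    using circ_next_line[of "m_seq x 0" "m_seq x 1" "l_seq x (Suc (Suc n))" "m_seq x 2"]
      circ_next_line[of "m_seq x 1" "m_seq x 2" "l_seq x (Suc (Suc n))" "m_seq x 0"]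
    by (simp_all only: l_seq.simps)
  then have "coplanar_at x (Suc (Suc n)) 0" "coplanar_at x (Suc (Suc n)) 1"
    by (simp_all add: circ_swap numeral_2_eq_2)
  then show ?thesis using assms by (cases k) auto
qed

text \<open>Squares with \<open>n\<close> or \<open>k\<close> at most 1 close by construction. Any
  other one is the last of a 3 by 3 block of squares, and the other eight have smaller n + k; the
  incidence theorem supplies it. The sign conditions of the framed net exclude the degenerate
  positions.\<close>

lemma coplanar_everywhere:
  assumes net: "framed_net m1 m2 n1 n2 f (\<lambda>i. l_seq x (nat (i - m1 - 1))) (\<lambda>j. m_seq x (nat (j - n1 - 1)))"
    and c: "circ (line_l0 x) (line_l1 x) axis_line $ 3 \<noteq> 0" "circ axis_line (line_m1 x) (line_l1 x) $ 3 \<noteq> 0"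
  shows "m1 + 2 + int n < m2 \<Longrightarrow> n1 + 2 + int k < n2 \<Longrightarrow> coplanar_at x n k"
proof (induction "n + k" arbitrary: n k rule: less_induct)
  case less
  interpret framed_net m1 m2 n1 n2 f "\<lambda>i. l_seq x (nat (i - m1 - 1))" "\<lambda>j. m_seq x (nat (j - n1 - 1))"
    by (rule net)
  interpret T: framed_net n1 n2 m1 m2 "transpose_net f" "\<lambda>j. m_seq x (nat (j - n1 - 1))" "\<lambda>i. l_seq x (nat (i - m1 - 1))"
    by (rule transposed)
  have idx: "nat (a + 1 + int l - a - 1) = l" "nat (a + 1 + int l + 1 - a - 1) = Suc l" for a l by simp_all
  consider "n \<le> 1" | n' where "n = Suc (Suc n')" "k \<le> 1" | n' k' where "n = Suc (Suc n')" "k = Suc (Suc k')"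
    by (metis One_nat_def Suc_le_mono le0 not0_implies_Suc)
  then show ?case
  proof cases
    case 1
    then show ?thesis using coplanar_first_columns[OF c] by blast
  next
    case 2
    then show ?thesis using coplanar_first_rows by blast
  next
    case 3
    let ?p = "\<lambda>i. l_seq x (n' + i)" and ?q = "\<lambda>j. m_seq x (k' + j)"
    have "circ (?p 2) (?p 3) (?q 2) \<bullet> (?q 2 + ?q 3) = 0"
    proof (rule incidence_incircles)
      fix i j :: nat
      show "circ (?p i) (?p (Suc i)) (?q j) \<bullet> (?q j + ?q (Suc j)) = 0" if "i \<le> 2" "j \<le> 2" "(i, j) \<noteq> (2, 2)"
        using less.hyps[of "n' + i" "k' + j"] less.prems that 3 by auto
      show "triple3 (?p i) (?p (Suc i)) (?q j) \<noteq> 0" if "i \<le> 2" "j \<le> 3"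
        using triple_nonzero[of "m1 + 1 + int (n' + i)" "n1 + 1 + int (k' + j)", unfolded idx] that less.prems 3 by simp
      show "triple3 (?q j) (?q (Suc j)) (?p i) \<noteq> 0" if "i \<le> 3" "j \<le> 2"
        using T.triple_nonzero[of "n1 + 1 + int (k' + j)" "m1 + 1 + int (n' + i)", unfolded idx] that less.prems 3 by simp
      show "cross3 (?p i + ?p (Suc i)) (?q j + ?q (Suc j)) \<noteq> 0" if "i \<le> 2" "j \<le> 2"
        using bisectors_not_parallel[of "m1 + 1 + int (n' + i)" "n1 + 1 + int (k' + j)", unfolded idx] that less.prems 3 by simp
    qed
    then show ?thesis by (simp add: 3 numeral_2_eq_2 numeral_3_eq_3)
  qed
qed

lemma circular_net_section_net:
  assumes good: "good_parameter (nat (m2 - m1 - 1)) (nat (n2 - n1 - 1)) x"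
    and size: "m1 + 3 < m2" "n1 + 2 < n2"
  shows "circular_net m1 m2 n1 n2 (section_net m1 m2 n1 n2 x)
    (\<lambda>i. l_seq x (nat (i - m1 - 1))) (\<lambda>j. m_seq x (nat (j - n1 - 1)))"
proof -
  let ?M = "nat (m2 - m1 - 1)" and ?N = "nat (n2 - n1 - 1)"
  let ?p = "\<lambda>i. l_seq x (nat (i - m1 - 1))" and ?q = "\<lambda>j. m_seq x (nat (j - n1 - 1))"
  let ?f = "section_net m1 m2 n1 n2 x"
  note G = good[unfolded good_parameter_def]
  have G6: "\<And>n k. n < ?M \<Longrightarrow> k < ?N \<Longrightarrow> cross3 (l_seq x n) (m_seq x k) $ 3 \<noteq> 0"
    and G7: "\<And>n k. n < ?M - 1 \<Longrightarrow> k < ?N \<Longrightarrow> 0 < l_seq x n \<bullet> hat (meet_point (l_seq x (Suc n)) (m_seq x k)) \<and>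
        l_seq x (Suc n) \<bullet> hat (meet_point (l_seq x n) (m_seq x k)) < 0"
    and G8: "\<And>n k. n < ?M \<Longrightarrow> k < ?N - 1 \<Longrightarrow> 0 < m_seq x k \<bullet> hat (meet_point (l_seq x n) (m_seq x (Suc k))) \<and>
        m_seq x (Suc k) \<bullet> hat (meet_point (l_seq x n) (m_seq x k)) < 0"
    and G9: "\<And>n k. n < ?M - 1 \<Longrightarrow> k < ?N - 1 \<Longrightarrow> triple3 (l_seq x n) (l_seq x (Suc n)) (m_seq x k) *
        circ (l_seq x n) (l_seq x (Suc n)) (m_seq x k) $ 3 < 0"
    using G by blast+
  have units: "\<And>k. k < ?N \<Longrightarrow> ldot (m_seq x k) (m_seq x k) = 1"
    "\<And>n. n < ?M \<Longrightarrow> ldot (l_seq x n) (l_seq x n) = 1"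
    using good_parameter_units[OF good] size by auto
  have f: "?f (i, j) = meet_point (?p i) (?q j)" if "m1 < i" "i < m2" "n1 < j" "j < n2" for i j
    using that by (simp add: section_net_def)
  have "line_frame (rect m1 m2 n1 n2) ?f ?p ?q"
    unfolding line_frame_def mem_rect
  proof (intro conjI allI impI)
    fix i j assume h: "m1 < i \<and> i < m2 \<and> n1 < j \<and> j < n2"
    then have r: "nat (i - m1 - 1) < ?M" "nat (j - n1 - 1) < ?N" by auto
    then show "ldot (?p i) (?p i) = 1" "ldot (?q j) (?q j) = 1" using units by auto
    show "?p i \<bullet> hat (?f (i, j)) = 0" "?q j \<bullet> hat (?f (i, j)) = 0"
      using meet_point_on_lines[OF G6[OF r]] h f by auto
  next
    fix i j assume h: "m1 < i \<and> i < m2 \<and> n1 < j \<and> j < n2" "m1 < i + 1 \<and> i + 1 < m2 \<and> n1 < j \<and> j < n2"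
    then have r: "nat (i - m1 - 1) < ?M - 1" "nat (j - n1 - 1) < ?N" by auto
    have i: "nat (i + 1 - m1 - 1) = Suc (nat (i - m1 - 1))" using h by (simp add: int_index)
    have f1: "?f (i, j) = meet_point (?p i) (?q j)" using f h by blast
    have f2: "?f (i + 1, j) = meet_point (l_seq x (Suc (nat (i - m1 - 1)))) (?q j)"
      using f[of "i + 1" j] h unfolding i by blast
    show "0 < ?p i \<bullet> hat (?f (i + 1, j))" "?p (i + 1) \<bullet> hat (?f (i, j)) < 0"
      using G7[OF r] unfolding f1 f2 i by blast+
  next
    fix i j assume h: "m1 < i \<and> i < m2 \<and> n1 < j \<and> j < n2" "m1 < i \<and> i < m2 \<and> n1 < j + 1 \<and> j + 1 < n2"
    then have r: "nat (i - m1 - 1) < ?M" "nat (j - n1 - 1) < ?N - 1" by auto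
    have j: "nat (j + 1 - n1 - 1) = Suc (nat (j - n1 - 1))" using h by (simp add: int_index)
    have f1: "?f (i, j) = meet_point (?p i) (?q j)" using f h by blast
    have f2: "?f (i, j + 1) = meet_point (?p i) (m_seq x (Suc (nat (j - n1 - 1))))"
      using f[of i "j + 1"] h unfolding j by blast
    show "0 < ?q j \<bullet> hat (?f (i, j + 1))" "?q (j + 1) \<bullet> hat (?f (i, j)) < 0"
      using G8[OF r] unfolding f1 f2 j by blast+
  qed
  then have net: "framed_net m1 m2 n1 n2 ?f ?p ?q"
    using size by unfold_locales auto
  have "circle_frame (rect m1 m2 n1 n2) ?p ?q"
    unfolding circle_frame_def mem_rect
  proof (intro allI impI)
    fix i j assume h: "m1 < i \<and> i < m2 \<and> n1 < j \<and> j < n2" "m1 < i + 1 \<and> i + 1 < m2 \<and> n1 < j + 1 \<and> j + 1 < n2"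
    then have r: "nat (i - m1 - 1) < ?M - 1" "nat (j - n1 - 1) < ?N - 1"
      and r': "m1 + 2 + int (nat (i - m1 - 1)) < m2" "n1 + 2 + int (nat (j - n1 - 1)) < n2" by auto
    have "coplanar_at x (nat (i - m1 - 1)) (nat (j - n1 - 1))"
      using coplanar_everywhere[OF net _ _ r'] G by blast
    then have "\<exists>c r. tangent_lines c r (l_seq x (nat (i - m1 - 1))) (l_seq x (Suc (nat (i - m1 - 1))))
        (m_seq x (nat (j - n1 - 1))) (m_seq x (Suc (nat (j - n1 - 1))))"
      using tangent_lines_if_circ G9[OF r] by blast
    moreover have "nat (i + 1 - m1 - 1) = Suc (nat (i - m1 - 1))" "nat (j + 1 - n1 - 1) = Suc (nat (j - n1 - 1))"
      using h int_index by blast+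
    ultimately show "\<exists>c r. tangent_lines c r (?p i) (?p (i + 1)) (?q j) (?q (j + 1))" by simp
  qed
  with net show ?thesis by (simp add: circular_net_def circular_net_axioms_def)
qed

lemma chart_section_net:
  assumes good: "good_parameter (nat (m2 - m1 - 1)) (nat (n2 - n1 - 1)) x"
    and sz: "m1 + 3 < m2" "n1 + 2 < n2" and x: "\<And>k. 4 \<le> k \<Longrightarrow> x k = 0"
  shows "chart (m1 + 1) (n1 + 1) (section_net m1 m2 n1 n2 x) = x"
proof
  fix k :: nat
  interpret circular_net m1 m2 n1 n2 "section_net m1 m2 n1 n2 x"
    "\<lambda>i. l_seq x (nat (i - m1 - 1))" "\<lambda>j. m_seq x (nat (j - n1 - 1))"
    by (rule circular_net_section_net[OF good sz])
  have x2: "\<bar>x 2\<bar> < 1" using good by (simp add: good_parameter_def)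
  have "ldot (line_l1 x) (line_l1 x) = 1"
    using good_parameter_units(2)[OF good, of 1] sz by simp
  then have turn: "ldot (line_l1 x) (line_m1 x) = - x 2"
    using ldot_turn(2)[OF _ x2] by (simp add: line_m1_def ldot_normal)
  have idx: "nat (m1 + 1 - m1 - 1) = 0" "nat (m1 + 2 - m1 - 1) = 1" "nat (m1 + 3 - m1 - 1) = 2"
    "nat (n1 + 1 - n1 - 1) = 0" "nat (n1 + 2 - n1 - 1) = 1"
    by simp_all
  note c = chart_eq_ldot[OF sz(1), unfolded idx]
  consider "k = 0" | "k = 1" | "k = 2" | "k = 3" | "4 \<le> k" by linarith
  then show "chart (m1 + 1) (n1 + 1) (section_net m1 m2 n1 n2 x) k = x k"
  proof cases
    case 1
    then show ?thesis using c(1) by (simp add: ldot_def line_l0_def)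
  next
    case 2
    then show ?thesis using c(2) by (simp add: ldot_def line_l1_def)
  next
    case 3
    then show ?thesis using c(3) turn by simp
  next
    case 4
    then show ?thesis using c(4) by (simp add: ldot_def line_l2_def tangent_line_def numeral_2_eq_2)
  next
    case 5
    then show ?thesis using x by (simp add: chart_eq_0)
  qed
qed

lemma section_net_extensional: "section_net m1 m2 n1 n2 x \<in> extensional (rect m1 m2 n1 n2)"
  by (simp add: section_net_def)

lemma section_net_IC_nets:
  assumes "good_parameter (nat (m2 - m1 - 1)) (nat (n2 - n1 - 1)) x" "m1 + 3 < m2" "n1 + 2 < n2"
  shows "section_net m1 m2 n1 n2 x \<in> IC_nets (rect m1 m2 n1 n2)"
  using circular_net_IC_net[OF circular_net_section_net[OF assms]] section_net_extensional
  by (simp add: IC_nets_def)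

lemma chart_similar:
  assumes "(f, g) \<in> similar_nets (rect m1 m2 n1 n2)" "m1 + 3 < m2" "n1 + 2 < n2"
  shows "chart (m1 + 1) (n1 + 1) f = chart (m1 + 1) (n1 + 1) g"
proof
  fix n :: nat
  obtain k T b where IC: "IC_net (rect m1 m2 n1 n2) f" and T: "0 < k" "orthogonal_transformation T"
    and g: "\<And>z. z \<in> rect m1 m2 n1 n2 \<Longrightarrow> g z = k *\<^sub>R T (f z) + b"
    using assms(1) by (auto simp: similar_nets_def IC_nets_def)
  obtain p q where A: "circular_net m1 m2 n1 n2 f p q"
    using IC_net_circular_net[OF IC] assms by auto
  have B: "circular_net m1 m2 n1 n2 g (move_line k T b \<circ> p) (move_line k T b \<circ> q)"
    by (rule circular_net_move[OF A T(2,1)]) (rule g)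
  interpret A: circular_net m1 m2 n1 n2 f p q by (rule A)
  interpret B: circular_net m1 m2 n1 n2 g "move_line k T b \<circ> p" "move_line k T b \<circ> q" by (rule B)
  consider "n = 0" | "n = 1" | "n = 2" | "n = 3" | "4 \<le> n" by linarith
  then show "chart (m1 + 1) (n1 + 1) f n = chart (m1 + 1) (n1 + 1) g n"
    using A.chart_eq_ldot[OF assms(2)] B.chart_eq_ldot[OF assms(2)]
    by cases (simp_all add: ldot_move_line[OF T(2)] chart_eq_0)
qed

text \<open>A similarity moves \<open>f\<close> into normal position without changing its
  coordinates. There every line, hence every point, is the explicit function of \<open>x0\<close>,
  so the moved net is the section net itself.\<close>

lemma chart_inverse:
  assumes f: "f \<in> IC_nets (rect m1 m2 n1 n2)" and sz: "m1 + 3 < m2" "n1 + 2 < n2" "4 \<le> n2 - n1 \<or> m2 - m1 = 4"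
    and x0: "x0 = chart (m1 + 1) (n1 + 1) f"
  shows "(f, section_net m1 m2 n1 n2 x0) \<in> similar_nets (rect m1 m2 n1 n2)"
    and "eventually (good_parameter (nat (m2 - m1 - 1)) (nat (n2 - n1 - 1))) (nhds x0)"
    and "z \<in> rect m1 m2 n1 n2 \<Longrightarrow>
      ((\<lambda>x. section_net m1 m2 n1 n2 x z) \<longlongrightarrow> section_net m1 m2 n1 n2 x0 z) (nhds x0)"
proof -
  let ?P = "rect m1 m2 n1 n2"
  obtain p q where A: "circular_net m1 m2 n1 n2 f p q"
    using IC_net_circular_net[of m1 m2 n1 n2 f] f sz by (auto simp: IC_nets_def)
  obtain k T b where T: "0 < k" "orthogonal_transformation T"
    and 0: "k *\<^sub>R T (f (m1 + 1, n1 + 1)) + b = 0" "k *\<^sub>R T (f (m1 + 2, n1 + 1)) + b = vector [1, 0]"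
      "move_line k T b (q (n1 + 1)) = axis_line"
    using circular_net_normalize[OF A, of "n1 + 1"] sz by (auto simp: axis_line_def)
  define g where "g = restrict (\<lambda>z. k *\<^sub>R T (f z) + b) ?P"
  have g: "g z = k *\<^sub>R T (f z) + b" if "z \<in> ?P" for z using that by (simp add: g_def)
  have B: "circular_net m1 m2 n1 n2 g (move_line k T b \<circ> p) (move_line k T b \<circ> q)"
    by (rule circular_net_move[OF A T(2,1)]) (rule g)
  have gIC: "g \<in> IC_nets ?P"
    using circular_net_IC_net[OF B] by (simp add: IC_nets_def g_def)
  have sim: "(f, g) \<in> similar_nets ?P"
    using f gIC T g by (auto simp: similar_nets_def)
  have x0g: "x0 = chart (m1 + 1) (n1 + 1) g"
    using chart_similar[OF sim] sz x0 by simp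
  interpret normalized_net m1 m2 n1 n2 g "move_line k T b \<circ> p" "move_line k T b \<circ> q" x0
    using B sz 0 x0g by (simp add: normalized_net_def normalized_net_axioms_def g)
  have "g z = section_net m1 m2 n1 n2 x0 z" for z
  proof (cases "z \<in> ?P")
    case True
    obtain i j where z: "z = (i, j)" by (cases z)
    have "m1 < i" "i < m2" "n1 < j" "j < n2" using True by (simp_all add: z)
    then show ?thesis
      using f_eq_meet_point(2)[of "nat (i - m1 - 1)" "nat (j - n1 - 1)"] by (simp add: section_net_def z)
  qed (simp add: g_def section_net_def)
  then have "g = section_net m1 m2 n1 n2 x0" by blast
  then show "(f, section_net m1 m2 n1 n2 x0) \<in> similar_nets ?P" using sim by simp
  show "eventually (good_parameter (nat (m2 - m1 - 1)) (nat (n2 - n1 - 1))) (nhds x0)"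
    by (rule eventually_good_parameter)
  show "((\<lambda>x. section_net m1 m2 n1 n2 x z) \<longlongrightarrow> section_net m1 m2 n1 n2 x0 z) (nhds x0)" if "z \<in> ?P"
  proof -
    obtain i j where z: "z = (i, j)" by (cases z)
    have "m1 < i" "i < m2" "n1 < j" "j < n2" using that by (simp_all add: z)
    then show ?thesis
      using tendsto_net_point[of "nat (i - m1 - 1)" "nat (j - n1 - 1)"] by (simp add: section_net_def z)
  qed
qed

lemma square_grid_IC_net:
  assumes "m1 + 2 < m2" "n1 + 2 < n2"
  shows "restrict (\<lambda>(i, j). vector [of_int i, of_int j]) (rect m1 m2 n1 n2) \<in> IC_nets (rect m1 m2 n1 n2)"
proof -
  let ?f = "restrict (\<lambda>(i, j). vector [of_int i, of_int j] :: real^2) (rect m1 m2 n1 n2)"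
  have "circular_net m1 m2 n1 n2 ?f (\<lambda>i. vector [1, 0, of_int i]) (\<lambda>j. vector [0, 1, of_int j])"
  proof
    show "line_frame (rect m1 m2 n1 n2) ?f (\<lambda>i. vector [1, 0, of_int i]) (\<lambda>j. vector [0, 1, of_int j])"
      unfolding line_frame_def by (auto simp: ldot_def inner_3)
    show "circle_frame (rect m1 m2 n1 n2) (\<lambda>i. vector [1, 0, of_int i]) (\<lambda>j. vector [0, 1, of_int j])"
      unfolding circle_frame_def tangent_lines_def
    proof (intro allI impI)
      fix i j :: int
      show "\<exists>c r. 0 < r \<and> vector [1, 0, of_int i] \<bullet> hat c = r \<and> vector [1, 0, of_int (i + 1)] \<bullet> hat c = - r \<and>
        vector [0, 1, of_int j] \<bullet> hat c = r \<and> vector [0, 1, of_int (j + 1)] \<bullet> hat c = - r"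
        by (intro exI[of _ "vector [of_int i + 1/2, of_int j + 1/2]"] exI[of _ "1/2"]) (simp add: inner_3)
    qed
  qed (use assms in auto)
  then show ?thesis using circular_net_IC_net by (simp add: IC_nets_def)
qed

section \<open>The topology of the moduli space\<close>

lemma topspace_quotient_space:
  assumes "equiv (topspace X) R"
  shows "topspace (quotient_space X R) = topspace X // R"
proof
  show "topspace (quotient_space X R) \<subseteq> topspace X // R"
    using openin_quotient_space[OF assms] openin_topspace by blast
  have "openin (quotient_space X R) (topspace X // R)"
    using openin_quotient_space[OF assms] Union_quotient[OF assms] by simp
  then show "topspace X // R \<subseteq> topspace (quotient_space X R)"
    by (rule openin_subset)
qed

text \<open>The map induced by \<phi> on classes is continuous, and \<sigma> followed by the
  projection is its continuous inverse. The section replaces a proof that \<phi> is open onto its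
  image.\<close>

lemma quotient_space_homeomorphic_image:
  assumes R: "equiv (topspace X) R" and \<phi>: "continuous_map X Y \<phi>"
    and \<sigma>: "continuous_map (subtopology Y (\<phi> ` topspace X)) X \<sigma>"
    and \<phi>\<sigma>: "\<And>x. x \<in> \<phi> ` topspace X \<Longrightarrow> \<phi> (\<sigma> x) = x"
    and \<sigma>\<phi>: "\<And>f. f \<in> topspace X \<Longrightarrow> (f, \<sigma> (\<phi> f)) \<in> R"
    and inv: "\<And>f g. (f, g) \<in> R \<Longrightarrow> \<phi> f = \<phi> g"
  shows "quotient_space X R homeomorphic_space subtopology Y (\<phi> ` topspace X)"
proof -
  let ?W = "\<phi> ` topspace X" and ?Q = "quotient_space X R"
  define F where "F C = \<phi> (SOME f. f \<in> C)" for C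
  define G where "G x = R `` {\<sigma> x}" for x
  have W: "topspace (subtopology Y ?W) = ?W"
    using continuous_map_image_subset_topspace[OF \<phi>] by auto
  have \<phi>W: "continuous_map X (subtopology Y ?W) \<phi>"
    using \<phi> by (simp add: continuous_map_in_subtopology)
  have F: "F C = \<phi> f" if "C \<in> topspace X // R" "f \<in> C" for C f
  proof -
    have "(SOME g. g \<in> C) \<in> C" using that(2) by (rule someI)
    then have "(f, SOME g. g \<in> C) \<in> R" using quotient_eq_iff[OF R that(1) that(1)] that(2) by simp
    then show ?thesis using inv by (simp add: F_def)
  qed
  have F_class: "F (R `` {f}) = \<phi> f" if "f \<in> topspace X" for f
    using F[OF quotientI[OF that] equiv_class_self[OF R that]] .
  have \<sigma>X: "\<sigma> x \<in> topspace X" if "x \<in> ?W" for x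
    using that \<sigma> W by (auto simp: continuous_map_def)
  have "continuous_map ?Q (subtopology Y ?W) F"
    unfolding continuous_map_def
  proof (intro conjI allI impI)
    show "F \<in> topspace ?Q \<rightarrow> topspace (subtopology Y ?W)"
      unfolding topspace_quotient_space[OF R] W using F_class by (auto elim!: quotientE)
    fix U assume U: "openin (subtopology Y ?W) U"
    have "\<Union>{C \<in> topspace X // R. F C \<in> U} = {f \<in> topspace X. \<phi> f \<in> U}"
    proof (intro equalityI subsetI)
      fix f assume "f \<in> \<Union>{C \<in> topspace X // R. F C \<in> U}"
      then obtain C where "C \<in> topspace X // R" "F C \<in> U" "f \<in> C" by blast
      then show "f \<in> {f \<in> topspace X. \<phi> f \<in> U}" using F Union_quotient[OF R] by auto
    next
      fix f assume "f \<in> {f \<in> topspace X. \<phi> f \<in> U}"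
      then have "R `` {f} \<in> topspace X // R" "F (R `` {f}) \<in> U" "f \<in> R `` {f}"
        using F_class quotientI equiv_class_self[OF R] by auto
      then show "f \<in> \<Union>{C \<in> topspace X // R. F C \<in> U}" by blast
    qed
    then show "openin ?Q {C \<in> topspace ?Q. F C \<in> U}"
      unfolding topspace_quotient_space[OF R] openin_quotient_space[OF R]
      using openin_continuous_map_preimage[OF \<phi>W U] by auto
  qed
  moreover have "continuous_map (subtopology Y ?W) ?Q G"
    unfolding continuous_map_def
  proof (intro conjI allI impI)
    show "G \<in> topspace (subtopology Y ?W) \<rightarrow> topspace ?Q"
      unfolding topspace_quotient_space[OF R] W G_def using \<sigma>X quotientI by fast
    fix U assume "openin ?Q U"
    then have U: "U \<subseteq> topspace X // R" "openin X (\<Union>U)"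
      using openin_quotient_space[OF R] by auto
    have "G x \<in> U \<longleftrightarrow> \<sigma> x \<in> \<Union>U" if "x \<in> ?W" for x
    proof
      assume "G x \<in> U"
      then show "\<sigma> x \<in> \<Union>U" using equiv_class_self[OF R \<sigma>X[OF that]] by (auto simp: G_def)
    next
      assume "\<sigma> x \<in> \<Union>U"
      then obtain C where C: "C \<in> U" "\<sigma> x \<in> C" by blast
      then have "C = R `` {\<sigma> x}"
        using U(1) Image_singleton_iff quotient_eqI[OF R _ quotientI[OF \<sigma>X[OF that]]]
          equiv_class_self[OF R \<sigma>X[OF that]] equivE[OF R] by (metis refl_onD subsetD \<sigma>X that)
      then show "G x \<in> U" using C by (simp add: G_def)
    qed
    then have "{x \<in> topspace (subtopology Y ?W). G x \<in> U} = {x \<in> topspace (subtopology Y ?W). \<sigma> x \<in> \<Union>U}"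
      unfolding W by blast
    then show "openin (subtopology Y ?W) {x \<in> topspace (subtopology Y ?W). G x \<in> U}"
      using openin_continuous_map_preimage[OF \<sigma> U(2)] by simp
  qed
  moreover have "G (F C) = C" if "C \<in> topspace ?Q" for C
  proof -
    obtain f where f: "f \<in> topspace X" "C = R `` {f}"
      using \<open>C \<in> topspace ?Q\<close> unfolding topspace_quotient_space[OF R] by (auto elim: quotientE)
    then have "F C = \<phi> f" using F_class by simp
    then show ?thesis
      using equiv_class_eq[OF R \<sigma>\<phi>[OF f(1)]] f(2) by (simp only: G_def)
  qed
  moreover have "F (G x) = x" if "x \<in> topspace (subtopology Y ?W)" for x
    using that \<sigma>X \<phi>\<sigma> F_class unfolding W G_def by auto
  ultimately show ?thesis
    unfolding homeomorphic_space_def homeomorphic_maps_def by blast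
qed

lemma second_countable_Euclidean_space: "second_countable (Euclidean_space n)"
proof -
  obtain B :: "(nat \<Rightarrow> real) set set" where B: "countable B" "\<And>C. C \<in> B \<Longrightarrow> open C"
    "\<And>S. open S \<Longrightarrow> \<exists>U. U \<subseteq> B \<and> S = \<Union>U"
    using univ_second_countable by blast
  have "second_countable (euclidean :: (nat \<Rightarrow> real) topology)"
    unfolding second_countable_def
  proof (intro exI[of _ B] conjI allI impI)
    fix U :: "(nat \<Rightarrow> real) set" and x assume "openin euclidean U \<and> x \<in> U"
    then show "\<exists>V\<in>B. x \<in> V \<and> V \<subseteq> U" using B(3)[of U] by auto
  qed (use B in auto)
  then show ?thesis
    unfolding Euclidean_space_def euclidean_product_topology by (rule second_countable_subtopology)
qed

lemma topological_manifold_if_homeomorphic_open: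
  assumes "X homeomorphic_space subtopology (Euclidean_space n) W" "openin (Euclidean_space n) W"
  shows "topological_manifold n X"
  unfolding topological_manifold_def
proof (intro conjI ballI)
  show "Hausdorff_space X"
    using homeomorphic_Hausdorff_space[OF assms(1)] Hausdorff_Euclidean_space Hausdorff_space_subtopology by blast
  show "second_countable X"
    using homeomorphic_space_second_countability[OF assms(1)] second_countable_Euclidean_space
      second_countable_subtopology by blast
  fix x assume "x \<in> topspace X"
  then show "\<exists>U V. openin X U \<and> x \<in> U \<and> openin (Euclidean_space n) V \<and>
      subtopology X U homeomorphic_space subtopology (Euclidean_space n) V"
    using assms by (intro exI[of _ "topspace X"] exI[of _ W]) auto
qed

lemma tendsto_cosine:
  assumes "(f \<longlongrightarrow> a) F" "(g \<longlongrightarrow> b) F" "a \<noteq> 0" "b \<noteq> 0"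
  shows "((\<lambda>x. cosine (f x) (g x)) \<longlongrightarrow> cosine a b) F"
  unfolding cosine_def using assms by (intro tendsto_intros) auto

lemma net_corner_distinct:
  assumes "f \<in> IC_nets (rect m1 m2 n1 n2)" "m1 + 3 < m2" "n1 + 2 < n2"
  shows "m1 < i \<Longrightarrow> i + 1 < m2 \<Longrightarrow> n1 < j \<Longrightarrow> j < n2 \<Longrightarrow> f (i + 1, j) \<noteq> f (i, j)"
    and "m1 < i \<Longrightarrow> i < m2 \<Longrightarrow> n1 < j \<Longrightarrow> j + 1 < n2 \<Longrightarrow> f (i, j + 1) \<noteq> f (i, j)"
proof -
  obtain p q where "circular_net m1 m2 n1 n2 f p q"
    using IC_net_circular_net[of m1 m2 n1 n2 f] assms by (auto simp: IC_nets_def)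
  then interpret circular_net m1 m2 n1 n2 f p q .
  show "f (i + 1, j) \<noteq> f (i, j)" if "m1 < i" "i + 1 < m2" "n1 < j" "j < n2"
    using frameD(3,5)[of i j] that by auto
  show "f (i, j + 1) \<noteq> f (i, j)" if "m1 < i" "i < m2" "n1 < j" "j + 1 < n2"
    using frameD(4,7)[of i j] that by auto
qed

lemma continuous_map_chart:
  assumes sz: "m1 + 3 < m2" "n1 + 2 < n2"
  shows "continuous_map (IC_net_topology (rect m1 m2 n1 n2)) (Euclidean_space 4) (chart (m1 + 1) (n1 + 1))"
proof -
  let ?P = "rect m1 m2 n1 n2" and ?X = "IC_net_topology (rect m1 m2 n1 n2)"
  have ev: "continuous_map ?X euclidean (\<lambda>f. f z)" if "z \<in> ?P" for z
    unfolding IC_net_topology_def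
    by (intro continuous_map_from_subtopology continuous_map_product_projection that)
  have lim: "((\<lambda>f. f z) \<longlongrightarrow> f0 z) (atin ?X f0)" if "z \<in> ?P" "f0 \<in> IC_nets ?P" for z f0
    using ev[OF that(1)] that(2) unfolding continuous_map_atin topspace_IC_net_topology by simp
  have cont: "continuous_map ?X euclideanreal (\<lambda>f. cosine (f a - f b) (f c - f d))"
    if "a \<in> ?P" "b \<in> ?P" "c \<in> ?P" "d \<in> ?P" and "\<And>f. f \<in> IC_nets ?P \<Longrightarrow> f a \<noteq> f b \<and> f c \<noteq> f d" for a b c d
    unfolding continuous_map_atin topspace_IC_net_topology limitin_canonical_iff
    using that by (intro ballI tendsto_cosine tendsto_diff lim) auto
  have eq: "m1 + 1 + 1 = m1 + 2" "m1 + 2 + 1 = m1 + 3" "n1 + 1 + 1 = n1 + 2" "m1 + 1 + 2 = m1 + 3" by simp_all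
  have ne: "f (m1 + 1, n1 + 2) \<noteq> f (m1 + 1, n1 + 1)" "f (m1 + 2, n1 + 1) \<noteq> f (m1 + 1, n1 + 1)"
     "f (m1 + 2, n1 + 2) \<noteq> f (m1 + 2, n1 + 1)" "f (m1 + 2, n1 + 2) \<noteq> f (m1 + 1, n1 + 2)"
     "f (m1 + 3, n1 + 2) \<noteq> f (m1 + 3, n1 + 1)" "f (m1 + 3, n1 + 1) \<noteq> f (m1 + 2, n1 + 1)"
    if "f \<in> IC_nets ?P" for f
    using net_corner_distinct(2)[OF that sz, of "m1 + 1" "n1 + 1"] net_corner_distinct(1)[OF that sz, of "m1 + 1" "n1 + 1"]
      net_corner_distinct(2)[OF that sz, of "m1 + 2" "n1 + 1"] net_corner_distinct(1)[OF that sz, of "m1 + 1" "n1 + 2"]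
      net_corner_distinct(2)[OF that sz, of "m1 + 3" "n1 + 1"] net_corner_distinct(1)[OF that sz, of "m1 + 2" "n1 + 1"] sz
    unfolding eq by auto
  have "continuous_map ?X euclideanreal (\<lambda>f. chart (m1 + 1) (n1 + 1) f k)" if "k < 4" for k
  proof -
    consider "k = 0" | "k = 1" | "k = 2" | "k = 3" using \<open>k < 4\<close> by linarith
    then show ?thesis
      using ne sz by cases (simp_all add: chart_def eq cont)
  qed
  then have "continuous_map ?X (Euclidean_space 4) (\<lambda>f k. if k < 4 then chart (m1 + 1) (n1 + 1) f k else 0)"
    by (simp add: continuous_map_componentwise_Euclidean_space)
  moreover have "(\<lambda>f k. if k < 4 then chart (m1 + 1) (n1 + 1) f k else 0) = chart (m1 + 1) (n1 + 1)"
    by (auto simp: fun_eq_iff chart_eq_0)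
  ultimately show ?thesis by simp
qed

lemma topological_manifold_IC_net_moduli:
  assumes sz: "m1 + 3 < m2" "n1 + 2 < n2" "4 \<le> n2 - n1 \<or> m2 - m1 = 4"
  shows "topological_manifold 4 (IC_net_moduli (rect m1 m2 n1 n2))"
proof -
  let ?P = "rect m1 m2 n1 n2" and ?X = "IC_net_topology (rect m1 m2 n1 n2)"
  let ?\<phi> = "chart (m1 + 1) (n1 + 1)" and ?\<sigma> = "section_net m1 m2 n1 n2" and ?E = "Euclidean_space 4"
  let ?W = "?\<phi> ` topspace ?X"
  let ?good = "good_parameter (nat (m2 - m1 - 1)) (nat (n2 - n1 - 1))"
  have X: "topspace ?X = IC_nets ?P" by (rule topspace_IC_net_topology)
  have equiv: "equiv (topspace ?X) (similar_nets ?P)" unfolding X by (rule equiv_similar_nets)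
  have E: "?E = top_of_set {x. \<forall>k\<ge>4. x k = 0}"
    by (simp add: Euclidean_space_def euclidean_product_topology)
  have WE: "?W \<subseteq> {x. \<forall>k\<ge>4. x k = 0}" by (auto simp: chart_eq_0)
  \<comment> \<open>Near the coordinates of a net all parameters are good, and a good parameter with
    zero entries from index 4 on is the coordinate vector of its own section net.\<close>
  have "openin ?E ?W"
  proof (subst openin_subopen, intro ballI)
    fix x0 assume "x0 \<in> ?W"
    then obtain f where f: "f \<in> IC_nets ?P" "x0 = ?\<phi> f" using X by auto
    obtain S where S: "open S" "x0 \<in> S" "\<And>x. x \<in> S \<Longrightarrow> ?good x"
      using chart_inverse(2)[OF f(1) sz f(2)] unfolding eventually_nhds by blast
    have "x \<in> ?W" if "x \<in> S" "\<forall>k\<ge>4. x k = 0" for x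
    proof -
      have "?\<sigma> x \<in> topspace ?X" "?\<phi> (?\<sigma> x) = x"
        using section_net_IC_nets chart_section_net S(3)[OF that(1)] sz that(2) X by auto
      then show ?thesis by (metis imageI)
    qed
    then have "S \<inter> {x. \<forall>k\<ge>4. x k = 0} \<subseteq> ?W" by blast
    moreover have "openin ?E (S \<inter> {x. \<forall>k\<ge>4. x k = 0})"
      unfolding E openin_open using S(1) by blast
    ultimately show "\<exists>T. openin ?E T \<and> x0 \<in> T \<and> T \<subseteq> ?W"
      using S(2) \<open>x0 \<in> ?W\<close> WE by blast
  qed
  moreover have "IC_net_moduli ?P homeomorphic_space subtopology ?E ?W"
    unfolding IC_net_moduli_def
  proof (rule quotient_space_homeomorphic_image[OF equiv])
    show "continuous_map ?X ?E ?\<phi>" by (rule continuous_map_chart[OF sz(1,2)])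
    have sub: "subtopology ?E ?W = top_of_set ?W"
      unfolding E subtopology_subtopology using WE by (simp add: Int_absorb1)
    have img: "?\<sigma> x \<in> IC_nets ?P" if "x \<in> ?W" for x
    proof -
      obtain f where f: "f \<in> IC_nets ?P" "x = ?\<phi> f" using \<open>x \<in> ?W\<close> X by auto
      then show ?thesis using chart_inverse(1)[OF f(1) sz f(2)] by (simp add: similar_nets_def)
    qed
    have "continuous_map (top_of_set ?W) (product_topology (\<lambda>_. euclidean) ?P) ?\<sigma>"
      unfolding continuous_map_componentwise
    proof (intro conjI ballI)
      show "?\<sigma> ` topspace (top_of_set ?W) \<subseteq> extensional ?P"
        using section_net_extensional by auto
      fix z assume z: "z \<in> ?P"
      have "continuous_on ?W (\<lambda>x. ?\<sigma> x z)"
        unfolding continuous_on_def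
      proof
        fix x0 assume "x0 \<in> ?W"
        then obtain f where f: "f \<in> IC_nets ?P" "x0 = ?\<phi> f" using X by auto
        show "((\<lambda>x. ?\<sigma> x z) \<longlongrightarrow> ?\<sigma> x0 z) (at x0 within ?W)"
          by (rule tendsto_mono[OF _ chart_inverse(3)[OF f(1) sz f(2) z]])
            (simp add: at_within_def)
      qed
      then show "continuous_map (top_of_set ?W) euclidean (\<lambda>x. ?\<sigma> x z)" by simp
    qed
    moreover have "continuous_map Z ?X h \<longleftrightarrow> continuous_map Z (product_topology (\<lambda>_. euclidean) ?P) h \<and>
      h \<in> topspace Z \<rightarrow> IC_nets ?P" for Z :: "(nat \<Rightarrow> real) topology" and h
      unfolding IC_net_topology_def by (auto simp: continuous_map_in_subtopology)
    moreover have "?\<sigma> \<in> topspace (top_of_set ?W) \<rightarrow> IC_nets ?P"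
      using img by (simp add: Pi_iff)
    ultimately show "continuous_map (subtopology ?E ?W) ?X ?\<sigma>"
      unfolding sub by blast
    show "(f, ?\<sigma> (?\<phi> f)) \<in> similar_nets ?P" if "f \<in> topspace ?X" for f
      using chart_inverse(1) sz that X by auto
    show inv: "?\<phi> f = ?\<phi> g" if "(f, g) \<in> similar_nets ?P" for f g
      using chart_similar[OF that sz(1,2)] .
    show "?\<phi> (?\<sigma> x) = x" if "x \<in> ?W" for x
    proof -
      obtain f where f: "f \<in> IC_nets ?P" "x = ?\<phi> f" using \<open>x \<in> ?W\<close> X by auto
      then show ?thesis using inv[OF chart_inverse(1)[OF f(1) sz f(2)]] by simp
    qed
  qed
  ultimately show ?thesis using topological_manifold_if_homeomorphic_open by blast
qed

section \<open>Uniqueness from the five lines, and the conclusion\<close>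

lemma mem_line_l:
  assumes "line_frame P f p q" "z \<in> line_l P f i"
  shows "p i \<bullet> hat z = 0"
proof -
  have "{f (i, j) |j. (i, j) \<in> P} \<subseteq> {z. normal (p i) \<bullet> z = p i $ 3}"
    using line_frameD(3)[OF assms(1)] by (auto simp: inner_hat)
  then have "line_l P f i \<subseteq> {z. normal (p i) \<bullet> z = p i $ 3}"
    unfolding line_l_def by (rule hull_minimal) (rule affine_hyperplane)
  then show ?thesis using assms(2) by (auto simp: inner_hat)
qed

lemma mem_line_m:
  assumes "line_frame P f p q" "z \<in> line_m P f j"
  shows "q j \<bullet> hat z = 0"
proof -
  have "{f (i, j) |i. (i, j) \<in> P} \<subseteq> {z. normal (q j) \<bullet> z = q j $ 3}"
    using line_frameD(4)[OF assms(1)] by (auto simp: inner_hat)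
  then have "line_m P f j \<subseteq> {z. normal (q j) \<bullet> z = q j $ 3}"
    unfolding line_m_def by (rule hull_minimal) (rule affine_hyperplane)
  then show ?thesis using assms(2) by (auto simp: inner_hat)
qed

lemma oriented_line_unique:
  assumes "ldot u u = 1" "ldot v v = 1" "y \<noteq> z"
    and "u \<bullet> hat y = 0" "u \<bullet> hat z = 0" "v \<bullet> hat y = 0" "v \<bullet> hat z = 0" and "0 < (u \<bullet> hat x) * (v \<bullet> hat x)"
  shows "v = u"
proof -
  have "v = u \<or> v = - u" using line_eq_or_minus assms(1-7) by blast
  moreover have "v \<noteq> - u"
    using assms(8) by (auto simp: not_less)
  ultimately show ?thesis by blast
qed

text \<open>The five unoriented lines fix their six intersection points. Since both nets orient
  their lines by the position of these points, the oriented lines agree as well, and the rest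
  follows by propagation.\<close>

lemma IC_net_determined_by_lines:
  assumes size: "m1 < 0" "2 < m2" "n1 < 0" "1 < n2" "4 \<le> n2 - n1 \<or> m2 - m1 = 4"
    and P: "P = rect m1 m2 n1 n2" and fg: "f \<in> IC_nets P" "g \<in> IC_nets P"
    and l: "line_l P f 0 = line_l P g 0" "line_l P f 1 = line_l P g 1" "line_l P f 2 = line_l P g 2"
    and m: "line_m P f 0 = line_m P g 0" "line_m P f 1 = line_m P g 1"
  shows "f = g"
proof -
  obtain p q where A: "circular_net m1 m2 n1 n2 f p q"
    using IC_net_circular_net[of m1 m2 n1 n2 f] fg size by (auto simp: IC_nets_def P)
  obtain p' q' where B: "circular_net m1 m2 n1 n2 g p' q'"
    using IC_net_circular_net[of m1 m2 n1 n2 g] fg size by (auto simp: IC_nets_def P)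
  interpret A: circular_net m1 m2 n1 n2 f p q by fact
  interpret B: circular_net m1 m2 n1 n2 g p' q' by fact
  have eq: "g (i, j) = f (i, j)" if "i = 0 \<or> i = 1 \<or> i = 2" "j = 0 \<or> j = 1" for i j
  proof -
    have ij: "m1 < i" "i < m2" "n1 < j" "j < n2" "(i, j) \<in> P" using that size P by auto
    have "g (i, j) \<in> line_l P g i" "g (i, j) \<in> line_m P g j"
      unfolding line_l_def line_m_def using ij(5) by (auto intro!: hull_inc)
    then have "g (i, j) \<in> line_l P f i" "g (i, j) \<in> line_m P f j" using l m that by auto
    then have "p i \<bullet> hat (g (i, j)) = 0" "q j \<bullet> hat (g (i, j)) = 0"
      using mem_line_l mem_line_m A.line_frame P by blast+
    then show ?thesis
      using intersection_unique[OF A.cross_nonzero[OF ij(1-4)]] A.frameD(3,4)[of i j] ij by blast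
  qed
  have e: "g (0, 0) = f (0, 0)" "g (1, 0) = f (1, 0)" "g (2, 0) = f (2, 0)"
      "g (0, 1) = f (0, 1)" "g (1, 1) = f (1, 1)" "g (2, 1) = f (2, 1)"
    using eq by auto
  have "p' 0 = p 0"
    using A.frameD[of 0 0] B.frameD[of 0 0] A.frameD[of 0 1] B.frameD[of 0 1] size e
    by (intro oriented_line_unique[of _ _ "f (0, 0)" "f (0, 1)" "f (1, 0)"]) auto
  moreover have "p' 1 = p 1"
    using A.frameD[of 1 0] B.frameD[of 1 0] A.frameD[of 1 1] B.frameD[of 1 1] size e
    by (intro oriented_line_unique[of _ _ "f (1, 0)" "f (1, 1)" "f (2, 0)"]) auto
  \<comment> \<open>Index 3 may lie outside the rectangle, so l_2 is oriented by a point of l_1,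
    where both signed distances are negative.\<close>
  moreover have "p' 2 = p 2"
    using A.frameD[of 2 0] B.frameD[of 2 0] A.frameD[of 2 1] B.frameD[of 2 1] A.frameD(6)[of 1 0] B.frameD(6)[of 1 0] size e
    by (intro oriented_line_unique[of _ _ "f (2, 0)" "f (2, 1)" "f (1, 0)"]) (auto simp: mult_neg_neg)
  moreover have "q' 0 = q 0"
    using A.frameD[of 0 0] B.frameD[of 0 0] A.frameD[of 1 0] B.frameD[of 1 0] size e
    by (intro oriented_line_unique[of _ _ "f (0, 0)" "f (1, 0)" "f (0, 1)"]) auto
  ultimately have "g (i, j) = f (i, j)" if "m1 < i" "i < m2" "n1 < j" "j < n2" for i j
    using frames_agree(3)[OF A B, of 0 0 i j] size that by simp
  then have "f z = g z" if "z \<in> P" for z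
    using that P by (cases z) simp
  then show "f = g"
    using fg unfolding IC_nets_def by (intro extensionalityI[of f P g]) auto
qed

theorem corollary2p10:
  fixes m1 m2 n1 n2 :: int and P :: "(int \<times> int) set"
  assumes P: "P = rect m1 m2 n1 n2"
    and "m1 < 0" "2 < m2" "n1 < 0" "1 < n2"
    and "4 \<le> n2 - n1 \<or> m2 - m1 = 4"
  shows "topspace (IC_net_moduli P) \<noteq> {} \<and> topological_manifold 4 (IC_net_moduli P) \<and>
    (\<forall>f \<in> IC_nets P. \<forall>g \<in> IC_nets P. \<forall>c0 r0 c1 r1.
       net_incircle f 0 0 c0 r0 \<and> net_incircle g 0 0 c0 r0 \<and>
       net_incircle f 1 0 c1 r1 \<and> net_incircle g 1 0 c1 r1 \<and>
       line_l P f 0 = line_l P g 0 \<and> line_l P f 1 = line_l P g 1 \<and> line_l P f 2 = line_l P g 2 \<and>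
       line_m P f 0 = line_m P g 0 \<and> line_m P f 1 = line_m P g 1 \<longrightarrow>
       f = g)"
proof (intro conjI ballI allI impI)
  have "equiv (topspace (IC_net_topology P)) (similar_nets P)"
    unfolding topspace_IC_net_topology by (rule equiv_similar_nets)
  then have "topspace (IC_net_moduli P) = IC_nets P // similar_nets P"
    unfolding IC_net_moduli_def by (simp add: topspace_quotient_space topspace_IC_net_topology)
  moreover have "IC_nets P \<noteq> {}"
    using square_grid_IC_net[of m1 m2 n1 n2] assms by auto
  ultimately show "topspace (IC_net_moduli P) \<noteq> {}" by simp
  show "topological_manifold 4 (IC_net_moduli P)"
    unfolding P by (rule topological_manifold_IC_net_moduli) (use assms in auto)
  show "f = g" if "f \<in> IC_nets P" "g \<in> IC_nets P"
    "net_incircle f 0 0 c0 r0 \<and> net_incircle g 0 0 c0 r0 \<and>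
       net_incircle f 1 0 c1 r1 \<and> net_incircle g 1 0 c1 r1 \<and>
       line_l P f 0 = line_l P g 0 \<and> line_l P f 1 = line_l P g 1 \<and> line_l P f 2 = line_l P g 2 \<and>
       line_m P f 0 = line_m P g 0 \<and> line_m P f 1 = line_m P g 1" for f g c0 r0 c1 r1
    using IC_net_determined_by_lines[OF assms(2-6) P that(1,2)] that(3) by blast
qed

end
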